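(* Consider the second-price auction regression model with unknown parameters $W^\star=[w_1^\star,\dots,w_k^\star]\in\mathbb{R}^{d\times k}$ satisfying the separability and boundedness assumption with constants $c\in(0,1]$, $C\ge1$. Then: (1) (Information preservation) There exist an absolute constant $K>0$ and a constant $a>0$ depending only on $c,C$ such that for all $V,W\in\mathbb{R}^{d\times k}$ with $\|V-W^\star\|_F\le a/\log k$ and $\|W-W^\star\|_F\le a/\log k$, \[ d_{TV}\big(\mathcal{M}(V),\mathcal{M}(W)\big)\ge\Big(\frac{c}{ek}\Big)^{K C^2/c^2}\|V-W\|_F. \] (2) (Local convexity) There exists a constant $\beta>0$ depending only on $c,C$ such that for every $W\in\mathbb{R}^{d\times k}$ with $\|W-W^\star\|_F\le k^{-\beta}$, $\nabla^2\mathcal{L}(W)\succeq0$.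
   Context: Second-price auction regression model with parameters $W=[w_1,\dots,w_k]$: draw $x\sim\mathcal{N}(0,I_d)$ and independent $\xi_1,\dots,\xi_k\sim\mathcal{N}(0,1)$, set $y_i=x^\top w_i+\xi_i$, $i_{\max}=\arg\max_iy_i$, $y_{\mathrm{smax}}=\max_{j\ne i_{\max}}y_j$; observe $(x,i_{\max},y_{\mathrm{smax}})$. $\mathcal{M}(W)$ is the distribution of $(x,i_{\max},y_{\mathrm{smax}})$ under parameters $W$. Separability and boundedness: $\|w_i^\star\|_2^2\ge c+\max_{j\ne i}|\langle w_j^\star,w_i^\star\rangle|$ for all $i$ and $\max_i\|w_i^\star\|_2\le C$. For $s\in\mathbb{R}$, $i\in[k]$, let $P(s,i)=\{z\in\mathbb{R}^k: z_i=\max_jz_j,\ \max_{j\ne i}z_j=s\}$. The population negative log-likelihood is $\mathcal{L}(W)=\mathbb{E}_{(x,y_{\mathrm{smax}},i_{\max})\sim\mathcal{M}(W^\star)}\big[-\log\int_{P(y_{\mathrm{smax}},i_{\max})}\exp(-\tfrac12\|z-W^\top x\|_2^2)\,dz\big]$ (integral w.r.t. $(k-1)$-dimensional surface measure); $\nabla^2\mathcal{L}$ is its Hessian on $\mathbb{R}^{dk}$. $d_{TV}$ is total variation distance. (For $k=1$, $a/\log k$ is read as $+\infty$.)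
   Formalization: The formal theorem assumes k ≥ 2: for k = 1 the second price y_smax is a maximum over the empty set, so M(W) and L are undefined (and under any fixed convention M(W) would not depend on W, making (1) false). *)

theory Defs
  imports "HOL-Probability.Probability"
begin

text \<open>Conventions: a d x k matrix W is a function nat => nat => real, entry W l i
  (row l < d, column i < k); its i-th column w_i is (%l. W l i).  Entries outside
  the range are irrelevant for every notion below.\<close>

definition N01 :: "real measure" where
  "N01 = density lborel std_normal_density"

definition colnorm2 :: "nat \<Rightarrow> (nat \<Rightarrow> nat \<Rightarrow> real) \<Rightarrow> nat \<Rightarrow> real" where
  "colnorm2 d W i = (\<Sum>l<d. (W l i)\<^sup>2)"

definition colinner :: "nat \<Rightarrow> (nat \<Rightarrow> nat \<Rightarrow> real) \<Rightarrow> nat \<Rightarrow> nat \<Rightarrow> real" where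
  "colinner d W i j = (\<Sum>l<d. W l i * W l j)"

definition frob :: "nat \<Rightarrow> nat \<Rightarrow> (nat \<Rightarrow> nat \<Rightarrow> real) \<Rightarrow> real" where
  "frob d k W = sqrt (\<Sum>l<d. \<Sum>i<k. (W l i)\<^sup>2)"

definition mdiff :: "(nat \<Rightarrow> nat \<Rightarrow> real) \<Rightarrow> (nat \<Rightarrow> nat \<Rightarrow> real) \<Rightarrow> (nat \<Rightarrow> nat \<Rightarrow> real)" where
  "mdiff V W = (\<lambda>l i. V l i - W l i)"

text \<open>Separability and boundedness assumption (max over j ~= i written out).\<close>
definition sep_bounded :: "nat \<Rightarrow> nat \<Rightarrow> real \<Rightarrow> real \<Rightarrow> (nat \<Rightarrow> nat \<Rightarrow> real) \<Rightarrow> bool" where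
  "sep_bounded d k c C W \<longleftrightarrow>
     (\<forall>i<k. \<forall>j<k. j \<noteq> i \<longrightarrow> colnorm2 d W i \<ge> c + \<bar>colinner d W j i\<bar>) \<and>
     (\<forall>i<k. sqrt (colnorm2 d W i) \<le> C)"

definition WTx :: "nat \<Rightarrow> (nat \<Rightarrow> nat \<Rightarrow> real) \<Rightarrow> (nat \<Rightarrow> real) \<Rightarrow> nat \<Rightarrow> real" where
  "WTx d W x = (\<lambda>i. \<Sum>l<d. W l i * x l)"

text \<open>Index of the maximum (ties, a null event, broken towards the least index)
  and the second-largest value.\<close>
definition imax :: "nat \<Rightarrow> (nat \<Rightarrow> real) \<Rightarrow> nat" where
  "imax k y = (LEAST i. i < k \<and> (\<forall>j<k. y j \<le> y i))"

definition ysmax :: "nat \<Rightarrow> (nat \<Rightarrow> real) \<Rightarrow> real" where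
  "ysmax k y = Max (y ` ({..<k} - {imax k y}))"

definition obs_space :: "nat \<Rightarrow> nat \<Rightarrow> ((nat \<Rightarrow> real) \<times> nat \<times> real) measure" where
  "obs_space d k = (PiM {..<d} (\<lambda>_. borel)) \<Otimes>\<^sub>M (count_space {..<k} \<Otimes>\<^sub>M (borel :: real measure))"

definition auction_model :: "nat \<Rightarrow> nat \<Rightarrow> (nat \<Rightarrow> nat \<Rightarrow> real) \<Rightarrow> ((nat \<Rightarrow> real) \<times> nat \<times> real) measure" where
  "auction_model d k W =
     distr (PiM {..<d} (\<lambda>_. N01) \<Otimes>\<^sub>M PiM {..<k} (\<lambda>_. N01)) (obs_space d k)
       (\<lambda>(x, \<xi>). let y = (\<lambda>i. WTx d W x i + \<xi> i) in (x, imax k y, ysmax k y))"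

definition dTV :: "'a measure \<Rightarrow> 'a measure \<Rightarrow> real" where
  "dTV M N = (SUP A \<in> sets M. \<bar>measure M A - measure N A\<bar>)"

definition Pset :: "nat \<Rightarrow> real \<Rightarrow> nat \<Rightarrow> (nat \<Rightarrow> real) set" where
  "Pset k s i = {z. z i = Max (z ` {..<k}) \<and> Max (z ` ({..<k} - {i})) = s}"

text \<open>Integral over P(s,i) w.r.t. (k-1)-dimensional surface measure.  P(s,i) is the
  union over j ~= i of its parts lying in the hyperplanes {z_j = s}; on such a
  hyperplane surface measure is Lebesgue measure in the remaining k-1 coordinates,
  and the pairwise overlaps are surface-null.\<close>
definition surf_int :: "nat \<Rightarrow> real \<Rightarrow> nat \<Rightarrow> ((nat \<Rightarrow> real) \<Rightarrow> real) \<Rightarrow> real" where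
  "surf_int k s i f =
     (\<Sum>j\<in>{..<k} - {i}. \<integral>z. indicator (Pset k s i) (z(j := s)) * f (z(j := s))
        \<partial>(PiM ({..<k} - {j}) (\<lambda>_. lborel)))"

definition popNLL :: "nat \<Rightarrow> nat \<Rightarrow> (nat \<Rightarrow> nat \<Rightarrow> real) \<Rightarrow> (nat \<Rightarrow> nat \<Rightarrow> real) \<Rightarrow> real" where
  "popNLL d k Wstar W =
     (\<integral>(x, i, s). - ln (surf_int k s i (\<lambda>z. exp (- (1/2) * (\<Sum>l<k. (z l - WTx d W x l)\<^sup>2))))
        \<partial>(auction_model d k Wstar))"

definition shift :: "(nat \<Rightarrow> nat \<Rightarrow> real) \<Rightarrow> nat \<times> nat \<Rightarrow> real \<Rightarrow> (nat \<Rightarrow> nat \<Rightarrow> real)" where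
  "shift W p t = (\<lambda>l i. if (l, i) = p then W l i + t else W l i)"

definition partial_deriv :: "((nat \<Rightarrow> nat \<Rightarrow> real) \<Rightarrow> real) \<Rightarrow> (nat \<Rightarrow> nat \<Rightarrow> real) \<Rightarrow> nat \<times> nat \<Rightarrow> real" where
  "partial_deriv F W p = deriv (\<lambda>t. F (shift W p t)) 0"

definition hessian_psd :: "nat \<Rightarrow> nat \<Rightarrow> ((nat \<Rightarrow> nat \<Rightarrow> real) \<Rightarrow> real) \<Rightarrow> (nat \<Rightarrow> nat \<Rightarrow> real) \<Rightarrow> bool" where
  "hessian_psd d k F W \<longleftrightarrow>
     (\<exists>e>0. \<forall>U. frob d k (mdiff U W) < e \<longrightarrow>
        (\<forall>p \<in> {..<d} \<times> {..<k}. (\<lambda>t. F (shift U p t)) differentiable (at 0))) \<and>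
     (\<exists>H. (\<forall>p \<in> {..<d} \<times> {..<k}. \<forall>q \<in> {..<d} \<times> {..<k}.
            ((\<lambda>t. partial_deriv F (shift W q t) p) has_real_derivative H p q) (at 0)) \<and>
          (\<forall>v. (\<Sum>p \<in> {..<d} \<times> {..<k}. \<Sum>q \<in> {..<d} \<times> {..<k}. v p * H p q * v q) \<ge> 0))"

end

theory Submission
  imports Defs
begin

text \<open>
  Given x, put \<open>\<mu> = W\<^sup>T x\<close>; the observation (i, s) has density
  \<open>p\<^sub>i(s; \<mu>) = Q(s - \<mu>\<^sub>i) d/ds \<Prod>\<^sub>j\<^sub>\<noteq>\<^sub>i \<Phi>(s - \<mu>\<^sub>j)\<close>.
  Look at s far above all means. If the means move to \<open>\<mu>'\<close>, the log density at (i, s) changes by the change of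
  \<open>ln Q(s - \<mu>\<^sub>i)\<close> plus, up to a negligible term, the change of a log-sum of the normal densities at
  \<open>s - \<mu>\<^sub>j\<close>, \<open>j \<noteq> i\<close>, hence plus at most the largest change of a single log density. Because the hazard rate
  of the normal law at v exceeds v by a definite amount, the coordinate i whose log tail changes most cannot be compensated by the
  others. So for each such s some index i has a log density gap comparable to \<open>max\<^sub>j |\<mu>'\<^sub>j - \<mu>\<^sub>j|\<close>,
  at a level s whose density is polynomially small in k. Averaging over typical x bounds from below the total variation distance
  (first claim) and the Kullback-Leibler divergence, quadratically.

  For the second claim, the Kullback-Leibler bound gives a lower bound on the Hessian at W of the negative log-likelihood with data
  from the model at W itself. Replacing the data distribution by the one at \<open>W\<^sup>\<star>\<close> changes the Hessian by at most
  a polynomial in k times \<open>\<parallel>W - W\<^sup>\<star>\<parallel>\<close>: the log densities are Lipschitz in the means, and all that enters are sixth moments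
  of linear forms in x, which do not depend on d.
\<close>

section \<open>The normal distribution function and the Mills ratio\<close>

abbreviation nd :: "real \<Rightarrow> real" where "nd \<equiv> std_normal_density"

definition ncdf :: "real \<Rightarrow> real" where "ncdf z = measure N01 {..z}"

definition rhaz :: "real \<Rightarrow> real" where "rhaz z = nd z / ncdf z"

lemma nd_pos [simp]: "0 < nd z" "0 \<le> nd z"
  using normal_density_pos[of 1 0 z] by (simp_all add: less_imp_le)

lemma nd_minus [simp]: "nd (- z) = nd z"
  by (simp add: std_normal_density_def)

lemma nd_le: "nd z \<le> 2/5 * exp (- z\<^sup>2 / 2)"
proof -
  have "(5/2)\<^sup>2 \<le> 2 * pi" using pi_approx by (simp add: power2_eq_square)
  then have "5/2 \<le> sqrt (2*pi)" by (rule real_le_rsqrt)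
  then have "1 / sqrt (2*pi) \<le> 2/5" by (simp add: field_simps)
  then show ?thesis unfolding std_normal_density_def by (intro mult_right_mono) auto
qed

lemma nd_le_const: "nd z \<le> 2/5"
proof -
  have "exp (- z\<^sup>2 / 2) \<le> 1" by simp
  then show ?thesis using nd_le[of z] by linarith
qed

lemma nd_ge: "1/3 * exp (- z\<^sup>2 / 2) \<le> nd z"
proof -
  have "2 * pi \<le> 3\<^sup>2" using pi_approx by (simp add: power2_eq_square)
  then have "sqrt (2*pi) \<le> 3" by (simp add: real_le_lsqrt)
  then have "1/3 \<le> 1 / sqrt (2*pi)" by (simp add: field_simps)
  then show ?thesis unfolding std_normal_density_def by (intro mult_right_mono) auto
qed

lemma has_real_derivative_nd: "(nd has_real_derivative (- z * nd z)) (at z)"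
proof -
  have "((\<lambda>z. 1 / sqrt (2 * pi) * exp (- z\<^sup>2 / 2)) has_real_derivative 1 / sqrt (2 * pi) * (exp (- z\<^sup>2 / 2) * (- z))) (at z)"
    by (rule derivative_eq_intros refl | simp)+
  then show ?thesis unfolding std_normal_density_def by (simp add: mult_ac)
qed

lemma prob_space_N01: "prob_space N01"
  unfolding N01_def by (rule prob_space_normal_density) simp

interpretation N01: prob_space N01 by (rule prob_space_N01)

lemma space_N01 [simp]: "space N01 = UNIV" and sets_N01 [measurable_cong, simp]: "sets N01 = sets borel"
  by (auto simp: N01_def)

lemma emeasure_N01: "A \<in> sets borel \<Longrightarrow> emeasure N01 A = (\<integral>\<^sup>+ z. ennreal (nd z) * indicator A z \<partial>lborel)"
  unfolding N01_def by (subst emeasure_density) auto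

lemma measure_N01_Ioc:
  assumes "a \<le> b"
  shows "measure N01 {a<..b} = integral {a..b} nd"
proof -
  have c: "continuous_on {a..b} nd"
    by (rule DERIV_continuous_on[OF has_field_derivative_at_within[OF has_real_derivative_nd]])
  have "measure N01 {a<..b} = (LBINT z. indicator {a<..b} z * nd z)"
    by (simp add: measure_def emeasure_N01 integral_eq_nn_integral ennreal_mult'' ennreal_indicator mult.commute)
  also have "\<dots> = (LBINT z. indicator {a..b} z * nd z)"
    by (rule integral_cong_AE) (use AE_lborel_singleton[of a] in \<open>auto elim!: eventually_mono split: split_indicator\<close>)
  also have "\<dots> = integral {a..b} nd"
    using set_borel_integral_eq_integral(2)[of "{a..b}" nd] borel_integrable_atLeastAtMost'[OF c]
    by (simp add: set_lebesgue_integral_def)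
  finally show ?thesis .
qed

lemma ncdf_diff:
  assumes "a \<le> b"
  shows "ncdf b = ncdf a + integral {a..b} nd"
proof -
  have "{..b} = {..a} \<union> {a<..b}" using assms by auto
  then have "measure N01 {..b} = measure N01 {..a} + measure N01 {a<..b}"
    by (simp only:) (rule N01.finite_measure_Union, auto)
  then show ?thesis using measure_N01_Ioc[OF assms] by (simp add: ncdf_def)
qed

lemma has_real_derivative_ncdf: "(ncdf has_real_derivative nd z) (at z)"
proof -
  have c: "continuous_on {z-1..z+1} nd"
    by (rule DERIV_continuous_on[OF has_field_derivative_at_within[OF has_real_derivative_nd]])
  have "((\<lambda>x. ncdf (z-1) + integral {z-1..x} nd) has_real_derivative 0 + nd z) (at z within {z-1..z+1})"
    by (intro DERIV_add DERIV_const integral_has_real_derivative c) auto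
  then have "(ncdf has_real_derivative 0 + nd z) (at z within {z-1..z+1})"
    by (rule has_field_derivative_transform_within[of _ _ _ _ 1]) (auto intro: ncdf_diff[symmetric])
  then have "(ncdf has_real_derivative 0 + nd z) (at z within {z-1<..<z+1})"
    by (rule DERIV_subset) auto
  then show ?thesis by (simp add: at_within_open[of z "{z-1<..<z+1}"])
qed

lemma has_real_derivative_ncdf' [derivative_intros]:
  assumes "(f has_real_derivative f') (at z within s)"
  shows "((\<lambda>z. ncdf (f z)) has_real_derivative (nd (f z) * f')) (at z within s)"
  using DERIV_chain2[OF has_real_derivative_ncdf assms] .

lemma ncdf_pos [simp]: "0 < ncdf z" "0 \<le> ncdf z"
proof -
  have "ncdf (z-1) < ncdf z"
    by (rule DERIV_pos_imp_increasing[of "z-1" z ncdf], simp) (use has_real_derivative_ncdf nd_pos in blast)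
  then show "0 < ncdf z" unfolding ncdf_def by (smt (verit) measure_nonneg)
  then show "0 \<le> ncdf z" by simp
qed

lemma measure_N01_singleton: "emeasure N01 {z} = 0"
  using AE_lborel_singleton[of z]
  by (subst emeasure_N01) (auto simp: nn_integral_0_iff_AE elim!: eventually_mono split: split_indicator)

lemma emeasure_N01_uminus:
  assumes [measurable]: "A \<in> sets borel"
  shows "emeasure N01 (uminus -` A) = emeasure N01 A"
proof -
  have "emeasure N01 A = (\<integral>\<^sup>+ z. ennreal (nd z) * indicator A z \<partial>lborel)"
    by (simp add: emeasure_N01)
  also have "\<dots> = (\<integral>\<^sup>+ z. ennreal (nd z) * indicator A (- z) \<partial>lborel)"
    using nn_integral_real_affine[of "\<lambda>z. ennreal (nd z) * indicator A z" "-1" 0] by simp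
  also have "\<dots> = emeasure N01 (uminus -` A)"
    by (subst emeasure_N01) (auto intro!: nn_integral_cong measurable_sets_borel[OF borel_measurable_uminus] split: split_indicator)
  finally show ?thesis by simp
qed

lemma emeasure_N01_atMost: "emeasure N01 {..z} = ennreal (ncdf z)"
  by (simp add: ncdf_def N01.emeasure_eq_measure)

lemma emeasure_N01_lessThan: "emeasure N01 {..<z} = ennreal (ncdf z)"
proof -
  have "emeasure N01 {..z} = emeasure N01 ({..<z} \<union> {z})"
    by (rule arg_cong[of _ _ "emeasure N01"]) auto
  also have "\<dots> = emeasure N01 {..<z}"
    by (rule emeasure_Un_null_set) (auto simp: null_sets_def measure_N01_singleton)
  finally show ?thesis by (simp add: emeasure_N01_atMost)
qed

lemma emeasure_N01_greaterThan: "emeasure N01 {z<..} = ennreal (ncdf (- z))"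
proof -
  have "uminus -` {z<..} = {..< - z}" by auto
  then show ?thesis
    using emeasure_N01_uminus[of "{z<..}"] emeasure_N01_lessThan[of "-z"] by simp
qed

lemma ncdf_minus: "ncdf (- z) = 1 - ncdf z"
proof -
  have "{z<..} = space N01 - {..z}" by auto
  then have "measure N01 {z<..} = 1 - ncdf z"
    using N01.prob_compl[of "{..z}"] by (simp add: ncdf_def)
  moreover have "measure N01 {z<..} = ncdf (- z)"
    using emeasure_N01_greaterThan[of z] by (simp add: measure_def)
  ultimately show ?thesis by simp
qed

lemma ncdf_mono: "a \<le> b \<Longrightarrow> ncdf a \<le> ncdf b"
  unfolding ncdf_def by (rule N01.finite_measure_mono) auto

lemma ncdf_ge_half: "0 \<le> z \<Longrightarrow> 1/2 \<le> ncdf z"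
  using ncdf_minus[of 0] ncdf_mono[of 0 z] by simp

lemma ncdf_at_bot: "(ncdf \<longlongrightarrow> 0) at_bot"
proof -
  interpret real_distribution N01 by (simp add: real_distribution_def real_distribution_axioms_def prob_space_N01)
  show ?thesis using cdf_lim_at_bot by (simp add: cdf_def ncdf_def [abs_def])
qed

lemma ncdf_minus_at_top: "((\<lambda>v. ncdf (- v)) \<longlongrightarrow> 0) at_top"
  using filterlim_compose[OF ncdf_at_bot filterlim_uminus_at_bot_at_top] by (simp add: o_def)

lemma nd_at_top: "(nd \<longlongrightarrow> 0) at_top"
proof -
  have "((\<lambda>z::real. 2/5 * exp (- z\<^sup>2 / 2)) \<longlongrightarrow> 0) at_top" by real_asymp
  then show ?thesis
    by (rule tendsto_sandwich[OF _ _ tendsto_const, rotated 2]) (use nd_le in auto)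
qed

text \<open>A candidate r for the Mills ratio Q/phi is compared with it through the sign of (phi r - Q)',
  because phi r - Q vanishes at infinity.\<close>

lemma mills_compare:
  fixes r r' :: "real \<Rightarrow> real"
  assumes r: "\<And>v. v \<ge> a \<Longrightarrow> (r has_real_derivative r' v) (at v)"
    and le: "\<And>v. v \<ge> a \<Longrightarrow> \<sigma> * (v * r v - r' v - 1) \<ge> 0"
    and lim: "(r \<longlongrightarrow> l) at_top"
  shows "\<sigma> * (nd a * r a - ncdf (- a)) \<ge> 0"
proof -
  let ?D = "\<lambda>v. \<sigma> * (nd v * r v - ncdf (- v))"
  have d: "(?D has_real_derivative (- nd v * (\<sigma> * (v * r v - r' v - 1)))) (at v)" if "v \<ge> a" for v
  proof -
    have "(?D has_real_derivative \<sigma> * ((nd v * r' v + (- v * nd v) * r v) - nd (- v) * (- 1))) (at v)"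
      by (intro DERIV_cmult DERIV_diff DERIV_mult' has_real_derivative_ncdf' has_real_derivative_nd DERIV_minus DERIV_ident r that)
    then show ?thesis by (simp add: algebra_simps)
  qed
  have mono: "?D v \<le> ?D a" if "v \<ge> a" for v
  proof (rule DERIV_nonpos_imp_nonincreasing[OF that])
    fix w assume "a \<le> w" "w \<le> v"
    then show "\<exists>y. (?D has_real_derivative y) (at w) \<and> y \<le> 0"
      using d[of w] mult_nonneg_nonneg[OF nd_pos(2)[of w] le[of w]] by (intro exI conjI) auto
  qed
  have "(?D \<longlongrightarrow> \<sigma> * (0 * l - 0)) at_top"
    by (intro tendsto_intros nd_at_top lim ncdf_minus_at_top)
  then have "0 \<le> ?D a"
    by (intro tendsto_upperbound[of ?D _ at_top]) (auto simp: eventually_at_top_linorder intro!: exI[of _ a] mono)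
  then show ?thesis .
qed

lemma ncdf_minus_ge:
  assumes v: "0 \<le> v"
  shows "nd v / (v + 2) \<le> ncdf (- v)"
proof -
  have "-1 * (nd v * (1 / (v + 2)) - ncdf (- v)) \<ge> 0"
  proof (rule mills_compare[of v "\<lambda>v. 1 / (v + 2)" "\<lambda>v. - 1 / (v + 2)\<^sup>2" "-1" 0])
    fix u assume "u \<ge> v"
    with v have u: "u \<ge> 0" by simp
    then show "((\<lambda>v. 1 / (v + 2)) has_real_derivative - 1 / (u + 2)\<^sup>2) (at u)"
      by (auto intro!: derivative_eq_intros simp: power2_eq_square)
    show "0 \<le> -1 * (u * (1 / (u + 2)) - - 1 / (u + 2)\<^sup>2 - 1)"
    proof -
      have "- 1 * (u * (1 / (u + 2)) - - 1 / (u + 2)\<^sup>2 - 1) = (2 * u + 3) / (u + 2)\<^sup>2"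
        using u by (simp add: divide_simps) (simp add: algebra_simps power2_eq_square)
      then show ?thesis using u by simp
    qed
  qed real_asymp
  then show ?thesis by simp
qed

lemma ncdf_minus_le:
  assumes v: "0 < v"
  shows "ncdf (- v) \<le> nd v * ((v\<^sup>2 + 2) / (v^3 + 3 * v))"
proof -
  define r where "r = (\<lambda>v::real. (v\<^sup>2 + 2) / (v^3 + 3 * v))"
  define r' where "r' = (\<lambda>v::real. (2 * v * (v^3 + 3 * v) - (v\<^sup>2 + 2) * (3 * v\<^sup>2 + 3)) / (v^3 + 3 * v)\<^sup>2)"
  have "1 * (nd v * r v - ncdf (- v)) \<ge> 0"
  proof (rule mills_compare)
    fix u assume "u \<ge> v"
    with v have u: "u > 0" by simp
    then have D: "u^3 + 3 * u > 0" by (simp add: add_pos_pos)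
    then show "(r has_real_derivative r' u) (at u)"
      unfolding r_def r'_def
      by (auto intro!: derivative_eq_intros simp: power2_eq_square)
    have "u * r u - r' u - 1 = 6 / (u^3 + 3 * u)\<^sup>2"
      unfolding r_def r'_def using D
      by (simp add: divide_simps) (simp add: algebra_simps power2_eq_square power3_eq_cube)
    then show "0 \<le> 1 * (u * r u - r' u - 1)" by simp
  next
    show "(r \<longlongrightarrow> 0) at_top" unfolding r_def by real_asymp
  qed
  then show ?thesis by (simp add: r_def)
qed

lemma rhaz_pos [simp]: "0 < rhaz z" "0 \<le> rhaz z"
  by (simp_all add: rhaz_def)

lemma rhaz_minus_ge:
  assumes v: "0 < v"
  shows "v + v / (v\<^sup>2 + 2) \<le> rhaz (- v)"
proof -
  have D: "v^3 + 3 * v > 0" using v by (simp add: add_pos_pos)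
  have "v + v / (v\<^sup>2 + 2) = (v^3 + 3 * v) / (v\<^sup>2 + 2)"
  proof -
    have "v\<^sup>2 + 2 \<noteq> 0" by (simp add: add_nonneg_eq_0_iff)
    then show ?thesis by (simp add: divide_simps) (simp add: algebra_simps power2_eq_square power3_eq_cube)
  qed
  also have "\<dots> \<le> rhaz (- v)"
  proof -
    have "v\<^sup>2 + 2 > 0" by (simp add: add_nonneg_pos)
    then have "(v^3 + 3 * v) * ncdf (- v) \<le> nd v * (v\<^sup>2 + 2)"
      using ncdf_minus_le[OF v] D by (simp add: pos_le_divide_eq mult.commute)
    then show ?thesis
      using \<open>v\<^sup>2 + 2 > 0\<close> by (simp add: rhaz_def divide_le_eq pos_le_divide_eq mult.commute)
  qed
  finally show ?thesis .
qed

lemma rhaz_minus_le: "0 \<le> v \<Longrightarrow> rhaz (- v) \<le> v + 2"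
  using ncdf_minus_ge[of v] by (simp add: rhaz_def pos_divide_le_eq mult.commute)

lemma rhaz_le_nd: "0 \<le> z \<Longrightarrow> rhaz z \<le> 2 * nd z"
  using mult_left_mono[OF ncdf_ge_half[of z], of "2 * nd z"] by (simp add: rhaz_def pos_divide_le_eq)

lemma rhaz_bound: "rhaz z \<le> 2 + \<bar>z\<bar>"
proof (cases "z \<ge> 0")
  case True
  then show ?thesis using rhaz_le_nd[of z] nd_le_const[of z] by simp
next
  case False
  then show ?thesis using rhaz_minus_le[of "-z"] by simp
qed

text \<open>This is minus the logarithmic derivative of the reverse hazard rate.\<close>
definition rg :: "real \<Rightarrow> real" where "rg z = z + rhaz z"

lemma rg_nonneg [simp]: "0 \<le> rg z"
proof (cases "z \<ge> 0")
  case False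
  then have "0 \<le> - z / ((- z)\<^sup>2 + 2)" by (intro divide_nonneg_nonneg) auto
  then show ?thesis using rhaz_minus_ge[of "-z"] False by (simp add: rg_def)
qed (simp add: rg_def)

lemma rg_bound: "rg z \<le> 2 + \<bar>z\<bar>"
proof (cases "z \<ge> 0")
  case True
  then show ?thesis using rhaz_le_nd[of z] nd_le_const[of z] by (simp add: rg_def)
next
  case False
  then show ?thesis using rhaz_minus_le[of "-z"] by (simp add: rg_def)
qed

lemma has_real_derivative_rhaz [derivative_intros]:
  assumes "(f has_real_derivative f') (at z within s)"
  shows "((\<lambda>z. rhaz (f z)) has_real_derivative (- rhaz (f z) * rg (f z) * f')) (at z within s)"
proof -
  have "(rhaz has_real_derivative ((- y * nd y) * ncdf y - nd y * nd y) / (ncdf y * ncdf y)) (at y)" for y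
    unfolding rhaz_def[abs_def]
    by (rule DERIV_divide[OF has_real_derivative_nd has_real_derivative_ncdf]) (simp add: less_imp_neq[symmetric])
  moreover have "((- y * nd y) * ncdf y - nd y * nd y) / (ncdf y * ncdf y) = - rhaz y * rg y" for y
    using ncdf_pos(1)[of y] by (simp add: rg_def rhaz_def divide_simps less_imp_neq[symmetric]) (simp add: algebra_simps)
  ultimately have "(rhaz has_real_derivative (- rhaz y * rg y)) (at y)" for y
    by simp
  from DERIV_chain2[OF this assms] show ?thesis .
qed

lemma has_real_derivative_rg [derivative_intros]:
  assumes "(f has_real_derivative f') (at z within s)"
  shows "((\<lambda>z. rg (f z)) has_real_derivative ((1 - rhaz (f z) * rg (f z)) * f')) (at z within s)"
  using DERIV_add[OF assms has_real_derivative_rhaz[OF assms]]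
  unfolding rg_def by (simp add: algebra_simps)

lemma has_real_derivative_ln_ncdf [derivative_intros]:
  assumes "(f has_real_derivative f') (at z within s)"
  shows "((\<lambda>z. ln (ncdf (f z))) has_real_derivative (rhaz (f z) * f')) (at z within s)"
  using DERIV_chain2[OF DERIV_ln_divide has_real_derivative_ncdf'[OF assms], of ] by (simp add: rhaz_def)

lemma borel_measurable_ncdf [measurable]: "ncdf \<in> borel_measurable borel"
  by (rule borel_measurable_continuous_onI, rule DERIV_continuous_on[OF has_field_derivative_at_within[OF has_real_derivative_ncdf]])

lemma borel_measurable_rhaz [measurable]: "rhaz \<in> borel_measurable borel"
  unfolding rhaz_def[abs_def] by measurable

lemma borel_measurable_rg [measurable]: "rg \<in> borel_measurable borel"
  unfolding rg_def[abs_def] by measurable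

section \<open>Linear forms of a Gaussian vector\<close>

abbreviation gauss :: "nat \<Rightarrow> (nat \<Rightarrow> real) measure" where
  "gauss n \<equiv> PiM {..<n} (\<lambda>_. N01)"

lemma prob_space_PiM_N01: "prob_space (PiM I (\<lambda>_. N01))"
  by (rule prob_space_PiM) (rule prob_space_N01)

lemma distr_gauss_lin:
  fixes c :: "nat \<Rightarrow> real"
  assumes pos: "0 < (\<Sum>l<d. (c l)\<^sup>2)"
  shows "distr (gauss d) borel (\<lambda>x. (\<Sum>l<d. c l * x l) / sqrt (\<Sum>l<d. (c l)\<^sup>2)) = N01"
proof -
  interpret P: prob_space "gauss d" by (rule prob_space_PiM_N01)
  let ?P = "gauss d"
  define I where "I = {l. l < d \<and> c l \<noteq> 0}"
  have fin: "finite I" by (simp add: I_def)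
  have sq: "(\<Sum>l<d. (c l)\<^sup>2) = (\<Sum>l\<in>I. (\<bar>c l\<bar>)\<^sup>2)"
    by (rule sum.mono_neutral_cong_right) (auto simp: I_def)
  have lin: "(\<Sum>l<d. c l * x l) = (\<Sum>l\<in>I. c l * x l)" for x
    by (rule sum.mono_neutral_cong_right) (auto simp: I_def)
  have ne: "I \<noteq> {}" using pos sq by auto
  have comp: "distributed ?P lborel (\<lambda>x. x l) std_normal_density" if "l < d" for l
  proof -
    have "distr ?P lborel (\<lambda>x. x l) = distr ?P N01 (\<lambda>x. x l)"
      by (rule distr_cong) auto
    also have "\<dots> = N01"
      using that by (intro distr_PiM_component prob_space_N01) auto
    finally show ?thesis
      using that by (auto simp: distributed_def N01_def)
  qed
  have ind: "P.indep_vars (\<lambda>_. borel) (\<lambda>l x. x l) I"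
  proof -
    have "P.indep_vars (\<lambda>_. N01) (\<lambda>l x. x l) {..<d}"
    proof (cases "d = 0")
      case False
      have "distr ?P ?P (\<lambda>x. \<lambda>l\<in>{..<d}. x l) = distr ?P ?P (\<lambda>x. x)"
        by (rule distr_cong) (auto simp: space_PiM PiE_def extensional_def fun_eq_iff)
      also have "\<dots> = PiM {..<d} (\<lambda>l. distr ?P N01 (\<lambda>x. x l))"
        by (simp, rule PiM_cong) (auto simp: distr_PiM_component[OF prob_space_N01])
      finally show ?thesis
        using False by (subst P.indep_vars_iff_distr_eq_PiM') auto
    qed (use ne in \<open>auto simp: I_def\<close>)
    then have "P.indep_vars (\<lambda>_. N01) (\<lambda>l x. x l) I"
      by (rule P.indep_vars_subset) (auto simp: I_def)
    from P.indep_vars_compose2[OF this, of "\<lambda>_ z. z" "\<lambda>_. borel"] show ?thesis by simp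
  qed
  have "distributed ?P lborel (\<lambda>x. \<Sum>l\<in>I. c l * x l) (normal_density (\<Sum>l\<in>I. 0) (sqrt (\<Sum>l\<in>I. (\<bar>c l\<bar>)\<^sup>2)))"
  proof (rule P.sum_indep_normal[OF fin ne])
    show "P.indep_vars (\<lambda>_. borel) (\<lambda>l x. c l * x l) I"
      by (rule P.indep_vars_compose2[OF ind]) auto
    fix l assume l: "l \<in> I"
    then show "0 < \<bar>c l\<bar>" by (simp add: I_def)
    show "distributed ?P lborel (\<lambda>x. c l * x l) (normal_density 0 \<bar>c l\<bar>)"
      using P.normal_density_affine[OF comp[of l], of "c l" 0] l by (simp add: I_def)
  qed
  then have "distributed ?P lborel (\<lambda>x. \<Sum>l<d. c l * x l) (normal_density 0 (sqrt (\<Sum>l<d. (c l)\<^sup>2)))"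
    by (simp add: lin sq)
  then have "distributed ?P lborel (\<lambda>x. ((\<Sum>l<d. c l * x l) - 0) / sqrt (\<Sum>l<d. (c l)\<^sup>2)) std_normal_density"
    using pos by (subst (asm) P.normal_standard_normal_convert) auto
  then have "distr ?P lborel (\<lambda>x. (\<Sum>l<d. c l * x l) / sqrt (\<Sum>l<d. (c l)\<^sup>2)) = N01"
    by (simp add: distributed_def N01_def)
  moreover have "distr ?P lborel (\<lambda>x. (\<Sum>l<d. c l * x l) / sqrt (\<Sum>l<d. (c l)\<^sup>2)) = distr ?P borel (\<lambda>x. (\<Sum>l<d. c l * x l) / sqrt (\<Sum>l<d. (c l)\<^sup>2))"
    by (rule distr_cong) auto
  ultimately show ?thesis by simp
qed

lemma measurable_noise_component:
  "l \<in> I \<Longrightarrow> (\<lambda>\<xi>. \<xi> l) \<in> borel_measurable (PiM I (\<lambda>_. N01))"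
  using measurable_component_singleton[of l I "\<lambda>_. N01"] by (simp cong: measurable_cong_sets)

lemma measurable_lin [measurable]:
  "(\<lambda>x. \<Sum>l<d. c l * x l) \<in> borel_measurable (gauss d)"
  "(\<lambda>x. \<Sum>l<d. c l * x l) \<in> borel_measurable (PiM {..<d} (\<lambda>_. borel :: real measure))"
  by (auto intro!: borel_measurable_sum borel_measurable_times measurable_compose[OF measurable_component_singleton])

lemma measure_N01_tail:
  assumes "1 \<le> t"
  shows "measure N01 {z. t < \<bar>z\<bar>} \<le> exp (- t\<^sup>2 / 2)"
proof -
  have "{z. t < \<bar>z\<bar>} = {..< - t} \<union> {t<..}" using assms by auto
  then have "measure N01 {z. t < \<bar>z\<bar>} \<le> measure N01 {..< - t} + measure N01 {t<..}"
    by (simp add: measure_Un_le)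
  also have "\<dots> = 2 * ncdf (- t)"
    using emeasure_N01_lessThan[of "-t"] emeasure_N01_greaterThan[of t] by (simp add: measure_def)
  also have "\<dots> \<le> 2 * nd t"
  proof -
    have "0 \<le> t / (t\<^sup>2 + 2)" using assms by simp
    moreover have "t + t / (t\<^sup>2 + 2) \<le> rhaz (- t)" using rhaz_minus_ge[of t] assms by simp
    ultimately have "1 \<le> rhaz (- t)" using assms by linarith
    then show ?thesis by (simp add: rhaz_def)
  qed
  also have "\<dots> \<le> exp (- t\<^sup>2 / 2)" using nd_le[of t] exp_gt_zero[of "- t\<^sup>2 / 2"] by linarith
  finally show ?thesis .
qed

lemma measure_gauss_lin:
  fixes c :: "nat \<Rightarrow> real"
  assumes "0 < (\<Sum>l<d. (c l)\<^sup>2)" and A: "A \<in> sets borel"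
  shows "measure (gauss d)
      {x \<in> space (gauss d). (\<Sum>l<d. c l * x l) / sqrt (\<Sum>l<d. (c l)\<^sup>2) \<in> A} = measure N01 A"
  by (subst distr_gauss_lin[OF assms(1), symmetric], subst measure_distr[OF _ A])
     (auto intro!: arg_cong[where f="measure _"])

lemma gauss_lin_tail:
  fixes c :: "nat \<Rightarrow> real"
  assumes t: "1 \<le> t" and b: "sqrt (\<Sum>l<d. (c l)\<^sup>2) \<le> b"
  shows "measure (gauss d)
    {x \<in> space (gauss d). t * b < \<bar>\<Sum>l<d. c l * x l\<bar>} \<le> exp (- t\<^sup>2 / 2)"
proof (cases "(\<Sum>l<d. (c l)\<^sup>2) = 0")
  case True
  then have "\<forall>l<d. c l = 0" by (simp add: sum_nonneg_eq_0_iff)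
  then have "(\<Sum>l<d. c l * x l) = 0" for x by simp
  moreover have "0 \<le> t * b" using t b True by simp
  ultimately show ?thesis by (simp add: not_less)
next
  case False
  let ?P = "gauss d"
  interpret P: prob_space ?P by (rule prob_space_PiM_N01)
  define \<sigma> where "\<sigma> = sqrt (\<Sum>l<d. (c l)\<^sup>2)"
  have pos: "0 < (\<Sum>l<d. (c l)\<^sup>2)" using False by (simp add: less_le sum_nonneg)
  then have s: "0 < \<sigma>" by (simp add: \<sigma>_def)
  have "P.prob {x \<in> space ?P. t * b < \<bar>\<Sum>l<d. c l * x l\<bar>}
      \<le> P.prob {x \<in> space ?P. (\<Sum>l<d. c l * x l) / \<sigma> \<in> {z. t < \<bar>z\<bar>}}"
  proof (rule P.finite_measure_mono)
    show "{x \<in> space ?P. t * b < \<bar>\<Sum>l<d. c l * x l\<bar>} \<subseteq> {x \<in> space ?P. (\<Sum>l<d. c l * x l) / \<sigma> \<in> {z. t < \<bar>z\<bar>}}"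
    proof safe
      fix x assume "t * b < \<bar>\<Sum>l<d. c l * x l\<bar>"
      moreover have "t * \<sigma> \<le> t * b" using t b by (simp add: \<sigma>_def)
      ultimately show "t < \<bar>(\<Sum>l<d. c l * x l) / \<sigma>\<bar>" using s by (simp add: field_simps)
    qed
    show "{x \<in> space ?P. (\<Sum>l<d. c l * x l) / \<sigma> \<in> {z. t < \<bar>z\<bar>}} \<in> P.events" by measurable
  qed
  also have "\<dots> = measure N01 {z. t < \<bar>z\<bar>}"
    unfolding \<sigma>_def by (rule measure_gauss_lin[OF pos]) measurable
  finally show ?thesis using measure_N01_tail[OF t] by simp
qed

lemma gauss_lin_anticonc:
  fixes c :: "nat \<Rightarrow> real"
  shows "3/5 \<le> measure (gauss d)
    {x \<in> space (gauss d). sqrt (\<Sum>l<d. (c l)\<^sup>2) / 2 \<le> \<bar>\<Sum>l<d. c l * x l\<bar>}"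
proof (cases "(\<Sum>l<d. (c l)\<^sup>2) = 0")
  case True
  interpret P: prob_space "gauss d" by (rule prob_space_PiM_N01)
  show ?thesis using P.prob_space by (simp add: True)
next
  case False
  let ?P = "gauss d"
  define \<sigma> where "\<sigma> = sqrt (\<Sum>l<d. (c l)\<^sup>2)"
  have pos: "0 < (\<Sum>l<d. (c l)\<^sup>2)" using False by (simp add: less_le sum_nonneg)
  then have s: "0 < \<sigma>" by (simp add: \<sigma>_def)
  have "measure N01 {-1/2<..1/2} = integral {-1/2..1/2} nd" by (rule measure_N01_Ioc) simp
  also have "\<dots> \<le> integral {-1/2..1/2::real} (\<lambda>_. 2/5)"
  proof (rule integral_le)
    show "nd integrable_on {- 1 / 2..1 / 2}"
      by (rule integrable_continuous_real, rule DERIV_continuous_on[OF has_field_derivative_at_within[OF has_real_derivative_nd]])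
  qed (use nd_le_const in auto)
  finally have "measure N01 {-1/2<..1/2} \<le> 2/5" by simp
  moreover have "measure N01 (space N01 - {-1/2<..1/2}) = 1 - measure N01 {-1/2<..1/2}"
    by (rule N01.prob_compl) simp
  moreover have "measure N01 (space N01 - {-1/2<..1/2}) \<le> measure N01 {z. 1/2 \<le> \<bar>z\<bar>}"
    by (rule N01.finite_measure_mono) auto
  ultimately have "3/5 \<le> measure N01 {z. 1/2 \<le> \<bar>z\<bar>}" by simp
  also have "\<dots> = measure ?P {x \<in> space ?P. (\<Sum>l<d. c l * x l) / \<sigma> \<in> {z. 1/2 \<le> \<bar>z\<bar>}}"
    unfolding \<sigma>_def by (rule measure_gauss_lin[OF pos, symmetric]) measurable
  also have "{x \<in> space ?P. (\<Sum>l<d. c l * x l) / \<sigma> \<in> {z. 1/2 \<le> \<bar>z\<bar>}} = {x \<in> space ?P. \<sigma> / 2 \<le> \<bar>\<Sum>l<d. c l * x l\<bar>}"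
    using s by (auto simp: field_simps)
  finally show ?thesis unfolding \<sigma>_def .
qed

lemma integral_N01: 
  fixes f :: "real \<Rightarrow> real"
  assumes [measurable]: "f \<in> borel_measurable borel"
  shows "integrable N01 f \<longleftrightarrow> integrable lborel (\<lambda>z. nd z * f z)"
    and "integral\<^sup>L N01 f = (\<integral>z. nd z * f z \<partial>lborel)"
  unfolding N01_def by (subst integrable_real_density integral_real_density; simp)+

lemma gauss_lin_moment6:
  fixes c :: "nat \<Rightarrow> real"
  shows "integrable (gauss d) (\<lambda>x. \<bar>\<Sum>l<d. c l * x l\<bar>^6)" (is ?I)
    and "(\<integral>x. \<bar>\<Sum>l<d. c l * x l\<bar>^6 \<partial>gauss d) = 15 * sqrt (\<Sum>l<d. (c l)\<^sup>2) ^ 6" (is ?E)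
proof -
  let ?P = "gauss d"
  have "?I \<and> ?E"
  proof (cases "(\<Sum>l<d. (c l)\<^sup>2) = 0")
    case True
    then have "\<forall>l<d. c l = 0" by (simp add: sum_nonneg_eq_0_iff)
    then have "(\<Sum>l<d. c l * x l) = 0" for x by simp
    then show ?thesis using True by simp
  next
    case False
    define \<sigma> where "\<sigma> = sqrt (\<Sum>l<d. (c l)\<^sup>2)"
    have pos: "0 < (\<Sum>l<d. (c l)\<^sup>2)" using False by (simp add: less_le sum_nonneg)
    then have s: "0 < \<sigma>" by (simp add: \<sigma>_def)
    let ?Z = "\<lambda>x. (\<Sum>l<d. c l * x l) / \<sigma>"
    have D: "distr ?P borel ?Z = N01" unfolding \<sigma>_def by (rule distr_gauss_lin[OF pos])
    have i1: "integrable N01 (\<lambda>z. z^6)"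
      by (subst integral_N01) (auto simp: integrable_std_normal_moment)
    have e1: "integral\<^sup>L N01 (\<lambda>z. z^6) = 15"
      using integral_std_normal_moment_even[of 3]
      by (subst integral_N01) (auto simp: fact_numeral)
    have i2: "integrable ?P (\<lambda>x. ?Z x ^ 6)"
      using i1 by (subst (asm) D[symmetric], subst (asm) integrable_distr_eq) auto
    have e2: "(\<integral>x. ?Z x ^ 6 \<partial>?P) = 15"
      using e1 by (subst (asm) D[symmetric], subst (asm) integral_distr) auto
    have eq: "\<bar>\<Sum>l<d. c l * x l\<bar>^6 = \<sigma>^6 * ?Z x ^ 6" for x
      using s by (simp add: power_divide)
    show ?thesis unfolding eq using i2 e2 by (simp add: \<sigma>_def[symmetric] mult.commute)
  qed
  then show ?I ?E by auto
qed

section \<open>The density of the observation\<close>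

definition side :: "nat \<Rightarrow> real \<Rightarrow> (nat \<Rightarrow> real) \<Rightarrow> nat \<Rightarrow> real" where
  "side i s \<mu> l = (if l = i then ncdf (\<mu> i - s) else ncdf (s - \<mu> l))"

text \<open>The sum runs over the index of the runner-up.\<close>
definition obs_dens :: "nat \<Rightarrow> nat \<Rightarrow> real \<Rightarrow> (nat \<Rightarrow> real) \<Rightarrow> real" where
  "obs_dens k i s \<mu> = (\<Sum>j\<in>{..<k}-{i}. nd (s - \<mu> j) * (\<Prod>l\<in>{..<k}-{j}. side i s \<mu> l))"

lemma side_pos [simp]: "0 < side i s \<mu> l" "0 \<le> side i s \<mu> l"
  by (simp_all add: side_def)

lemma obs_dens_nonneg [simp]: "0 \<le> obs_dens k i s \<mu>"
  unfolding obs_dens_def by (intro sum_nonneg mult_nonneg_nonneg prod_nonneg) auto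

lemma imax_eq:
  assumes "i < k" "\<And>l. l < k \<Longrightarrow> l \<noteq> i \<Longrightarrow> y l < y i"
  shows "imax k y = i"
  unfolding imax_def
proof (rule Least_equality)
  show "i < k \<and> (\<forall>j<k. y j \<le> y i)" using assms by (metis less_imp_le order_refl)
  fix l assume l: "l < k \<and> (\<forall>j<k. y j \<le> y l)"
  then have "l = i" using assms by (metis not_less)
  then show "i \<le> l" by simp
qed

lemma imax_ysmax_eq:
  assumes "i < k" "j < k" "i \<noteq> j" "y j < y i" "\<And>l. l < k \<Longrightarrow> l \<noteq> i \<Longrightarrow> l \<noteq> j \<Longrightarrow> y l < y j"
  shows "imax k y = i \<and> ysmax k y = y j"
proof -
  have i: "imax k y = i"
    by (rule imax_eq) (use assms in \<open>force\<close>)+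
  have "Max (y ` ({..<k} - {i})) = y j"
    by (rule Max_eqI) (use assms in \<open>force+\<close>)
  then show ?thesis using i by (simp add: ysmax_def)
qed

lemma imax_less:
  assumes "0 < k"
  shows "imax k y < k" "l < k \<Longrightarrow> y l \<le> y (imax k y)"
proof -
  have "Max (y ` {..<k}) \<in> y ` {..<k}" using assms by (intro Max_in) auto
  then obtain i where "i < k" "y i = Max (y ` {..<k})" by auto
  then have ex: "i < k \<and> (\<forall>j<k. y j \<le> y i)" by simp
  have "imax k y < k \<and> (\<forall>j<k. y j \<le> y (imax k y))"
    unfolding imax_def by (rule LeastI[of "\<lambda>i. i < k \<and> (\<forall>j<k. y j \<le> y i)", OF ex])
  then show "imax k y < k" "l < k \<Longrightarrow> y l \<le> y (imax k y)" by auto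
qed

lemma ysmax_in:
  assumes "2 \<le> k"
  shows "\<exists>j<k. j \<noteq> imax k y \<and> ysmax k y = y j \<and> (\<forall>l<k. l \<noteq> imax k y \<longrightarrow> y l \<le> y j)"
proof -
  let ?I = "{..<k} - {imax k y}"
  have "card ?I > 0" using imax_less(1)[of k y] assms by simp
  then have ne: "?I \<noteq> {}" by fastforce
  then have "Max (y ` ?I) \<in> y ` ?I" by (intro Max_in) auto
  then obtain j where "j \<in> ?I" "y j = Max (y ` ?I)" by (metis imageE)
  then show ?thesis unfolding ysmax_def by (intro exI[of _ j]) auto
qed

lemma abs_ysmax_le:
  assumes "2 \<le> k"
  shows "\<bar>ysmax k y\<bar> \<le> (\<Sum>l<k. \<bar>y l\<bar>)"
  using ysmax_in[OF assms, of y] member_le_sum[of _ "{..<k}" "\<lambda>l. \<bar>y l\<bar>"] by fastforce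

lemma sum_ordered_pairs:
  fixes g :: "nat \<Rightarrow> real \<Rightarrow> ennreal"
  assumes k: "2 \<le> k" and inj: "inj_on y {..<k}"
  shows "(\<Sum>i<k. \<Sum>j\<in>{..<k}-{i}. g i (y j) *
      (\<Prod>l\<in>{..<k}-{j}. if l = i then indicator {y j<..} (y i) else indicator {..<y j} (y l)))
    = g (imax k y) (ysmax k y)"
proof -
  let ?F = "\<lambda>i j. g i (y j) * (\<Prod>l\<in>{..<k}-{j}. if l = i then indicator {y j<..} (y i) else indicator {..<y j} (y l) :: ennreal)"
  let ?S = "SIGMA i:{..<k}. {..<k}-{i}"
  define i0 where "i0 = imax k y"
  obtain j0 where j0: "j0 < k" "j0 \<noteq> i0" "ysmax k y = y j0" "\<And>l. l < k \<Longrightarrow> l \<noteq> i0 \<Longrightarrow> y l \<le> y j0"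
    using ysmax_in[OF k, of y] unfolding i0_def by blast
  have i0: "i0 < k" "\<And>l. l < k \<Longrightarrow> y l \<le> y i0" using imax_less[where k=k and y=y] k by (auto simp: i0_def)
  have one: "(\<Prod>l\<in>{..<k}-{j0}. if l = i0 then indicator {y j0<..} (y i0) else indicator {..<y j0} (y l) :: ennreal) = 1"
  proof (rule prod.neutral, rule ballI)
    fix l assume l: "l \<in> {..<k}-{j0}"
    have "y j0 \<noteq> y i0" using inj j0 i0 by (auto simp: inj_on_def)
    moreover have "y l \<noteq> y j0" using inj j0 l by (auto simp: inj_on_def)
    ultimately show "(if l = i0 then indicator {y j0<..} (y i0) else indicator {..<y j0} (y l) :: ennreal) = 1"
      using j0(4)[of l] i0(2)[OF j0(1)] l by (auto simp: less_le)
  qed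
  have "(\<Sum>i<k. \<Sum>j\<in>{..<k}-{i}. ?F i j) = (\<Sum>(i,j)\<in>?S. ?F i j)"
    by (rule sum.Sigma) auto
  also have "\<dots> = (\<Sum>(i,j)\<in>{(i0,j0)}. ?F i j)"
  proof (rule sum.mono_neutral_right)
    show "\<forall>p\<in>?S - {(i0, j0)}. (case p of (i, j) \<Rightarrow> ?F i j) = 0"
    proof safe
      fix i j assume ij: "(i, j) \<notin> {}" "i < k" "j < k" "j \<noteq> i" and n: "?F i j \<noteq> 0" 
      have nz: "(if l = i then indicator {y j<..} (y i) else indicator {..<y j} (y l) :: ennreal) \<noteq> 0"
        if "l < k" "l \<noteq> j" for l
        using n that by (auto simp: prod_zero_iff)
      have "y j < y i" using nz[of i] ij by (auto split: split_indicator_asm)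
      moreover have "y l < y j" if "l < k" "l \<noteq> i" "l \<noteq> j" for l
        using nz[of l] that by (auto split: split_indicator_asm)
      ultimately have "imax k y = i \<and> ysmax k y = y j"
        using ij by (intro imax_ysmax_eq) auto
      then show "i = i0" "j = j0" using j0 inj ij by (auto simp: i0_def inj_on_def)
    qed
  qed (use i0 j0 in auto)
  also have "\<dots> = g i0 (y j0)" using one by simp
  finally show ?thesis using j0 by (simp add: i0_def)
qed

interpretation PN: product_sigma_finite "\<lambda>_::nat. N01"
  by (rule product_sigma_finite.intro) (rule prob_space_imp_sigma_finite[OF prob_space_N01])

lemma AE_inj_shifted_noise:
  fixes \<mu> :: "nat \<Rightarrow> real"
  shows "AE \<xi> in gauss k. inj_on (\<lambda>i. \<mu> i + \<xi> i) {..<k}"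
proof -
  let ?P = "gauss k"
  have "AE \<xi> in ?P. \<mu> a + \<xi> a \<noteq> \<mu> b + \<xi> b" if ab: "a < k" "b < k" "a \<noteq> b" for a b
  proof -
    have ins: "{..<k} = insert a ({..<k}-{a})" using ab by auto
    have [measurable]: "(\<lambda>\<xi>. \<xi> a) \<in> borel_measurable ?P" "(\<lambda>\<xi>. \<xi> b) \<in> borel_measurable ?P"
      using ab by (simp_all add: measurable_noise_component)
    have meas: "(\<lambda>\<xi>. indicator {\<xi> \<in> space ?P. \<mu> a + \<xi> a = \<mu> b + \<xi> b} \<xi> :: ennreal) \<in> borel_measurable ?P"
      using ab by measurable
    have "emeasure ?P {\<xi> \<in> space ?P. \<mu> a + \<xi> a = \<mu> b + \<xi> b} =
       (\<integral>\<^sup>+ \<xi>. indicator {\<xi> \<in> space ?P. \<mu> a + \<xi> a = \<mu> b + \<xi> b} \<xi> \<partial>?P)"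
      by (rule nn_integral_indicator[symmetric]) measurable
    also have "\<dots> = (\<integral>\<^sup>+ \<xi>. (\<integral>\<^sup>+ z. indicator {\<xi> \<in> space ?P. \<mu> a + \<xi> a = \<mu> b + \<xi> b} (\<xi>(a := z)) \<partial>N01) \<partial>(PiM ({..<k}-{a}) (\<lambda>_. N01)))"
      using PN.product_nn_integral_insert[of "{..<k}-{a}" a "indicator {\<xi> \<in> space ?P. \<mu> a + \<xi> a = \<mu> b + \<xi> b}"] meas
      unfolding ins[symmetric] by simp
    also have "\<dots> \<le> (\<integral>\<^sup>+ \<xi>. (\<integral>\<^sup>+ z. indicator {\<mu> b + \<xi> b - \<mu> a} z \<partial>N01) \<partial>(PiM ({..<k}-{a}) (\<lambda>_. N01)))"
      using ab by (intro nn_integral_mono) (auto split: split_indicator)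
    also have "\<dots> = 0" by (simp add: measure_N01_singleton)
    finally have "{\<xi> \<in> space ?P. \<mu> a + \<xi> a = \<mu> b + \<xi> b} \<in> null_sets ?P"
      by (intro null_setsI) (auto, measurable)
    then show ?thesis by (rule AE_I') auto
  qed
  then have "AE \<xi> in ?P. \<forall>a\<in>{..<k}. \<forall>b\<in>{..<k}. a \<noteq> b \<longrightarrow> \<mu> a + \<xi> a \<noteq> \<mu> b + \<xi> b"
    by (intro AE_finite_allI) auto
  then show ?thesis by (rule AE_mp) (auto simp: inj_on_def)
qed

lemma measurable_order_indicator:
  assumes "i < k" "j < k" "l < k"
  shows "(\<lambda>\<xi>. if l = i then indicator {\<mu> j + \<xi> j<..} (\<mu> i + \<xi> i) else indicator {..<\<mu> j + \<xi> j} (\<mu> l + \<xi> l) :: ennreal)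
    \<in> borel_measurable (gauss k)"
proof -
  have [measurable]: "(\<lambda>\<xi>. \<xi> l) \<in> borel_measurable (gauss k)"
    "(\<lambda>\<xi>. \<xi> i) \<in> borel_measurable (gauss k)"
    "(\<lambda>\<xi>. \<xi> j) \<in> borel_measurable (gauss k)"
    using assms by (simp_all add: measurable_noise_component)
  show ?thesis unfolding indicator_def greaterThan_iff lessThan_iff
    by (cases "l = i") (simp_all, measurable)
qed

lemma nn_integral_ordered_pair:
  fixes g :: "real \<Rightarrow> ennreal"
  assumes [measurable]: "g \<in> borel_measurable borel" and ij: "i < k" "j < k" "i \<noteq> j"
  shows "(\<integral>\<^sup>+ \<xi>. g (\<mu> j + \<xi> j) * (\<Prod>l\<in>{..<k}-{j}. if l = i then indicator {\<mu> j + \<xi> j<..} (\<mu> i + \<xi> i) else indicator {..<\<mu> j + \<xi> j} (\<mu> l + \<xi> l)) \<partial>gauss k)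
    = (\<integral>\<^sup>+ s. g s * ennreal (nd (s - \<mu> j) * (\<Prod>l\<in>{..<k}-{j}. side i s \<mu> l)) \<partial>lborel)"
proof -
  let ?I = "{..<k} - {j}"
  have ins: "insert j ?I = {..<k}" using ij by auto
  let ?f = "\<lambda>\<xi>. g (\<mu> j + \<xi> j) * (\<Prod>l\<in>?I. if l = i then indicator {\<mu> j + \<xi> j<..} (\<mu> i + \<xi> i) else indicator {..<\<mu> j + \<xi> j} (\<mu> l + \<xi> l)) :: ennreal"
  let ?e = "\<lambda>s l v. if l = i then indicator {s<..} (\<mu> i + v) else indicator {..<s} (\<mu> l + v) :: ennreal"
  have fm: "?f \<in> borel_measurable (gauss k)"
    using ij by (intro borel_measurable_times_ennreal borel_measurable_prod_ennreal measurable_order_indicator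
        measurable_compose[OF measurable_noise_component[of j]]) auto
  have e: "(\<integral>\<^sup>+ v. ?e s l v \<partial>N01) = ennreal (side i s \<mu> l)" for s l
  proof -
    have "(\<integral>\<^sup>+ v. ?e s l v \<partial>N01) = (\<integral>\<^sup>+ v. indicator (if l = i then {s - \<mu> i<..} else {..<s - \<mu> l}) v \<partial>N01)"
      by (rule nn_integral_cong) (auto split: split_indicator)
    also have "\<dots> = ennreal (side i s \<mu> l)"
      by (subst nn_integral_indicator) (auto simp: emeasure_N01_lessThan emeasure_N01_greaterThan side_def)
    finally show ?thesis .
  qed
  have "(\<integral>\<^sup>+ \<xi>. ?f \<xi> \<partial>gauss k) = (\<integral>\<^sup>+ z. (\<integral>\<^sup>+ \<xi>. ?f (\<xi>(j := z)) \<partial>PiM ?I (\<lambda>_. N01)) \<partial>N01)"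
    using PN.product_nn_integral_insert_rev[of ?I j ?f] fm unfolding ins by simp
  also have "\<dots> = (\<integral>\<^sup>+ z. g (\<mu> j + z) * ennreal (\<Prod>l\<in>?I. side i (\<mu> j + z) \<mu> l) \<partial>N01)"
  proof (rule nn_integral_cong)
    fix z :: real
    have "(\<integral>\<^sup>+ \<xi>. ?f (\<xi>(j := z)) \<partial>PiM ?I (\<lambda>_. N01)) =
       (\<integral>\<^sup>+ \<xi>. g (\<mu> j + z) * (\<Prod>l\<in>?I. ?e (\<mu> j + z) l (\<xi> l)) \<partial>PiM ?I (\<lambda>_. N01))"
      using ij by (intro nn_integral_cong arg_cong2[where f="(*)"] prod.cong) auto
    also have "\<dots> = g (\<mu> j + z) * (\<integral>\<^sup>+ \<xi>. (\<Prod>l\<in>?I. ?e (\<mu> j + z) l (\<xi> l)) \<partial>PiM ?I (\<lambda>_. N01))"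
      by (rule nn_integral_cmult)
         (auto intro!: borel_measurable_prod_ennreal simp: indicator_def)
    also have "(\<integral>\<^sup>+ \<xi>. (\<Prod>l\<in>?I. ?e (\<mu> j + z) l (\<xi> l)) \<partial>PiM ?I (\<lambda>_. N01)) = (\<Prod>l\<in>?I. \<integral>\<^sup>+ v. ?e (\<mu> j + z) l v \<partial>N01)"
      by (rule PN.product_nn_integral_prod) (auto simp: indicator_def)
    also have "\<dots> = ennreal (\<Prod>l\<in>?I. side i (\<mu> j + z) \<mu> l)"
      unfolding e by (rule prod_ennreal) simp
    finally show "(\<integral>\<^sup>+ \<xi>. ?f (\<xi>(j := z)) \<partial>PiM ?I (\<lambda>_. N01)) = g (\<mu> j + z) * ennreal (\<Prod>l\<in>?I. side i (\<mu> j + z) \<mu> l)" .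
  qed
  also have "\<dots> = (\<integral>\<^sup>+ z. ennreal (nd z) * (g (\<mu> j + z) * ennreal (\<Prod>l\<in>?I. side i (\<mu> j + z) \<mu> l)) \<partial>lborel)"
    unfolding N01_def side_def by (subst nn_integral_density) auto
  also have "\<dots> = (\<integral>\<^sup>+ s. ennreal (nd (s - \<mu> j)) * (g s * ennreal (\<Prod>l\<in>?I. side i s \<mu> l)) \<partial>lborel)"
    unfolding side_def
    by (subst nn_integral_real_affine[where c=1 and t="\<mu> j" and f="\<lambda>s. ennreal (nd (s - \<mu> j)) * (g s * ennreal (\<Prod>l\<in>?I. if l = i then ncdf (\<mu> i - s) else ncdf (s - \<mu> l)))"]) (auto cong: if_cong)
  also have "\<dots> = (\<integral>\<^sup>+ s. g s * ennreal (nd (s - \<mu> j) * (\<Prod>l\<in>?I. side i s \<mu> l)) \<partial>lborel)"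
    by (intro nn_integral_cong) (simp add: ennreal_mult prod_nonneg mult_ac)
  finally show ?thesis .
qed

lemma borel_measurable_side [measurable]: "(\<lambda>s. side i s \<mu> l) \<in> borel_measurable borel"
  unfolding side_def by measurable

lemma borel_measurable_obs_dens1 [measurable]: "(\<lambda>s. obs_dens k i s \<mu>) \<in> borel_measurable borel"
  unfolding obs_dens_def by measurable

lemma nn_integral_obs_dens:
  fixes g :: "nat \<Rightarrow> real \<Rightarrow> ennreal"
  assumes k: "2 \<le> k" and g[measurable]: "\<And>i. g i \<in> borel_measurable borel"
  shows "(\<integral>\<^sup>+ \<xi>. g (imax k (\<lambda>i. \<mu> i + \<xi> i)) (ysmax k (\<lambda>i. \<mu> i + \<xi> i)) \<partial>gauss k)
    = (\<Sum>i<k. \<integral>\<^sup>+ s. g i s * ennreal (obs_dens k i s \<mu>) \<partial>lborel)"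
proof -
  let ?P = "gauss k"
  let ?T = "\<lambda>i j \<xi>. g i (\<mu> j + \<xi> j) * (\<Prod>l\<in>{..<k}-{j}. if l = i then indicator {\<mu> j + \<xi> j<..} (\<mu> i + \<xi> i) else indicator {..<\<mu> j + \<xi> j} (\<mu> l + \<xi> l) :: ennreal)"
  have Tm: "?T i j \<in> borel_measurable ?P" if "i < k" "j < k" for i j
    using that by (intro borel_measurable_times_ennreal borel_measurable_prod_ennreal measurable_order_indicator
        measurable_compose[OF measurable_noise_component[of j]]) auto
  have "(\<integral>\<^sup>+ \<xi>. g (imax k (\<lambda>i. \<mu> i + \<xi> i)) (ysmax k (\<lambda>i. \<mu> i + \<xi> i)) \<partial>?P)
     = (\<integral>\<^sup>+ \<xi>. (\<Sum>i<k. \<Sum>j\<in>{..<k}-{i}. ?T i j \<xi>) \<partial>?P)"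
    by (rule nn_integral_cong_AE, rule AE_mp[OF AE_inj_shifted_noise[where k=k and \<mu>=\<mu>]])
       (auto simp: sum_ordered_pairs[OF k, symmetric])
  also have "\<dots> = (\<Sum>i<k. \<Sum>j\<in>{..<k}-{i}. \<integral>\<^sup>+ \<xi>. ?T i j \<xi> \<partial>?P)"
    using Tm by (subst nn_integral_sum; auto intro!: sum.cong nn_integral_sum)
  also have "\<dots> = (\<Sum>i<k. \<Sum>j\<in>{..<k}-{i}. \<integral>\<^sup>+ s. g i s * ennreal (nd (s - \<mu> j) * (\<Prod>l\<in>{..<k}-{j}. side i s \<mu> l)) \<partial>lborel)"
    by (intro sum.cong refl nn_integral_ordered_pair g) auto
  also have "\<dots> = (\<Sum>i<k. \<integral>\<^sup>+ s. (\<Sum>j\<in>{..<k}-{i}. g i s * ennreal (nd (s - \<mu> j) * (\<Prod>l\<in>{..<k}-{j}. side i s \<mu> l))) \<partial>lborel)"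
    by (intro sum.cong refl nn_integral_sum[symmetric]) auto
  also have "\<dots> = (\<Sum>i<k. \<integral>\<^sup>+ s. g i s * ennreal (obs_dens k i s \<mu>) \<partial>lborel)"
    unfolding obs_dens_def
    by (intro sum.cong refl nn_integral_cong)
       (simp add: sum_distrib_left[symmetric] sum_ennreal prod_nonneg)
  finally show ?thesis .
qed

lemma Pset_upd_iff:
  assumes "i < k" "j < k" "j \<noteq> i"
  shows "z(j := s) \<in> Pset k s i \<longleftrightarrow> s \<le> z i \<and> (\<forall>l<k. l \<noteq> i \<longrightarrow> l \<noteq> j \<longrightarrow> z l \<le> s)" (is "?L \<longleftrightarrow> ?R")
proof
  let ?z = "z(j := s)"
  assume ?L
  then have 1: "?z i = Max (?z ` {..<k})" and 2: "Max (?z ` ({..<k} - {i})) = s" by (auto simp: Pset_def)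
  have "?z j \<le> Max (?z ` {..<k})" using assms by (intro Max_ge) auto
  then have "s \<le> z i" using 1 assms by simp
  moreover have "z l \<le> s" if "l < k" "l \<noteq> i" "l \<noteq> j" for l
  proof -
    have "?z l \<le> Max (?z ` ({..<k} - {i}))" using that by (intro Max_ge) auto
    then have "?z l \<le> s" unfolding 2 .
    then show ?thesis using that by simp
  qed
  ultimately show ?R by blast
next
  let ?z = "z(j := s)"
  assume R: ?R
  have "Max (?z ` {..<k}) = ?z i"
  proof (rule Max_eqI)
    fix w assume "w \<in> ?z ` {..<k}"
    then obtain l where l: "l < k" "w = ?z l" by auto
    show "w \<le> ?z i"
    proof (cases "l = i \<or> l = j")
      case False
      then have "z l \<le> s" "s \<le> z i" using R l by auto
      then have "z l \<le> z i" by (rule order.trans)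
      then show ?thesis using l False assms by simp
    qed (use l R assms in auto)
  qed (use assms in auto)
  moreover have "Max (?z ` ({..<k} - {i})) = s"
    by (rule Max_eqI) (use R assms in \<open>auto intro!: image_eqI[of _ _ j]\<close>)
  ultimately show ?L by (simp add: Pset_def)
qed

lemma integral_side:
  assumes A: "A = (if l = i then {s..} else {..s})"
  shows "integrable lborel (\<lambda>v. indicator A v * exp (- (1/2) * (v - \<mu> l)\<^sup>2))"
    and "(\<integral>v. indicator A v * exp (- (1/2) * (v - \<mu> l)\<^sup>2) \<partial>lborel) = sqrt (2 * pi) * side i s \<mu> l"
proof -
  define B where "B = (if l = i then {s - \<mu> l..} else {..s - \<mu> l})"
  have [measurable]: "B \<in> sets borel" by (simp add: B_def)
  have eq: "indicator A v * exp (- (1/2) * (v - \<mu> l)\<^sup>2) = sqrt (2 * pi) * (indicator B (- \<mu> l + 1 * v) * nd (- \<mu> l + 1 * v))" for v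
    by (auto simp: A B_def std_normal_density_def split: split_indicator)
  have i: "integrable lborel (\<lambda>z. indicator B z * nd z)"
    using integrable_real_mult_indicator[of B lborel nd] by (simp add: mult.commute)
  have m: "(\<integral>z. indicator B z * nd z \<partial>lborel) = side i s \<mu> l"
  proof -
    have "(\<integral>z. indicator B z * nd z \<partial>lborel) = measure N01 B"
      by (simp add: measure_def emeasure_N01 integral_eq_nn_integral ennreal_mult'' ennreal_indicator mult.commute)
    also have "\<dots> = side i s \<mu> l"
    proof (cases "l = i")
      case True
      have "measure N01 {s - \<mu> l..} = measure N01 (uminus -` {..\<mu> l - s})"
        by (rule arg_cong[where f="measure N01"]) auto
      also have "\<dots> = measure N01 {..\<mu> l - s}"
        using emeasure_N01_uminus[of "{..\<mu> l - s}"] by (simp add: measure_def)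
      finally show ?thesis using True by (simp add: B_def side_def ncdf_def)
    qed (simp add: B_def side_def ncdf_def)
    finally show ?thesis .
  qed
  show "integrable lborel (\<lambda>v. indicator A v * exp (- (1/2) * (v - \<mu> l)\<^sup>2))"
    unfolding eq by (intro integrable_mult_right lborel_integrable_real_affine i) auto
  show "(\<integral>v. indicator A v * exp (- (1/2) * (v - \<mu> l)\<^sup>2) \<partial>lborel) = sqrt (2 * pi) * side i s \<mu> l"
    unfolding eq m[symmetric] using lborel_integral_real_affine[of 1 "\<lambda>z. indicator B z * nd z" "- \<mu> l"] by simp
qed

interpretation PL: product_sigma_finite "\<lambda>_::nat. lborel :: real measure"
  by (rule product_sigma_finite.intro) (rule sigma_finite_lborel)

lemma surf_int_eq:
  assumes i: "i < k"
  shows "surf_int k s i (\<lambda>z. exp (- (1/2) * (\<Sum>l<k. (z l - \<mu> l)\<^sup>2))) = sqrt (2 * pi) ^ k * obs_dens k i s \<mu>"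
proof -
  have "(\<integral>z. indicator (Pset k s i) (z(j := s)) * exp (- (1/2) * (\<Sum>l<k. ((z(j := s)) l - \<mu> l)\<^sup>2)) \<partial>(PiM ({..<k} - {j}) (\<lambda>_. lborel)))
    = sqrt (2 * pi) ^ k * (nd (s - \<mu> j) * (\<Prod>l\<in>{..<k}-{j}. side i s \<mu> l))"
    if j: "j \<in> {..<k} - {i}" for j
  proof -
    let ?I = "{..<k} - {j}"
    define A where "A = (\<lambda>l. if l = i then {s..} else {..s})"
    let ?e = "\<lambda>l v. indicator (A l) v * exp (- (1/2) * (v - \<mu> l)\<^sup>2) :: real"
    have pt: "indicator (Pset k s i) (z(j := s)) * exp (- (1/2) * (\<Sum>l<k. ((z(j := s)) l - \<mu> l)\<^sup>2))
      = exp (- (1/2) * (s - \<mu> j)\<^sup>2) * (\<Prod>l\<in>?I. ?e l (z l))" for z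
    proof -
      have "(\<Sum>l<k. ((z(j := s)) l - \<mu> l)\<^sup>2) = (s - \<mu> j)\<^sup>2 + (\<Sum>l\<in>?I. ((z(j := s)) l - \<mu> l)\<^sup>2)"
        using j by (subst sum.remove[of _ j]) auto
      also have "(\<Sum>l\<in>?I. ((z(j := s)) l - \<mu> l)\<^sup>2) = (\<Sum>l\<in>?I. (z l - \<mu> l)\<^sup>2)"
        by (rule sum.cong) auto
      finally have "exp (- (1/2) * (\<Sum>l<k. ((z(j := s)) l - \<mu> l)\<^sup>2))
         = exp (- (1/2) * (s - \<mu> j)\<^sup>2) * (\<Prod>l\<in>?I. exp (- (1/2) * (z l - \<mu> l)\<^sup>2))"
        by (simp only: exp_sum[symmetric] exp_add[symmetric] distrib_left sum_distrib_left finite_Diff finite_lessThan)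
      moreover have "(indicator (Pset k s i) (z(j := s)) :: real) = (\<Prod>l\<in>?I. indicator (A l) (z l))"
      proof (cases "z(j := s) \<in> Pset k s i")
        case True
        then have "\<forall>l\<in>?I. (indicator (A l) (z l) :: real) = 1"
          using i j by (subst (asm) Pset_upd_iff) (auto simp: A_def)
        then show ?thesis using True by simp
      next
        case False
        then have "\<exists>l\<in>?I. (indicator (A l) (z l) :: real) = 0"
          using i j by (subst (asm) Pset_upd_iff) (auto simp: A_def not_le split: split_indicator)
        then have "(\<Prod>l\<in>?I. indicator (A l) (z l) :: real) = 0" by (intro prod_zero) auto
        then show ?thesis using False by simp
      qed
      ultimately show ?thesis by (simp only: prod.distrib mult_ac)
    qed
    have "(\<integral>z. (\<Prod>l\<in>?I. ?e l (z l)) \<partial>(PiM ?I (\<lambda>_. lborel))) = (\<Prod>l\<in>?I. \<integral>v. ?e l v \<partial>lborel)"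
      by (rule PL.product_integral_prod, simp, rule integral_side(1)) (simp add: A_def)
    also have "\<dots> = (\<Prod>l\<in>?I. sqrt (2 * pi) * side i s \<mu> l)"
      by (intro prod.cong refl integral_side(2)) (simp add: A_def)
    also have "\<dots> = sqrt (2 * pi) ^ (k - 1) * (\<Prod>l\<in>?I. side i s \<mu> l)"
      using j by (simp add: prod.distrib)
    finally have P: "(\<integral>z. (\<Prod>l\<in>?I. ?e l (z l)) \<partial>(PiM ?I (\<lambda>_. lborel))) = sqrt (2 * pi) ^ (k - 1) * (\<Prod>l\<in>?I. side i s \<mu> l)" .
    have "sqrt (2 * pi) ^ k = sqrt (2 * pi) * sqrt (2 * pi) ^ (k - 1)"
      using i by (cases k) auto
    then show ?thesis unfolding pt using P
      by (simp add: std_normal_density_def)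
  qed
  then show ?thesis
    unfolding surf_int_def obs_dens_def sum_distrib_left by (intro sum.cong) auto
qed

definition base :: "nat \<Rightarrow> nat \<Rightarrow> ((nat \<Rightarrow> real) \<times> nat \<times> real) measure" where
  "base d k = gauss d \<Otimes>\<^sub>M (count_space {..<k} \<Otimes>\<^sub>M lborel)"

lemma sets_PiM_N01 [measurable_cong]: "sets (PiM I (\<lambda>_. N01)) = sets (PiM I (\<lambda>_. borel :: real measure))"
  by (rule sets_PiM_cong) auto

lemma sets_base [measurable_cong]: "sets (base d k) = sets (obs_space d k)"
  unfolding base_def obs_space_def by (intro sets_pair_measure_cong sets_PiM_N01 refl) auto

lemma space_base: "space (base d k) = space (obs_space d k)"
  by (rule sets_eq_imp_space_eq[OF sets_base])

lemma space_obs_space: "space (obs_space d k) = (PiE {..<d} (\<lambda>_. UNIV)) \<times> {..<k} \<times> UNIV"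
  by (simp add: obs_space_def space_pair_measure space_PiM)

lemma borel_measurable_obsI:
  fixes f :: "(nat \<Rightarrow> real) \<times> nat \<times> real \<Rightarrow> 'b :: topological_space"
  assumes "\<And>i. i < k \<Longrightarrow> (\<lambda>(x, s). f (x, i, s)) \<in> borel_measurable (PiM {..<d} (\<lambda>_. borel) \<Otimes>\<^sub>M borel)"
  shows "f \<in> borel_measurable (obs_space d k)"
proof -
  have "(\<lambda>\<omega>. (\<lambda>i \<omega>. f (fst \<omega>, i, snd (snd \<omega>))) (fst (snd \<omega>)) \<omega>) \<in> borel_measurable (obs_space d k)"
  proof (rule measurable_compose_countable'[where I="{..<k}"])
    fix i assume "i \<in> {..<k}"
    then have 1: "(\<lambda>(x, s). f (x, i, s)) \<in> borel_measurable (PiM {..<d} (\<lambda>_. borel) \<Otimes>\<^sub>M borel)"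
      using assms by simp
    have 2: "(\<lambda>\<omega>. (fst \<omega>, snd (snd \<omega>))) \<in> obs_space d k \<rightarrow>\<^sub>M PiM {..<d} (\<lambda>_. borel) \<Otimes>\<^sub>M borel"
      unfolding obs_space_def by measurable
    show "(\<lambda>\<omega>. f (fst \<omega>, i, snd (snd \<omega>))) \<in> borel_measurable (obs_space d k)"
      using measurable_compose[OF 2 1] by simp
  qed (auto simp: obs_space_def)
  then show ?thesis by simp
qed

lemma borel_measurable_obs_slice:
  assumes "f \<in> borel_measurable (obs_space d k)" "x \<in> space (gauss d)" "i < k"
  shows "(\<lambda>s. f (x, i, s)) \<in> borel_measurable borel"
proof -
  have "(\<lambda>s. (x, i, s)) \<in> borel \<rightarrow>\<^sub>M obs_space d k"
    unfolding obs_space_def using assms by (intro measurable_Pair measurable_const) (auto simp: space_PiM)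
  from measurable_compose[OF this assms(1)] show ?thesis .
qed

lemma nn_integral_base:
  fixes f :: "(nat \<Rightarrow> real) \<times> nat \<times> real \<Rightarrow> ennreal"
  assumes f: "f \<in> borel_measurable (obs_space d k)"
  shows "(\<integral>\<^sup>+ \<omega>. f \<omega> \<partial>base d k) = (\<integral>\<^sup>+ x. (\<Sum>i<k. \<integral>\<^sup>+ s. f (x, i, s) \<partial>lborel) \<partial>gauss d)"
proof -
  interpret c: sigma_finite_measure "count_space {..<k}" by (rule sigma_finite_measure_count_space_finite) simp
  interpret cl: pair_sigma_finite "count_space {..<k}" "lborel :: real measure"
    by (rule pair_sigma_finite.intro) (auto intro: c.sigma_finite_measure_axioms sigma_finite_lborel)
  have fb: "f \<in> borel_measurable (gauss d \<Otimes>\<^sub>M (count_space {..<k} \<Otimes>\<^sub>M lborel))"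
    using f sets_base[of d k] by (simp add: base_def cong: measurable_cong_sets)
  have "(\<integral>\<^sup>+ \<omega>. f \<omega> \<partial>base d k) = (\<integral>\<^sup>+ x. (\<integral>\<^sup>+ w. f (x, w) \<partial>(count_space {..<k} \<Otimes>\<^sub>M lborel)) \<partial>gauss d)"
    unfolding base_def by (rule sigma_finite_measure.nn_integral_fst[OF cl.sigma_finite_measure_axioms fb, symmetric])
  also have "\<dots> = (\<integral>\<^sup>+ x. (\<Sum>i<k. \<integral>\<^sup>+ s. f (x, i, s) \<partial>lborel) \<partial>gauss d)"
  proof (rule nn_integral_cong)
    fix x assume x: "x \<in> space (gauss d)"
    have "(\<lambda>w. f (x, w)) \<in> borel_measurable (count_space {..<k} \<Otimes>\<^sub>M lborel)"
      by (rule measurable_compose[OF measurable_Pair1'[OF x] fb])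
    then have "(\<integral>\<^sup>+ w. f (x, w) \<partial>(count_space {..<k} \<Otimes>\<^sub>M lborel)) = (\<integral>\<^sup>+ i. \<integral>\<^sup>+ s. f (x, i, s) \<partial>lborel \<partial>count_space {..<k})"
      by (rule lborel.nn_integral_fst[symmetric])
    then show "(\<integral>\<^sup>+ w. f (x, w) \<partial>(count_space {..<k} \<Otimes>\<^sub>M lborel)) = (\<Sum>i<k. \<integral>\<^sup>+ s. f (x, i, s) \<partial>lborel)"
      by (simp add: nn_integral_count_space_finite)
  qed
  finally show ?thesis .
qed

definition dens :: "nat \<Rightarrow> nat \<Rightarrow> (nat \<Rightarrow> nat \<Rightarrow> real) \<Rightarrow> (nat \<Rightarrow> real) \<times> nat \<times> real \<Rightarrow> real" where
  "dens d k W = (\<lambda>(x, i, s). obs_dens k i s (WTx d W x))"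

lemma measurable_WTx [measurable]:
  "(\<lambda>x. WTx d W x i) \<in> borel_measurable (PiM {..<d} (\<lambda>_. borel :: real measure))"
  "(\<lambda>x. WTx d W x i) \<in> borel_measurable (gauss d)"
  unfolding WTx_def by measurable

lemma borel_measurable_dens [measurable]: "dens d k W \<in> borel_measurable (obs_space d k)"
proof (rule borel_measurable_obsI)
  fix i
  show "(\<lambda>(x, s). dens d k W (x, i, s)) \<in> borel_measurable (PiM {..<d} (\<lambda>_. borel) \<Otimes>\<^sub>M borel)"
    unfolding dens_def obs_dens_def side_def split_beta' fst_conv snd_conv
    by measurable
qed

lemma measurable_imax:
  fixes Y :: "'a \<Rightarrow> nat \<Rightarrow> real"
  assumes Y: "\<And>i. i < k \<Longrightarrow> (\<lambda>\<omega>. Y \<omega> i) \<in> borel_measurable M" and k: "0 < k"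
  shows "(\<lambda>\<omega>. imax k (Y \<omega>)) \<in> M \<rightarrow>\<^sub>M count_space {..<k}"
proof -
  have "(\<lambda>\<omega>. LEAST i. i < k \<and> (\<forall>j<k. Y \<omega> j \<le> Y \<omega> i)) \<in> M \<rightarrow>\<^sub>M count_space UNIV"
  proof (rule measurable_Least)
    fix i
    show "Measurable.pred M (\<lambda>\<omega>. i < k \<and> (\<forall>j<k. Y \<omega> j \<le> Y \<omega> i))"
    proof (cases "i < k")
      case True
      have "Measurable.pred M (\<lambda>\<omega>. \<forall>j\<in>{..<k}. Y \<omega> j \<le> Y \<omega> i)"
        unfolding pred_def
      proof (rule sets.sets_Collect_finite_All)
        show "{\<omega> \<in> space M. Y \<omega> j \<le> Y \<omega> i} \<in> sets M" if "j \<in> {..<k}" for j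
          by (rule borel_measurable_le) (use that True in \<open>simp_all add: Y\<close>)
      qed simp
      moreover have "(\<lambda>\<omega>. i < k \<and> (\<forall>j<k. Y \<omega> j \<le> Y \<omega> i)) = (\<lambda>\<omega>. \<forall>j\<in>{..<k}. Y \<omega> j \<le> Y \<omega> i)"
        using True by blast
      ultimately show ?thesis by (simp only:)
    next
      case False
      then have "(\<lambda>\<omega>. i < k \<and> (\<forall>j<k. Y \<omega> j \<le> Y \<omega> i)) = (\<lambda>\<omega>. False)" by blast
      then show ?thesis by (simp only:) (rule measurable_const, simp)
    qed
  qed
  then have H: "(\<lambda>\<omega>. imax k (Y \<omega>)) \<in> M \<rightarrow>\<^sub>M count_space UNIV" unfolding imax_def .
  show ?thesis
  proof (subst measurable_count_space_eq2)
    show "(\<lambda>\<omega>. imax k (Y \<omega>)) \<in> space M \<rightarrow> {..<k} \<and>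
      (\<forall>a\<in>{..<k}. (\<lambda>\<omega>. imax k (Y \<omega>)) -` {a} \<inter> space M \<in> sets M)"
    proof (intro conjI ballI)
      show "(\<lambda>\<omega>. imax k (Y \<omega>)) \<in> space M \<rightarrow> {..<k}" using imax_less(1)[OF k] by (intro Pi_I) (simp only: lessThan_iff)
      show "(\<lambda>\<omega>. imax k (Y \<omega>)) -` {a} \<inter> space M \<in> sets M" for a
        by (rule measurable_sets[OF H]) simp
    qed
  qed simp
qed

lemma measurable_ysmax:
  fixes Y :: "'a \<Rightarrow> nat \<Rightarrow> real"
  assumes Y: "\<And>i. i < k \<Longrightarrow> (\<lambda>\<omega>. Y \<omega> i) \<in> borel_measurable M" and k: "2 \<le> k"
  shows "(\<lambda>\<omega>. ysmax k (Y \<omega>)) \<in> borel_measurable M"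
proof -
  have "(\<lambda>\<omega>. (\<lambda>i \<omega>. Max ((\<lambda>l. Y \<omega> l) ` ({..<k} - {i}))) (imax k (Y \<omega>)) \<omega>) \<in> borel_measurable M"
  proof (rule measurable_compose_countable'[where I="{..<k}"])
    show "(\<lambda>\<omega>. Max ((\<lambda>l. Y \<omega> l) ` ({..<k} - {i}))) \<in> borel_measurable M" for i
      by (rule borel_measurable_Max) (simp_all add: Y)
    show "(\<lambda>\<omega>. imax k (Y \<omega>)) \<in> M \<rightarrow>\<^sub>M count_space {..<k}"
      by (rule measurable_imax) (use k in \<open>simp_all add: Y\<close>)
  qed simp
  then show ?thesis by (simp add: ysmax_def)
qed

abbreviation "noise d k \<equiv> gauss d \<Otimes>\<^sub>M gauss k"

definition model_map :: "nat \<Rightarrow> nat \<Rightarrow> (nat \<Rightarrow> nat \<Rightarrow> real) \<Rightarrow> (nat \<Rightarrow> real) \<times> (nat \<Rightarrow> real) \<Rightarrow> (nat \<Rightarrow> real) \<times> nat \<times> real" where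
  "model_map d k W = (\<lambda>(x, \<xi>). (x, imax k (\<lambda>i. WTx d W x i + \<xi> i), ysmax k (\<lambda>i. WTx d W x i + \<xi> i)))"

lemma auction_model_eq: "auction_model d k W = distr (noise d k) (obs_space d k) (model_map d k W)"
  by (simp add: auction_model_def model_map_def Let_def)

lemma measurable_model_map:
  assumes "2 \<le> k"
  shows "model_map d k W \<in> noise d k \<rightarrow>\<^sub>M obs_space d k"
proof -
  have Y: "(\<lambda>\<omega>. WTx d W (fst \<omega>) i + snd \<omega> i) \<in> borel_measurable (noise d k)" if "i < k" for i
    using that by (intro borel_measurable_add measurable_compose[OF measurable_fst measurable_WTx(2)]
        measurable_compose[OF measurable_snd measurable_noise_component]) auto
  have "(\<lambda>\<omega>. (fst \<omega>, imax k (\<lambda>i. WTx d W (fst \<omega>) i + snd \<omega> i), ysmax k (\<lambda>i. WTx d W (fst \<omega>) i + snd \<omega> i)))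
    \<in> noise d k \<rightarrow>\<^sub>M obs_space d k"
    unfolding obs_space_def
  proof (intro measurable_Pair)
    show "fst \<in> noise d k \<rightarrow>\<^sub>M PiM {..<d} (\<lambda>_. borel :: real measure)"
      using measurable_fst[of "gauss d" "gauss k"]
      by (subst measurable_cong_sets[OF refl sets_PiM_N01[symmetric]])
  qed (use assms in \<open>auto intro!: measurable_imax measurable_ysmax Y\<close>)
  then show ?thesis by (simp add: model_map_def case_prod_beta')
qed

lemma prob_space_auction_model: "2 \<le> k \<Longrightarrow> prob_space (auction_model d k W)"
proof -
  assume k: "2 \<le> k"
  interpret pair_prob_space "gauss d" "gauss k"
    by (auto simp: pair_prob_space_def pair_sigma_finite_def prob_space_PiM_N01 prob_space_imp_sigma_finite)
  show ?thesis unfolding auction_model_eq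
    by (rule prob_space.prob_space_distr[OF prob_space_axioms measurable_model_map[OF k]])
qed

lemma sets_auction_model [simp, measurable_cong]: "sets (auction_model d k W) = sets (obs_space d k)"
  by (simp add: auction_model_eq)

lemma auction_model_density:
  assumes k: "2 \<le> k"
  shows "auction_model d k W = density (base d k) (\<lambda>\<omega>. ennreal (dens d k W \<omega>))"
proof (rule measure_eqI)
  fix A assume "A \<in> sets (auction_model d k W)"
  then have A[measurable]: "A \<in> sets (obs_space d k)" by simp
  interpret X: prob_space "gauss k" by (rule prob_space_PiM_N01)
  have m: "(\<lambda>\<omega>. indicator A (model_map d k W \<omega>) :: ennreal) \<in> borel_measurable (noise d k)"
    by (rule measurable_compose[OF measurable_model_map[OF k]]) measurable
  have "emeasure (auction_model d k W) A = (\<integral>\<^sup>+ \<omega>. indicator A \<omega> \<partial>auction_model d k W)"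
    by simp
  also have "\<dots> = (\<integral>\<^sup>+ \<omega>. indicator A (model_map d k W \<omega>) \<partial>noise d k)"
    unfolding auction_model_eq by (rule nn_integral_distr[OF measurable_model_map[OF k]]) simp
  also have "\<dots> = (\<integral>\<^sup>+ x. \<integral>\<^sup>+ \<xi>. indicator A (model_map d k W (x, \<xi>)) \<partial>gauss k \<partial>gauss d)"
    by (rule X.nn_integral_fst[OF m, symmetric])
  also have "\<dots> = (\<integral>\<^sup>+ x. (\<Sum>i<k. \<integral>\<^sup>+ s. ennreal (dens d k W (x, i, s)) * indicator A (x, i, s) \<partial>lborel) \<partial>gauss d)"
  proof (rule nn_integral_cong)
    fix x assume x: "x \<in> space (gauss d)"
    define g where "g = (\<lambda>i s. if i < k then indicator A (x, i, s) else 0 :: ennreal)"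
    have g: "g i \<in> borel_measurable borel" for i
      using borel_measurable_obs_slice[OF borel_measurable_indicator[OF A] x, of i] by (cases "i < k") (auto simp: g_def)
    have "(\<integral>\<^sup>+ \<xi>. indicator A (model_map d k W (x, \<xi>)) \<partial>gauss k)
      = (\<integral>\<^sup>+ \<xi>. g (imax k (\<lambda>i. WTx d W x i + \<xi> i)) (ysmax k (\<lambda>i. WTx d W x i + \<xi> i)) \<partial>gauss k)"
      using imax_less(1)[of k] k by (intro nn_integral_cong) (simp add: model_map_def g_def)
    also have "\<dots> = (\<Sum>i<k. \<integral>\<^sup>+ s. g i s * ennreal (obs_dens k i s (WTx d W x)) \<partial>lborel)"
      by (rule nn_integral_obs_dens[OF k g])
    finally show "(\<integral>\<^sup>+ \<xi>. indicator A (model_map d k W (x, \<xi>)) \<partial>gauss k)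
      = (\<Sum>i<k. \<integral>\<^sup>+ s. ennreal (dens d k W (x, i, s)) * indicator A (x, i, s) \<partial>lborel)"
      by (simp add: g_def dens_def mult.commute)
  qed
  also have "\<dots> = (\<integral>\<^sup>+ \<omega>. ennreal (dens d k W \<omega>) * indicator A \<omega> \<partial>base d k)"
    by (rule nn_integral_base[symmetric]) measurable
  also have "\<dots> = emeasure (density (base d k) (\<lambda>\<omega>. ennreal (dens d k W \<omega>))) A"
    by (subst emeasure_density) (auto simp: sets_base)
  finally show "emeasure (auction_model d k W) A = emeasure (density (base d k) (\<lambda>\<omega>. ennreal (dens d k W \<omega>))) A" .
qed (simp add: sets_base)

section \<open>Separation of log densities far above the means\<close>

definition hsum :: "nat \<Rightarrow> nat \<Rightarrow> real \<Rightarrow> (nat \<Rightarrow> real) \<Rightarrow> real" where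
  "hsum k i s \<mu> = (\<Sum>j\<in>{..<k}-{i}. rhaz (s - \<mu> j))"

definition nll :: "nat \<Rightarrow> nat \<Rightarrow> real \<Rightarrow> (nat \<Rightarrow> real) \<Rightarrow> real" where
  "nll k i s \<mu> = - ln (obs_dens k i s \<mu>)"

lemma obs_dens_eq: "obs_dens k i s \<mu> = (\<Prod>l<k. side i s \<mu> l) * hsum k i s \<mu>"
proof -
  have "nd (s - \<mu> j) * (\<Prod>l\<in>{..<k}-{j}. side i s \<mu> l) = (\<Prod>l<k. side i s \<mu> l) * rhaz (s - \<mu> j)"
    if "j \<in> {..<k} - {i}" for j
  proof -
    have "(\<Prod>l<k. side i s \<mu> l) = side i s \<mu> j * (\<Prod>l\<in>{..<k}-{j}. side i s \<mu> l)"
      using that by (intro prod.remove) auto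
    moreover have "side i s \<mu> j = ncdf (s - \<mu> j)" using that by (simp add: side_def)
    ultimately show ?thesis by (simp add: rhaz_def less_imp_neq[OF ncdf_pos(1), symmetric])
  qed
  then show ?thesis unfolding obs_dens_def hsum_def sum_distrib_left by (rule sum.cong[OF refl])
qed

lemma other_index:
  assumes "2 \<le> k"
  shows "\<exists>j. j \<in> {..<k} - {i::nat}"
proof -
  have "(if i = 0 then 1 else 0) \<in> {..<k} - {i}" using assms by auto
  then show ?thesis by blast
qed

lemma hsum_pos: "2 \<le> k \<Longrightarrow> 0 < hsum k i s \<mu>"
  unfolding hsum_def using other_index[of k i] by (intro sum_pos) auto

lemma obs_dens_pos: "2 \<le> k \<Longrightarrow> 0 < obs_dens k i s \<mu>"
  unfolding obs_dens_eq by (intro mult_pos_pos prod_pos hsum_pos) auto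

lemma ln_sum_shift_bound:
  fixes f f' :: "'a \<Rightarrow> real"
  assumes fin: "finite I" and ne: "I \<noteq> {}"
    and pos: "\<And>j. j \<in> I \<Longrightarrow> 0 < f j" "\<And>j. j \<in> I \<Longrightarrow> 0 < f' j"
    and le: "\<And>j. j \<in> I \<Longrightarrow> \<bar>ln (f' j) - ln (f j) - \<alpha>\<bar> \<le> D"
  shows "\<bar>ln (sum f' I) - ln (sum f I) - \<alpha>\<bar> \<le> D"
proof -
  have S: "0 < sum f I" "0 < sum f' I" using pos fin ne by (auto intro: sum_pos)
  have up: "f' j \<le> exp (\<alpha> + D) * f j" if "j \<in> I" for j
  proof -
    have "f' j = exp (ln (f' j))" using pos that by simp
    also have "\<dots> \<le> exp ((\<alpha> + D) + ln (f j))" using le[OF that] by (subst exp_le_cancel_iff) linarith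
    also have "\<dots> = exp (\<alpha> + D) * f j" using pos that by (simp add: exp_add)
    finally show ?thesis .
  qed
  have lo: "exp (\<alpha> - D) * f j \<le> f' j" if "j \<in> I" for j
  proof -
    have "exp (\<alpha> - D) * f j = exp ((\<alpha> - D) + ln (f j))" using pos that by (simp add: exp_add)
    also have "\<dots> \<le> exp (ln (f' j))" using le[OF that] by (subst exp_le_cancel_iff) linarith
    also have "\<dots> = f' j" using pos that by simp
    finally show ?thesis .
  qed
  have "sum f' I \<le> exp (\<alpha> + D) * sum f I"
    unfolding sum_distrib_left by (rule sum_mono[OF up])
  then have "ln (sum f' I) \<le> ln (exp (\<alpha> + D) * sum f I)" using S by (subst ln_le_cancel_iff) auto
  then have 1: "ln (sum f' I) \<le> (\<alpha> + D) + ln (sum f I)" using S by (simp add: ln_mult)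
  have "exp (\<alpha> - D) * sum f I \<le> sum f' I"
    unfolding sum_distrib_left by (rule sum_mono[OF lo])
  then have "ln (exp (\<alpha> - D) * sum f I) \<le> ln (sum f' I)" using S by (subst ln_le_cancel_iff) auto
  then have 2: "(\<alpha> - D) + ln (sum f I) \<le> ln (sum f' I)" using S by (simp add: ln_mult)
  show ?thesis using 1 2 by linarith
qed

lemma ln_nd: "ln (nd z) = - z\<^sup>2 / 2 - ln (sqrt (2 * pi))"
proof -
  have "sqrt (2 * pi) > 0" by simp
  then show ?thesis unfolding std_normal_density_def by (simp add: ln_mult ln_div)
qed

lemma mvt_increment_ge:
  fixes f :: "real \<Rightarrow> real"
  assumes "a \<le> b" and d: "\<And>v. a \<le> v \<Longrightarrow> v \<le> b \<Longrightarrow> (f has_real_derivative f' v) (at v)"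
    and ge: "\<And>v. a \<le> v \<Longrightarrow> v \<le> b \<Longrightarrow> c \<le> f' v"
  shows "c * (b - a) \<le> f b - f a"
proof (cases "a = b")
  case False
  then have "a < b" using assms(1) by simp
  from MVT2[OF this d] obtain z where z: "a < z" "z < b" "f b - f a = (b - a) * f' z" by blast
  have "c * (b - a) \<le> f' z * (b - a)" using ge[of z] z \<open>a < b\<close> by (intro mult_right_mono) auto
  then show ?thesis using z by (simp add: mult.commute)
qed simp

lemma log_tail_diff_ordered:
  assumes M: "1 \<le> M" and a: "M \<le> a" and ab: "a \<le> b" and b: "b \<le> 3 * M + 1"
  shows "\<bar>ln (nd b) - ln (nd a)\<bar> + \<bar>b - a\<bar> / (12 * M) \<le> \<bar>ln (ncdf (- b)) - ln (ncdf (- a))\<bar>"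
    and "\<bar>ln (ncdf (- b)) - ln (ncdf (- a))\<bar> \<le> 6 * M * \<bar>b - a\<bar>"
    and "\<bar>b - a\<bar> \<le> \<bar>ln (ncdf (- b)) - ln (ncdf (- a))\<bar>"
    and "\<bar>ln (ncdf b) - ln (ncdf a)\<bar> \<le> exp (- M\<^sup>2 / 2) * \<bar>b - a\<bar>"
proof -
  have d: "((\<lambda>v. - ln (ncdf (- v))) has_real_derivative rhaz (- v)) (at v)" for v
  proof -
    have "((\<lambda>v. - ln (ncdf (- v))) has_real_derivative - (rhaz (- v) * - 1)) (at v)"
      by (intro DERIV_minus has_real_derivative_ln_ncdf DERIV_ident)
    then show ?thesis by simp
  qed
  have d2: "((\<lambda>v. - ln (ncdf (- v)) - v\<^sup>2 / 2) has_real_derivative rhaz (- v) - v) (at v)" for v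
  proof -
    have "((\<lambda>v::real. v\<^sup>2 / 2) has_real_derivative v) (at v)"
      by (auto intro!: derivative_eq_intros)
    from DERIV_diff[OF d this] show ?thesis .
  qed
  have g: "1 / (12 * M) \<le> rhaz (- v) - v" if "a \<le> v" "v \<le> b" for v
  proof -
    have v: "1 \<le> v" "v \<le> 4 * M" using that assms by linarith+
    have "v\<^sup>2 \<ge> 1" using v by simp
    then have "v / (3 * v\<^sup>2) \<le> v / (v\<^sup>2 + 2)" using v by (intro divide_left_mono) (auto intro!: mult_pos_pos add_pos_nonneg)
    moreover have "v / (3 * v\<^sup>2) = 1 / (3 * v)" using v by (simp add: power2_eq_square)
    moreover have "1 / (12 * M) \<le> 1 / (3 * v)" using v M by (intro divide_left_mono) auto
    ultimately have "1 / (12 * M) \<le> v / (v\<^sup>2 + 2)" by linarith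
    moreover have "v + v / (v\<^sup>2 + 2) \<le> rhaz (- v)" using v by (intro rhaz_minus_ge) simp
    ultimately show ?thesis by linarith
  qed
  have 1: "1 / (12 * M) * (b - a) \<le> (- ln (ncdf (- b)) - b\<^sup>2 / 2) - (- ln (ncdf (- a)) - a\<^sup>2 / 2)"
    by (rule mvt_increment_ge[OF ab d2 g])
  have 2: "1 * (b - a) \<le> - ln (ncdf (- b)) - - ln (ncdf (- a))"
  proof (rule mvt_increment_ge[OF ab d])
    fix v assume v: "a \<le> v" "v \<le> b"
    have "0 \<le> 1 / (12 * M)" using M by simp
    then show "1 \<le> rhaz (- v)" using g[OF v] v a M by linarith
  qed
  have 3: "- (6 * M) * (b - a) \<le> ln (ncdf (- b)) - ln (ncdf (- a))"
  proof (rule mvt_increment_ge[OF ab])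
    fix v assume v: "a \<le> v" "v \<le> b"
    show "((\<lambda>v. ln (ncdf (- v))) has_real_derivative - rhaz (- v)) (at v)"
      using DERIV_minus[OF d[of v]] by simp
    show "- (6 * M) \<le> - rhaz (- v)" using rhaz_minus_le[of v] v assms by linarith
  qed
  have sq: "a\<^sup>2 \<le> b\<^sup>2" using assms by (intro power_mono) auto
  have lnd: "ln (nd b) - ln (nd a) = a\<^sup>2 / 2 - b\<^sup>2 / 2" by (simp add: ln_nd)
  have ba: "\<bar>b - a\<bar> = b - a" using ab by simp
  show "\<bar>ln (nd b) - ln (nd a)\<bar> + \<bar>b - a\<bar> / (12 * M) \<le> \<bar>ln (ncdf (- b)) - ln (ncdf (- a))\<bar>"
    using 1 2 sq ab unfolding lnd ba by simp
  show "\<bar>ln (ncdf (- b)) - ln (ncdf (- a))\<bar> \<le> 6 * M * \<bar>b - a\<bar>"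
    using 2 3 ab unfolding ba by simp
  show "\<bar>b - a\<bar> \<le> \<bar>ln (ncdf (- b)) - ln (ncdf (- a))\<bar>"
    using 2 ab unfolding ba by simp
  have r: "rhaz v \<le> exp (- M\<^sup>2 / 2)" if "a \<le> v" "v \<le> b" for v
  proof -
    have "M\<^sup>2 \<le> v\<^sup>2" using that assms by (intro power_mono) auto
    then have "exp (- v\<^sup>2 / 2) \<le> exp (- M\<^sup>2 / 2)" by simp
    moreover have "rhaz v \<le> 2 * nd v" using that assms by (intro rhaz_le_nd) auto
    ultimately show ?thesis using nd_le[of v] exp_gt_zero[of "- v\<^sup>2 / 2"] by linarith
  qed
  have 4: "0 * (b - a) \<le> ln (ncdf b) - ln (ncdf a)"
    by (rule mvt_increment_ge[OF ab, where f'=rhaz]) (use has_real_derivative_ln_ncdf[OF DERIV_ident] in auto)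
  have 5: "- exp (- M\<^sup>2 / 2) * (b - a) \<le> - ln (ncdf b) - - ln (ncdf a)"
  proof (rule mvt_increment_ge[OF ab])
    fix v assume v: "a \<le> v" "v \<le> b"
    show "((\<lambda>v. - ln (ncdf v)) has_real_derivative - rhaz v) (at v)"
      using DERIV_minus[OF has_real_derivative_ln_ncdf[OF DERIV_ident]] by simp
    show "- exp (- M\<^sup>2 / 2) \<le> - rhaz v" using r[OF v] by simp
  qed
  show "\<bar>ln (ncdf b) - ln (ncdf a)\<bar> \<le> exp (- M\<^sup>2 / 2) * \<bar>b - a\<bar>"
    using 4 5 unfolding ba by simp
qed

lemma log_tail_diff:
  assumes M: "1 \<le> M" and "M \<le> a" "a \<le> 3 * M + 1" "M \<le> b" "b \<le> 3 * M + 1"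
  shows "\<bar>ln (nd b) - ln (nd a)\<bar> + \<bar>b - a\<bar> / (12 * M) \<le> \<bar>ln (ncdf (- b)) - ln (ncdf (- a))\<bar>"
    and "\<bar>ln (ncdf (- b)) - ln (ncdf (- a))\<bar> \<le> 6 * M * \<bar>b - a\<bar>"
    and "\<bar>b - a\<bar> \<le> \<bar>ln (ncdf (- b)) - ln (ncdf (- a))\<bar>"
    and "\<bar>ln (ncdf b) - ln (ncdf a)\<bar> \<le> exp (- M\<^sup>2 / 2) * \<bar>b - a\<bar>"
  using log_tail_diff_ordered[OF M, of a b] log_tail_diff_ordered[OF M, of b a] assms
  by (cases "a \<le> b"; simp add: abs_minus_commute)+

lemma nll_separation:
  assumes k: "2 \<le> k" and M: "1 \<le> M" and eps: "real k * exp (- M\<^sup>2 / 2) \<le> 1 / (144 * M\<^sup>2)"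
    and \<mu>: "\<And>l. l < k \<Longrightarrow> \<bar>\<mu> l\<bar> \<le> M" and \<mu>': "\<And>l. l < k \<Longrightarrow> \<bar>\<mu>' l\<bar> \<le> M"
    and s: "2 * M \<le> s" "s \<le> 2 * M + 1"
  shows "\<exists>i<k. \<forall>j<k. \<bar>\<mu>' j - \<mu> j\<bar> / (144 * M\<^sup>2) \<le> \<bar>nll k i s \<mu>' - nll k i s \<mu>\<bar>"
proof -
  define A where "A = (\<lambda>l. \<bar>ln (ncdf (\<mu>' l - s)) - ln (ncdf (\<mu> l - s))\<bar>)"
  define \<nu> where "\<nu> = (\<lambda>l. \<bar>\<mu>' l - \<mu> l\<bar>)"
  define N where "N = Max (\<nu> ` {..<k})"
  define e where "e = exp (- M\<^sup>2 / 2)"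
  have ne: "{..<k} \<noteq> {}" using k by (simp add: lessThan_empty_iff)
  have rng: "M \<le> s - \<mu> l" "s - \<mu> l \<le> 3 * M + 1" "M \<le> s - \<mu>' l" "s - \<mu>' l \<le> 3 * M + 1" if "l < k" for l
    using \<mu>[OF that] \<mu>'[OF that] s by linarith+
  have T: "\<bar>ln (nd (s - \<mu>' l)) - ln (nd (s - \<mu> l))\<bar> + \<nu> l / (12 * M) \<le> A l"
    "A l \<le> 6 * M * \<nu> l" "\<nu> l \<le> A l" "\<bar>ln (ncdf (s - \<mu>' l)) - ln (ncdf (s - \<mu> l))\<bar> \<le> e * \<nu> l"
    if "l < k" for l
    using log_tail_diff[OF M rng[OF that]] unfolding A_def \<nu>_def e_def
    by (simp_all add: abs_minus_commute)
  have N: "\<nu> l \<le> N" if "l < k" for l unfolding N_def using that by (intro Max_ge) auto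
  have "N \<in> \<nu> ` {..<k}" unfolding N_def using ne by (intro Max_in) auto
  then obtain j0 where j0: "j0 < k" "\<nu> j0 = N" by auto
  have N0: "0 \<le> N" using j0 by (auto simp: \<nu>_def)
  have "Max (A ` {..<k}) \<in> A ` {..<k}" using ne by (intro Max_in) auto
  then obtain i where i: "i < k" "A i = Max (A ` {..<k})" by auto
  have Ai: "A l \<le> A i" if "l < k" for l unfolding i(2) using that by (intro Max_ge) auto
  define q where "q = 1 / (72 * M\<^sup>2)"
  have q: "0 \<le> q" "q \<le> 1" using M by (auto simp: q_def field_simps intro: order.trans[of _ "M\<^sup>2"])
  define D where "D = (1 - q) * A i + real k * (e * N)"
  define \<alpha> where "\<alpha> = ln (ncdf (\<mu>' i - s)) - ln (ncdf (\<mu> i - s))"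
  let ?f = "\<lambda>\<mu> j. nd (s - \<mu> j) * (\<Prod>l\<in>{..<k}-{j}. side i s \<mu> l)"
  have step: "\<bar>ln (?f \<mu>' j) - ln (?f \<mu> j) - \<alpha>\<bar> \<le> D" if j: "j \<in> {..<k} - {i}" for j
  proof -
    have ji: "j < k" "j \<noteq> i" using j by auto
    let ?J = "{..<k} - {j} - {i}"
    have lnf: "ln (?f m j) = ln (nd (s - m j)) + ln (ncdf (m i - s)) + (\<Sum>l\<in>?J. ln (ncdf (s - m l)))" for m
    proof -
      have "(\<Prod>l\<in>{..<k}-{j}. side i s m l) = side i s m i * (\<Prod>l\<in>?J. side i s m l)"
        using i ji by (intro prod.remove) auto
      also have "(\<Prod>l\<in>?J. side i s m l) = (\<Prod>l\<in>?J. ncdf (s - m l))"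
        by (rule prod.cong) (auto simp: side_def)
      finally have "?f m j = nd (s - m j) * (ncdf (m i - s) * (\<Prod>l\<in>?J. ncdf (s - m l)))"
        by (simp add: side_def)
      moreover have "0 < (\<Prod>l\<in>?J. ncdf (s - m l))" by (intro prod_pos) auto
      ultimately show ?thesis by (simp add: ln_mult ln_prod less_imp_neq[symmetric])
    qed
    have "ln (?f \<mu>' j) - ln (?f \<mu> j) - \<alpha> = (ln (nd (s - \<mu>' j)) - ln (nd (s - \<mu> j)))
        + (\<Sum>l\<in>?J. ln (ncdf (s - \<mu>' l)) - ln (ncdf (s - \<mu> l)))"
      unfolding lnf \<alpha>_def sum_subtractf by simp
    moreover have "\<bar>\<Sum>l\<in>?J. ln (ncdf (s - \<mu>' l)) - ln (ncdf (s - \<mu> l))\<bar> \<le> real k * (e * N)"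
    proof -
      have "\<bar>\<Sum>l\<in>?J. ln (ncdf (s - \<mu>' l)) - ln (ncdf (s - \<mu> l))\<bar> \<le> (\<Sum>l\<in>?J. \<bar>ln (ncdf (s - \<mu>' l)) - ln (ncdf (s - \<mu> l))\<bar>)"
        by (rule sum_abs)
      also have "\<dots> \<le> (\<Sum>l\<in>?J. e * N)"
      proof (rule sum_mono)
        fix l assume "l \<in> ?J"
        then have l: "l < k" by simp
        have "e * \<nu> l \<le> e * N" using N[OF l] by (intro mult_left_mono) (auto simp: e_def)
        then show "\<bar>ln (ncdf (s - \<mu>' l)) - ln (ncdf (s - \<mu> l))\<bar> \<le> e * N" using T(4)[OF l] by linarith
      qed
      also have "\<dots> \<le> (\<Sum>l<k. e * N)"
        using N0 by (intro sum_mono2) (auto simp: e_def)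
      finally show ?thesis by simp
    qed
    moreover have "\<bar>ln (nd (s - \<mu>' j)) - ln (nd (s - \<mu> j))\<bar> \<le> (1 - q) * A i"
    proof -
      have "q * A j \<le> q * (6 * M * \<nu> j)" using T(2)[OF ji(1)] q by (intro mult_left_mono)
      also have "\<dots> = \<nu> j / (12 * M)" using M by (simp add: q_def power2_eq_square)
      finally have "\<bar>ln (nd (s - \<mu>' j)) - ln (nd (s - \<mu> j))\<bar> \<le> (1 - q) * A j"
        using T(1)[OF ji(1)] by (simp add: algebra_simps)
      also have "\<dots> \<le> (1 - q) * A i" using Ai[OF ji(1)] q by (intro mult_left_mono) auto
      finally show ?thesis .
    qed
    ultimately show ?thesis unfolding D_def by linarith
  qed
  have main: "\<bar>ln (obs_dens k i s \<mu>') - ln (obs_dens k i s \<mu>) - \<alpha>\<bar> \<le> D"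
    unfolding obs_dens_def
  proof (rule ln_sum_shift_bound)
    show "{..<k} - {i} \<noteq> {}" using other_index[OF k, of i] by blast
  qed (auto intro!: mult_pos_pos prod_pos step)
  have "A i = \<bar>\<alpha>\<bar>" by (simp add: A_def \<alpha>_def)
  then have "A i - D \<le> \<bar>nll k i s \<mu>' - nll k i s \<mu>\<bar>" using main unfolding nll_def by linarith
  moreover have "N / (144 * M\<^sup>2) \<le> A i - D"
  proof -
    have "N \<le> A i" using T(3)[OF j0(1)] Ai[OF j0(1)] j0 by simp
    then have "q * N \<le> q * A i" using q by (intro mult_left_mono)
    moreover have "real k * e * N \<le> 1 / (144 * M\<^sup>2) * N" using eps N0 unfolding e_def by (intro mult_right_mono)
    moreover have "q * N = 2 * (1 / (144 * M\<^sup>2) * N)" by (simp add: q_def)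
    ultimately show ?thesis unfolding D_def by (simp add: algebra_simps)
  qed
  moreover have "\<nu> j / (144 * M\<^sup>2) \<le> N / (144 * M\<^sup>2)" if "j < k" for j
    using N[OF that] by (intro divide_right_mono) auto
  ultimately show ?thesis using i(1) unfolding \<nu>_def by (meson order.trans)
qed

lemma obs_dens_lower:
  assumes k: "2 \<le> k" and M: "1 \<le> M" and eps: "real k * exp (- M\<^sup>2 / 2) \<le> 1 / (144 * M\<^sup>2)"
    and \<mu>: "\<And>l. l < k \<Longrightarrow> \<bar>\<mu> l\<bar> \<le> M"
    and s: "2 * M \<le> s" "s \<le> 2 * M + 1" and i: "i < k"
  shows "exp (- 22 * M\<^sup>2) \<le> obs_dens k i s \<mu>"
proof -
  obtain j where j: "j < k" "j \<noteq> i" using other_index[OF k, of i] by auto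
  have rng: "M \<le> s - \<mu> l" "s - \<mu> l \<le> 4 * M" if "l < k" for l
    using \<mu>[OF that] s M by linarith+
  define e where "e = exp (- M\<^sup>2 / 2)"
  have M2: "1 \<le> M\<^sup>2" using M by simp
  have ndlo: "exp (- 8 * M\<^sup>2) / 3 \<le> nd (s - \<mu> l)" if "l < k" for l
  proof -
    have "(s - \<mu> l)\<^sup>2 \<le> (4 * M)\<^sup>2" using rng[OF that] M by (intro power_mono) auto
    then have "exp (- 8 * M\<^sup>2) \<le> exp (- (s - \<mu> l)\<^sup>2 / 2)" by (simp add: power_mult_distrib)
    then show ?thesis using nd_ge[of "s - \<mu> l"] by linarith
  qed
  have ni: "exp (- 8 * M\<^sup>2) / (18 * M) \<le> ncdf (\<mu> i - s)"
  proof -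
    have "exp (- 8 * M\<^sup>2) / (18 * M) = (exp (- 8 * M\<^sup>2) / 3) / (6 * M)" by simp
    also have "\<dots> \<le> nd (s - \<mu> i) / (6 * M)" using ndlo[OF i] M by (intro divide_right_mono) auto
    also have "\<dots> \<le> nd (s - \<mu> i) / ((s - \<mu> i) + 2)"
      using rng[OF i] M by (intro divide_left_mono) (auto intro!: mult_pos_pos)
    also have "\<dots> \<le> ncdf (\<mu> i - s)" using ncdf_minus_ge[of "s - \<mu> i"] rng[OF i] M by simp
    finally show ?thesis .
  qed
  have nl: "1 - e \<le> ncdf (s - \<mu> l)" if "l < k" for l
  proof -
    have "M\<^sup>2 \<le> (s - \<mu> l)\<^sup>2" using rng[OF that] M by (intro power_mono) auto
    then have "exp (- (s - \<mu> l)\<^sup>2 / 2) \<le> e" by (simp add: e_def)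
    moreover have "ncdf (- (s - \<mu> l)) \<le> nd (s - \<mu> l)"
    proof -
      have pos: "1 \<le> s - \<mu> l" using rng[OF that] M by simp
      then have "0 \<le> (s - \<mu> l) / ((s - \<mu> l)\<^sup>2 + 2)" by simp
      then have "1 \<le> rhaz (- (s - \<mu> l))" using rhaz_minus_ge[of "s - \<mu> l"] pos by linarith
      then show ?thesis by (simp add: rhaz_def le_divide_eq del: minus_diff_eq)
    qed
    ultimately show ?thesis
      using nd_le[of "s - \<mu> l"] exp_gt_zero[of "- (s - \<mu> l)\<^sup>2 / 2"] ncdf_minus[of "s - \<mu> l"] by linarith
  qed
  have ke: "real k * e \<le> 1/2"
  proof -
    have "1 / (144 * M\<^sup>2) \<le> 1 / 144" using M2 by (intro divide_left_mono) auto
    then show ?thesis using eps unfolding e_def by linarith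
  qed
  have e0: "0 \<le> e" "e \<le> 1"
  proof -
    show "0 \<le> e" by (simp add: e_def)
    have "1 * e \<le> real k * e" using k \<open>0 \<le> e\<close> by (intro mult_right_mono) auto
    then show "e \<le> 1" using ke by simp
  qed
  let ?J = "{..<k} - {j} - {i}"
  have pj: "1/2 \<le> (\<Prod>l\<in>?J. ncdf (s - \<mu> l))"
  proof -
    have "1/2 \<le> 1 + real (card ?J) * (- e)"
    proof -
      have "card ?J \<le> k" using card_mono[of "{..<k}" ?J] by auto
      then have "real (card ?J) * e \<le> real k * e" using e0 by (intro mult_right_mono) auto
      then show ?thesis using ke by simp
    qed
    also have "\<dots> \<le> (1 + (- e)) ^ card ?J" using e0 by (intro Bernoulli_inequality) simp
    also have "\<dots> = (\<Prod>l\<in>?J. 1 - e)" by simp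
    also have "\<dots> \<le> (\<Prod>l\<in>?J. ncdf (s - \<mu> l))" using e0 nl by (intro prod_mono) auto
    finally show ?thesis .
  qed
  have "exp (- 22 * M\<^sup>2) \<le> (exp (- 8 * M\<^sup>2) / 3) * ((exp (- 8 * M\<^sup>2) / (18 * M)) * (1/2))"
  proof -
    have "M \<le> M\<^sup>2" using M by (simp add: power2_eq_square)
    also have "\<dots> \<le> exp (M\<^sup>2)" using exp_ge_add_one_self[of "M\<^sup>2"] by linarith
    finally have "M \<le> exp (M\<^sup>2)" .
    moreover have "108 \<le> exp (5 * M\<^sup>2)"
    proof -
      have "(108::real) \<le> 2.7 ^ 5" by (simp add: power_numeral_reduce)
      also have "\<dots> \<le> exp 1 ^ 5" using e_approx_32 by (intro power_mono) (auto simp: abs_if split: if_splits)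
      also have "\<dots> = exp 5" by (simp add: exp_of_nat_mult[symmetric])
      also have "\<dots> \<le> exp (5 * M\<^sup>2)" using M2 by simp
      finally show ?thesis .
    qed
    ultimately have "108 * M \<le> exp (5 * M\<^sup>2) * exp (M\<^sup>2)" using M by (intro mult_mono) auto
    also have "\<dots> = exp (6 * M\<^sup>2)" by (simp add: exp_add[symmetric])
    finally have "exp (- 22 * M\<^sup>2) * (108 * M) \<le> exp (- 22 * M\<^sup>2) * exp (6 * M\<^sup>2)" by (intro mult_left_mono) auto
    also have "\<dots> = exp (- 8 * M\<^sup>2) * exp (- 8 * M\<^sup>2)" by (simp add: exp_add[symmetric])
    finally show ?thesis using M by (simp add: field_simps)
  qed
  also have "\<dots> \<le> nd (s - \<mu> j) * (ncdf (\<mu> i - s) * (\<Prod>l\<in>?J. ncdf (s - \<mu> l)))"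
    using ndlo[OF j(1)] ni pj M by (intro mult_mono) (auto intro!: mult_nonneg_nonneg)
  also have "\<dots> = nd (s - \<mu> j) * (\<Prod>l\<in>{..<k}-{j}. side i s \<mu> l)"
  proof -
    have "(\<Prod>l\<in>{..<k}-{j}. side i s \<mu> l) = side i s \<mu> i * (\<Prod>l\<in>?J. side i s \<mu> l)"
      using i j by (intro prod.remove) auto
    also have "(\<Prod>l\<in>?J. side i s \<mu> l) = (\<Prod>l\<in>?J. ncdf (s - \<mu> l))"
      by (rule prod.cong) (auto simp: side_def)
    finally show ?thesis by (simp add: side_def)
  qed
  also have "\<dots> \<le> obs_dens k i s \<mu>"
    unfolding obs_dens_def using j
    by (intro member_le_sum[of j "{..<k}-{i}" "\<lambda>j. nd (s - \<mu> j) * (\<Prod>l\<in>{..<k}-{j}. side i s \<mu> l)"])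
       (auto intro!: mult_nonneg_nonneg prod_nonneg)
  finally show ?thesis .
qed

section \<open>Information preservation\<close>

lemma dens_nonneg [simp]: "0 \<le> dens d k W \<omega>"
  by (simp add: dens_def split: prod.split)

lemma borel_measurable_base: "f \<in> borel_measurable (obs_space d k) \<Longrightarrow> f \<in> borel_measurable (base d k)"
  by (subst measurable_cong_sets[OF sets_base refl])

lemma integrable_auction_model_iff:
  fixes f :: "(nat \<Rightarrow> real) \<times> nat \<times> real \<Rightarrow> real"
  assumes k: "2 \<le> k" and [measurable]: "f \<in> borel_measurable (obs_space d k)"
  shows "integrable (auction_model d k W) f \<longleftrightarrow> integrable (base d k) (\<lambda>\<omega>. dens d k W \<omega> * f \<omega>)"
  unfolding auction_model_density[OF k]
  by (rule integrable_real_density) (simp_all add: borel_measurable_base)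

lemma integral_auction_model:
  fixes f :: "(nat \<Rightarrow> real) \<times> nat \<times> real \<Rightarrow> real"
  assumes k: "2 \<le> k" and [measurable]: "f \<in> borel_measurable (obs_space d k)"
  shows "integral\<^sup>L (auction_model d k W) f = (\<integral>\<omega>. dens d k W \<omega> * f \<omega> \<partial>base d k)"
  unfolding auction_model_density[OF k]
  by (rule integral_real_density) (simp_all add: borel_measurable_base)

lemma integrable_dens:
  assumes k: "2 \<le> k"
  shows "integrable (base d k) (dens d k W)" "(\<integral>\<omega>. dens d k W \<omega> \<partial>base d k) = 1"
proof -
  interpret P: prob_space "auction_model d k W" by (rule prob_space_auction_model[OF k])
  show "integrable (base d k) (dens d k W)"
    using integrable_auction_model_iff[OF k, of "\<lambda>_. 1" d W] by simp
  show "(\<integral>\<omega>. dens d k W \<omega> \<partial>base d k) = 1"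
    using integral_auction_model[OF k, of "\<lambda>_. 1" d W] P.prob_space by simp
qed

lemma measure_auction_model:
  assumes k: "2 \<le> k" and A[measurable]: "A \<in> sets (obs_space d k)"
  shows "measure (auction_model d k W) A = (\<integral>\<omega>. dens d k W \<omega> * indicator A \<omega> \<partial>base d k)"
proof -
  have "measure (auction_model d k W) A = (\<integral>\<omega>. indicator A \<omega> \<partial>auction_model d k W)"
    using sets.sets_into_space[OF A] by (simp add: Int_absorb2 sets_eq_imp_space_eq[OF sets_auction_model])
  also have "\<dots> = (\<integral>\<omega>. dens d k W \<omega> * indicator A \<omega> \<partial>base d k)"
    by (rule integral_auction_model[OF k]) measurable
  finally show ?thesis .
qed

lemma dTV_ge:
  assumes k: "2 \<le> k" and A: "A \<in> sets (obs_space d k)"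
  shows "\<bar>measure (auction_model d k V) A - measure (auction_model d k W) A\<bar> \<le> dTV (auction_model d k V) (auction_model d k W)"
  unfolding dTV_def
proof (rule cSUP_upper)
  interpret P: prob_space "auction_model d k V" by (rule prob_space_auction_model[OF k])
  interpret Q: prob_space "auction_model d k W" by (rule prob_space_auction_model[OF k])
  show "A \<in> sets (auction_model d k V)" using A by simp
  have "\<bar>P.prob B - Q.prob B\<bar> \<le> 1" for B
    using P.prob_le_1[of B] Q.prob_le_1[of B] measure_nonneg[of "auction_model d k V" B] measure_nonneg[of "auction_model d k W" B] by linarith
  then show "bdd_above ((\<lambda>B. \<bar>P.prob B - Q.prob B\<bar>) ` P.events)" by (intro bdd_aboveI2[where M=1])
qed

lemma integral_abs_dens_diff_le_dTV:
  assumes k: "2 \<le> k"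
  shows "(\<integral>\<omega>. \<bar>dens d k V \<omega> - dens d k W \<omega>\<bar> \<partial>base d k) \<le> 2 * dTV (auction_model d k V) (auction_model d k W)"
proof -
  let ?p = "dens d k V" and ?q = "dens d k W"
  define A where "A = {\<omega> \<in> space (obs_space d k). ?q \<omega> < ?p \<omega>}"
  define B where "B = {\<omega> \<in> space (obs_space d k). \<not> ?q \<omega> < ?p \<omega>}"
  have A[measurable]: "A \<in> sets (obs_space d k)" unfolding A_def by measurable
  have B[measurable]: "B \<in> sets (obs_space d k)" unfolding B_def by measurable
  have i: "integrable (base d k) (\<lambda>\<omega>. dens d k U \<omega> * indicator S \<omega>)" if "S \<in> sets (obs_space d k)" for U S
    using that by (intro integrable_real_mult_indicator integrable_dens[OF k]) (simp add: sets_base)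
  have "(\<integral>\<omega>. \<bar>?p \<omega> - ?q \<omega>\<bar> \<partial>base d k) = (\<integral>\<omega>. (?p \<omega> * indicator A \<omega> - ?q \<omega> * indicator A \<omega>) + (?q \<omega> * indicator B \<omega> - ?p \<omega> * indicator B \<omega>) \<partial>base d k)"
    by (rule Bochner_Integration.integral_cong[OF refl]) (auto simp: A_def B_def space_base split: split_indicator)
  also have "\<dots> = (measure (auction_model d k V) A - measure (auction_model d k W) A) + (measure (auction_model d k W) B - measure (auction_model d k V) B)"
    unfolding measure_auction_model[OF k A] measure_auction_model[OF k B]
    by (simp add: i A B)
  also have "\<dots> \<le> 2 * dTV (auction_model d k V) (auction_model d k W)"
    using dTV_ge[OF k A, of V W] dTV_ge[OF k B, of V W] by linarith
  finally show ?thesis .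
qed

lemma nn_integral_base_ge:
  fixes f :: "(nat \<Rightarrow> real) \<times> nat \<times> real \<Rightarrow> real"
  assumes [measurable]: "f \<in> borel_measurable (obs_space d k)"
    and X: "X \<in> sets (gauss d)" "1/2 \<le> measure (gauss d) X"
    and b: "0 \<le> b" "\<And>x s. x \<in> X \<Longrightarrow> S \<le> s \<Longrightarrow> s \<le> S + 1 \<Longrightarrow> \<exists>i<k. b \<le> f (x, i, s)"
  shows "ennreal (b / 2) \<le> (\<integral>\<^sup>+ \<omega>. ennreal (f \<omega>) \<partial>base d k)"
proof -
  let ?P = "gauss d"
  interpret P: prob_space ?P by (rule prob_space_PiM_N01)
  have "ennreal (b / 2) = ennreal b * ennreal (1/2)" using b(1) by (subst ennreal_mult[symmetric]) simp_all
  also have "\<dots> \<le> ennreal b * emeasure ?P X"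
    unfolding P.emeasure_eq_measure by (intro mult_left_mono ennreal_leI X(2)) simp
  also have "\<dots> = (\<integral>\<^sup>+ x. ennreal b * indicator X x \<partial>?P)"
    using X(1) by (rule nn_integral_cmult_indicator[symmetric])
  also have "\<dots> \<le> (\<integral>\<^sup>+ x. (\<Sum>i<k. \<integral>\<^sup>+ s. ennreal (f (x, i, s)) \<partial>lborel) \<partial>?P)"
  proof (rule nn_integral_mono)
    fix x assume x: "x \<in> space ?P"
    have m: "(\<lambda>s. ennreal (f (x, i, s))) \<in> borel_measurable lborel" if "i < k" for i
      using borel_measurable_obs_slice[OF assms(1) x that] by simp
    show "ennreal b * indicator X x \<le> (\<Sum>i<k. \<integral>\<^sup>+ s. ennreal (f (x, i, s)) \<partial>lborel)"
    proof (cases "x \<in> X")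
      case True
      have "ennreal b = (\<integral>\<^sup>+ s. ennreal b * indicator {S..S+1} s \<partial>lborel)"
        by (subst nn_integral_cmult_indicator) auto
      also have "\<dots> \<le> (\<integral>\<^sup>+ s. (\<Sum>i<k. ennreal (f (x, i, s))) \<partial>lborel)"
      proof (rule nn_integral_mono)
        fix s :: real
        show "ennreal b * indicator {S..S+1} s \<le> (\<Sum>i<k. ennreal (f (x, i, s)))"
        proof (cases "s \<in> {S..S+1}")
          case s: True
          obtain i where i: "i < k" "b \<le> f (x, i, s)" using b(2)[OF True] s by auto
          have "ennreal b \<le> ennreal (f (x, i, s))" using i by (intro ennreal_leI)
          also have "\<dots> \<le> (\<Sum>i<k. ennreal (f (x, i, s)))"
            using i by (intro member_le_sum[of i "{..<k}" "\<lambda>i. ennreal (f (x, i, s))"]) auto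
          finally show ?thesis using s by simp
        qed simp
      qed
      also have "\<dots> = (\<Sum>i<k. \<integral>\<^sup>+ s. ennreal (f (x, i, s)) \<partial>lborel)"
        using m by (intro nn_integral_sum) auto
      finally show ?thesis using True by simp
    qed simp
  qed
  also have "\<dots> = (\<integral>\<^sup>+ \<omega>. ennreal (f \<omega>) \<partial>base d k)"
    by (rule nn_integral_base[symmetric]) measurable
  finally show ?thesis .
qed

definition rad :: "real \<Rightarrow> nat \<Rightarrow> real" where
  "rad C k = sqrt (32 * C\<^sup>2 * (1 + ln (real k)))"

lemma rad_sq: "1 \<le> C \<Longrightarrow> 2 \<le> k \<Longrightarrow> (rad C k)\<^sup>2 = 32 * C\<^sup>2 * (1 + ln (real k))"
  unfolding rad_def by (rule real_sqrt_pow2) (auto intro!: mult_nonneg_nonneg)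

lemma rad_sq_ge:
  assumes "1 \<le> C" "2 \<le> k"
  shows "32 * (1 + ln (real k)) \<le> (rad C k)\<^sup>2" "32 \<le> (rad C k)\<^sup>2" "1 \<le> rad C k"
proof -
  have l: "0 \<le> ln (real k)" using assms by simp
  have "1 \<le> C\<^sup>2" using assms by simp
  then have "1 * (32 * (1 + ln (real k))) \<le> C\<^sup>2 * (32 * (1 + ln (real k)))" using l by (intro mult_right_mono) auto
  then show 1: "32 * (1 + ln (real k)) \<le> (rad C k)\<^sup>2" by (simp add: rad_sq[OF assms] algebra_simps)
  show 2: "32 \<le> (rad C k)\<^sup>2" by (rule order.trans[OF _ 1]) (use l in simp)
  have "1\<^sup>2 \<le> (rad C k)\<^sup>2" using 2 by simp
  then show "1 \<le> rad C k" by (rule power2_le_imp_le) (use l in \<open>simp add: rad_def\<close>)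
qed

lemma rad_eps:
  assumes "1 \<le> C" "2 \<le> k"
  shows "real k * exp (- (rad C k)\<^sup>2 / 2) \<le> 1 / (144 * (rad C k)\<^sup>2)"
proof -
  define y where "y = (rad C k)\<^sup>2"
  have y: "32 * (1 + ln (real k)) \<le> y" "32 \<le> y" using rad_sq_ge[OF assms] by (auto simp: y_def)
  have "real k = exp (ln (real k))" using assms by simp
  also have "\<dots> \<le> exp (y / 32)" using y by (subst exp_le_cancel_iff) simp
  finally have 1: "real k \<le> exp (y / 32)" .
  have 2: "y \<le> exp (y / 4)"
  proof -
    have "y = 32 * (y / 32)" by simp
    also have "\<dots> \<le> y * (y / 32)" using y by (intro mult_right_mono) auto
    also have "\<dots> = (y / 4)\<^sup>2 / 2" by (simp add: power2_eq_square)
    also have "\<dots> \<le> exp (y / 4)" using exp_lower_Taylor_quadratic[of "y / 4"] y by linarith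
    finally show ?thesis .
  qed
  have 3: "144 \<le> exp (y * (7 / 32))"
  proof -
    have "(144::real) \<le> 2.7 ^ 7" by (simp add: power_numeral_reduce)
    also have "\<dots> \<le> exp 1 ^ 7" using e_approx_32 by (intro power_mono) (auto simp: abs_if split: if_splits)
    also have "\<dots> = exp 7" by (simp add: exp_of_nat_mult[symmetric])
    also have "\<dots> \<le> exp (y * (7 / 32))" using y by (subst exp_le_cancel_iff) simp
    finally show ?thesis .
  qed
  have "real k * (144 * y) \<le> exp (y / 32) * (exp (y * (7 / 32)) * exp (y / 4))"
    using 1 2 3 y by (intro mult_mono) auto
  also have "\<dots> = exp (y / 2)" by (simp add: exp_add[symmetric])
  finally have "real k * (144 * y) * exp (- y / 2) \<le> exp (y / 2) * exp (- y / 2)" by (intro mult_right_mono) auto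
  also have "\<dots> = 1" by (simp add: exp_add[symmetric])
  finally show ?thesis using y unfolding y_def[symmetric] by (simp add: pos_le_divide_eq mult_ac)
qed

definition typical :: "nat \<Rightarrow> nat \<Rightarrow> real \<Rightarrow> (nat \<Rightarrow> nat \<Rightarrow> real) \<Rightarrow> (nat \<Rightarrow> nat \<Rightarrow> real) \<Rightarrow> nat \<Rightarrow> (nat \<Rightarrow> real) set" where
  "typical d k M V W j = {x \<in> space (gauss d).
     (\<forall>l\<in>{..<k}. \<bar>WTx d V x l\<bar> \<le> M \<and> \<bar>WTx d W x l\<bar> \<le> M) \<and>
     sqrt (colnorm2 d (mdiff V W) j) / 2 \<le> \<bar>WTx d V x j - WTx d W x j\<bar>}"

lemma WTx_mdiff: "WTx d (mdiff V W) x j = WTx d V x j - WTx d W x j"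
  by (simp add: WTx_def mdiff_def left_diff_distrib sum_subtractf)

lemma typical_measurable: "typical d k M V W j \<in> sets (gauss d)"
  unfolding typical_def by measurable

lemma measure_typical:
  assumes C: "1 \<le> C" and k: "2 \<le> k"
    and V: "\<And>l. l < k \<Longrightarrow> sqrt (colnorm2 d V l) \<le> 2 * C" and W: "\<And>l. l < k \<Longrightarrow> sqrt (colnorm2 d W l) \<le> 2 * C"
  shows "1/2 \<le> measure (gauss d) (typical d k (rad C k) V W j)"
proof -
  let ?P = "gauss d"
  interpret P: prob_space ?P by (rule prob_space_PiM_N01)
  define M where "M = rad C k"
  define t where "t = M / (2 * C)"
  have tC: "t * (2 * C) = M" using C by (simp add: t_def)
  have M1: "1 \<le> M" using rad_sq_ge[OF C k] by (simp add: M_def)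
  have t2: "t\<^sup>2 = 8 * (1 + ln (real k))" using C rad_sq[OF C k] by (simp add: t_def M_def power_divide power_mult_distrib)
  have lk: "0 \<le> ln (real k)" using k by simp
  have t1: "1 \<le> t"
  proof -
    have "1\<^sup>2 \<le> t\<^sup>2" using t2 lk by simp
    then show ?thesis by (rule power2_le_imp_le) (use M1 C in \<open>simp add: t_def\<close>)
  qed
  have tail: "P.prob {x \<in> space ?P. M < \<bar>WTx d U x l\<bar>} \<le> exp (- t\<^sup>2 / 2)" if "sqrt (colnorm2 d U l) \<le> 2 * C" for U l
    using gauss_lin_tail[OF t1, where d=d and c="\<lambda>a. U a l" and b="2 * C"] that unfolding tC WTx_def colnorm2_def by simp
  define B where "B = (\<lambda>l. {x \<in> space ?P. M < \<bar>WTx d V x l\<bar>} \<union> {x \<in> space ?P. M < \<bar>WTx d W x l\<bar>})"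
  define G where "G = {x \<in> space ?P. sqrt (colnorm2 d (mdiff V W) j) / 2 \<le> \<bar>WTx d V x j - WTx d W x j\<bar>}"
  have Bm[measurable]: "B l \<in> P.events" for l unfolding B_def by measurable
  have Gm[measurable]: "G \<in> P.events" unfolding G_def by measurable
  have Bl: "P.prob (B l) \<le> 2 * exp (- t\<^sup>2 / 2)" if "l < k" for l
  proof -
    have "P.prob (B l) \<le> P.prob {x \<in> space ?P. M < \<bar>WTx d V x l\<bar>} + P.prob {x \<in> space ?P. M < \<bar>WTx d W x l\<bar>}"
      unfolding B_def by (rule measure_Un_le) measurable
    then show ?thesis using tail[OF V[OF that]] tail[OF W[OF that]] by linarith
  qed
  have "P.prob (\<Union>l\<in>{..<k}. B l) \<le> (\<Sum>l<k. P.prob (B l))"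
    by (rule measure_UNION_le) (simp_all add: Bm)
  also have "\<dots> \<le> (\<Sum>l<k. 2 * exp (- t\<^sup>2 / 2))" using Bl by (intro sum_mono) auto
  also have "\<dots> = 2 * (real k * exp (- t\<^sup>2 / 2))" by simp
  also have "real k * exp (- t\<^sup>2 / 2) \<le> 1/20"
  proof -
    have "real k * exp (- t\<^sup>2 / 2) = exp (ln (real k)) * exp (- t\<^sup>2 / 2)" using k by simp
    also have "\<dots> = exp (- 4 - 3 * ln (real k))" unfolding t2 exp_add[symmetric] by (rule arg_cong[where f=exp]) (simp add: field_simps)
    also have "\<dots> \<le> exp (- 4)" using lk by simp
    also have "\<dots> \<le> 1 / 20"
    proof -
      have "(20::real) \<le> 2.7 ^ 4" by (simp add: power_numeral_reduce)
      also have "\<dots> \<le> exp 1 ^ 4" using e_approx_32 by (intro power_mono) (auto simp: abs_if split: if_splits)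
      also have "\<dots> = exp 4" by (simp add: exp_of_nat_mult[symmetric])
      finally show ?thesis by (simp add: exp_minus field_simps)
    qed
    finally show ?thesis .
  qed
  finally have bad: "P.prob (\<Union>l\<in>{..<k}. B l) \<le> 1/10" by simp
  have good: "3/5 \<le> P.prob G"
    using gauss_lin_anticonc[where d=d and c="\<lambda>a. mdiff V W a j"]
    unfolding G_def WTx_mdiff[symmetric] by (simp add: WTx_def colnorm2_def)
  have "G \<subseteq> typical d k M V W j \<union> (\<Union>l\<in>{..<k}. B l)"
  proof
    fix x assume x: "x \<in> G"
    show "x \<in> typical d k M V W j \<union> (\<Union>l\<in>{..<k}. B l)"
    proof (cases "\<forall>l\<in>{..<k}. \<bar>WTx d V x l\<bar> \<le> M \<and> \<bar>WTx d W x l\<bar> \<le> M")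
      case True
      then show ?thesis using x by (simp add: typical_def G_def)
    next
      case False
      then show ?thesis using x by (auto simp: B_def G_def not_le)
    qed
  qed
  then have "P.prob G \<le> P.prob (typical d k M V W j \<union> (\<Union>l\<in>{..<k}. B l))"
    by (intro P.finite_measure_mono sets.Un sets.finite_UN typical_measurable Bm) simp_all
  also have "\<dots> \<le> P.prob (typical d k M V W j) + P.prob (\<Union>l\<in>{..<k}. B l)"
    by (intro measure_Un_le sets.finite_UN typical_measurable Bm) simp_all
  finally show ?thesis using bad good unfolding M_def by linarith
qed

lemma log_density_gap_integral:
  assumes C: "1 \<le> C" and k: "2 \<le> k"
    and V: "\<And>l. l < k \<Longrightarrow> sqrt (colnorm2 d V l) \<le> 2 * C" and W: "\<And>l. l < k \<Longrightarrow> sqrt (colnorm2 d W l) \<le> 2 * C"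
    and j: "j < k"
  shows "ennreal (exp (- 22 * (rad C k)\<^sup>2) * (sqrt (colnorm2 d (mdiff V W) j) / (288 * (rad C k)\<^sup>2)) ^ r / 2)
    \<le> (\<integral>\<^sup>+ \<omega>. ennreal (min (dens d k V \<omega>) (dens d k W \<omega>) * \<bar>ln (dens d k V \<omega>) - ln (dens d k W \<omega>)\<bar> ^ r) \<partial>base d k)"
proof (rule nn_integral_base_ge[where X="typical d k (rad C k) V W j" and S="2 * rad C k"])
  define M where "M = rad C k"
  have M: "1 \<le> M" "real k * exp (- M\<^sup>2 / 2) \<le> 1 / (144 * M\<^sup>2)"
    using rad_sq_ge[OF C k] rad_eps[OF C k] by (auto simp: M_def)
  define \<sigma> where "\<sigma> = sqrt (colnorm2 d (mdiff V W) j)"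
  have \<sigma>: "0 \<le> \<sigma>" by (simp add: \<sigma>_def colnorm2_def sum_nonneg)
  show "(\<lambda>\<omega>. min (dens d k V \<omega>) (dens d k W \<omega>) * \<bar>ln (dens d k V \<omega>) - ln (dens d k W \<omega>)\<bar> ^ r) \<in> borel_measurable (obs_space d k)"
    by (intro borel_measurable_times borel_measurable_min borel_measurable_power borel_measurable_abs borel_measurable_diff
        borel_measurable_ln borel_measurable_dens)
  show "1/2 \<le> measure (gauss d) (typical d k (rad C k) V W j)"
    by (rule measure_typical[OF C k V W])
  show "typical d k (rad C k) V W j \<in> sets (gauss d)" by (rule typical_measurable)
  show "0 \<le> exp (- 22 * (rad C k)\<^sup>2) * (sqrt (colnorm2 d (mdiff V W) j) / (288 * (rad C k)\<^sup>2)) ^ r"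
    using \<sigma> by (simp add: \<sigma>_def)
  fix x s assume x: "x \<in> typical d k (rad C k) V W j" and s: "2 * rad C k \<le> s" "s \<le> 2 * rad C k + 1"
  have b: "\<bar>WTx d V x l\<bar> \<le> M" "\<bar>WTx d W x l\<bar> \<le> M" if "l < k" for l
    using x that by (auto simp: typical_def M_def)
  have s': "2 * M \<le> s" "s \<le> 2 * M + 1" using s by (auto simp: M_def)
  have gap: "\<sigma> / 2 \<le> \<bar>WTx d V x j - WTx d W x j\<bar>" using x by (simp add: typical_def \<sigma>_def)
  have "\<exists>i<k. \<forall>j<k. \<bar>WTx d V x j - WTx d W x j\<bar> / (144 * M\<^sup>2) \<le> \<bar>nll k i s (WTx d V x) - nll k i s (WTx d W x)\<bar>"
    by (rule nll_separation[OF k M b(2) b(1) s'])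
  then obtain i where i1: "i < k" and all: "\<forall>j<k. \<bar>WTx d V x j - WTx d W x j\<bar> / (144 * M\<^sup>2) \<le> \<bar>nll k i s (WTx d V x) - nll k i s (WTx d W x)\<bar>"
    by (elim exE conjE)
  note i = i1 all[rule_format, OF j]
  have "\<sigma> / (288 * M\<^sup>2) = (\<sigma> / 2) / (144 * M\<^sup>2)" by simp
  also have "\<dots> \<le> \<bar>WTx d V x j - WTx d W x j\<bar> / (144 * M\<^sup>2)" using gap by (intro divide_right_mono) auto
  also have "\<dots> \<le> \<bar>nll k i s (WTx d V x) - nll k i s (WTx d W x)\<bar>" by (rule i(2))
  also have "\<dots> = \<bar>ln (dens d k V (x, i, s)) - ln (dens d k W (x, i, s))\<bar>"
    by (simp add: nll_def dens_def)
  finally have L: "\<sigma> / (288 * M\<^sup>2) \<le> \<bar>ln (dens d k V (x, i, s)) - ln (dens d k W (x, i, s))\<bar>" .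
  have "exp (- 22 * M\<^sup>2) \<le> min (dens d k V (x, i, s)) (dens d k W (x, i, s))"
    using obs_dens_lower[OF k M b(1) s' i(1)] obs_dens_lower[OF k M b(2) s' i(1)] by (simp add: dens_def)
  then have "exp (- 22 * M\<^sup>2) * (\<sigma> / (288 * M\<^sup>2)) ^ r
    \<le> min (dens d k V (x, i, s)) (dens d k W (x, i, s)) * \<bar>ln (dens d k V (x, i, s)) - ln (dens d k W (x, i, s))\<bar> ^ r"
    using L \<sigma> by (intro mult_mono power_mono) simp_all
  then show "\<exists>i<k. exp (- 22 * (rad C k)\<^sup>2) * (sqrt (colnorm2 d (mdiff V W) j) / (288 * (rad C k)\<^sup>2)) ^ r
    \<le> min (dens d k V (x, i, s)) (dens d k W (x, i, s)) * \<bar>ln (dens d k V (x, i, s)) - ln (dens d k W (x, i, s))\<bar> ^ r"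
    using i(1) unfolding M_def \<sigma>_def by (intro exI conjI)
qed

lemma dens_pos: "2 \<le> k \<Longrightarrow> 0 < dens d k W \<omega>"
  by (auto simp: dens_def obs_dens_pos split: prod.split)

lemma abs_diff_ge_min_ln:
  fixes p q :: real
  assumes "0 < p" "0 < q"
  shows "min p q * \<bar>ln p - ln q\<bar> \<le> \<bar>p - q\<bar>"
proof -
  have *: "q * (ln p - ln q) \<le> p - q" if "0 < q" "q \<le> p" for p q :: real
  proof -
    have "ln (p / q) \<le> p / q - 1" using that by (intro ln_le_minus_one) auto
    then have "q * ln (p / q) \<le> q * (p / q - 1)" using that by (intro mult_left_mono) auto
    then show ?thesis using that by (simp add: ln_div algebra_simps)
  qed
  show ?thesis
  proof (cases "q \<le> p")
    case True
    then have "ln q \<le> ln p" using assms by simp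
    then show ?thesis using *[OF assms(2) True] True by (simp add: min_def)
  next
    case False
    then have "ln p \<le> ln q" using assms by simp
    then show ?thesis using *[OF assms(1), of q] False by (simp add: min_def abs_if)
  qed
qed

lemma colnorm_le_frob: "j < k \<Longrightarrow> sqrt (colnorm2 d D j) \<le> frob d k D"
proof -
  assume j: "j < k"
  have "colnorm2 d D j \<le> (\<Sum>i<k. colnorm2 d D i)"
    using j by (intro member_le_sum) (auto simp: colnorm2_def sum_nonneg)
  also have "\<dots> = (\<Sum>l<d. \<Sum>i<k. (D l i)\<^sup>2)" unfolding colnorm2_def by (rule sum.swap)
  finally show ?thesis unfolding frob_def by simp
qed

lemma frob_le_max_colnorm:
  assumes "0 < k"
  shows "\<exists>j<k. frob d k D \<le> sqrt (real k) * sqrt (colnorm2 d D j)"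
proof -
  have "Max (colnorm2 d D ` {..<k}) \<in> colnorm2 d D ` {..<k}"
    using assms by (intro Max_in) auto
  then obtain j where j: "j < k" "colnorm2 d D j = Max (colnorm2 d D ` {..<k})" by auto
  have "(\<Sum>l<d. \<Sum>i<k. (D l i)\<^sup>2) = (\<Sum>i<k. colnorm2 d D i)" unfolding colnorm2_def by (rule sum.swap)
  also have "\<dots> \<le> (\<Sum>i<k. colnorm2 d D j)" unfolding j(2) by (intro sum_mono Max_ge) auto
  finally have "frob d k D \<le> sqrt (real k * colnorm2 d D j)" unfolding frob_def by simp
  then show ?thesis using j(1) by (auto simp: real_sqrt_mult)
qed

lemma colnorm_triangle:
  assumes "frob d k (mdiff V W) \<le> 1" "sqrt (colnorm2 d W l) \<le> C" "1 \<le> C" "l < k"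
  shows "sqrt (colnorm2 d V l) \<le> 2 * C"
proof -
  have "L2_set (\<lambda>a. mdiff V W a l + W a l) {..<d} \<le> L2_set (\<lambda>a. mdiff V W a l) {..<d} + L2_set (\<lambda>a. W a l) {..<d}"
    by (rule L2_set_triangle_ineq)
  then have "sqrt (colnorm2 d V l) \<le> sqrt (colnorm2 d (mdiff V W) l) + sqrt (colnorm2 d W l)"
    by (simp add: L2_set_def colnorm2_def mdiff_def)
  then show ?thesis using colnorm_le_frob[OF assms(4), of d "mdiff V W"] assms by linarith
qed

lemma dTV_lower_bound:
  assumes C: "1 \<le> C" and k: "2 \<le> k"
    and V: "\<And>l. l < k \<Longrightarrow> sqrt (colnorm2 d V l) \<le> 2 * C" and W: "\<And>l. l < k \<Longrightarrow> sqrt (colnorm2 d W l) \<le> 2 * C"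
  shows "exp (- 30 * (rad C k)\<^sup>2) * frob d k (mdiff V W) \<le> dTV (auction_model d k V) (auction_model d k W)"
proof -
  obtain j where j: "j < k" "frob d k (mdiff V W) \<le> sqrt (real k) * sqrt (colnorm2 d (mdiff V W) j)"
    using frob_le_max_colnorm[of k d "mdiff V W"] k by auto
  define y where "y = (rad C k)\<^sup>2"
  define \<sigma> where "\<sigma> = sqrt (colnorm2 d (mdiff V W) j)"
  define b where "b = exp (- 22 * y) * (\<sigma> / (288 * y)) / 2"
  have y: "32 * (1 + ln (real k)) \<le> y" "32 \<le> y" using rad_sq_ge[OF C k] by (auto simp: y_def)
  have \<sigma>: "0 \<le> \<sigma>" by (simp add: \<sigma>_def colnorm2_def sum_nonneg)
  let ?p = "dens d k V" and ?q = "dens d k W"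
  have "ennreal b \<le> (\<integral>\<^sup>+ \<omega>. ennreal (min (?p \<omega>) (?q \<omega>) * \<bar>ln (?p \<omega>) - ln (?q \<omega>)\<bar> ^ 1) \<partial>base d k)"
    using log_density_gap_integral[OF C k V W j(1), of 1] by (simp add: b_def y_def \<sigma>_def)
  also have "\<dots> \<le> (\<integral>\<^sup>+ \<omega>. ennreal \<bar>?p \<omega> - ?q \<omega>\<bar> \<partial>base d k)"
    using abs_diff_ge_min_ln[OF dens_pos[OF k] dens_pos[OF k]] by (intro nn_integral_mono ennreal_leI) simp
  also have "\<dots> = ennreal (\<integral>\<omega>. \<bar>?p \<omega> - ?q \<omega>\<bar> \<partial>base d k)"
    by (rule nn_integral_eq_integral) (intro integrable_abs Bochner_Integration.integrable_diff integrable_dens[OF k], simp)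
  finally have "b \<le> (\<integral>\<omega>. \<bar>?p \<omega> - ?q \<omega>\<bar> \<partial>base d k)"
    by (simp add: ennreal_le_iff)
  then have "b / 2 \<le> dTV (auction_model d k V) (auction_model d k W)"
    using integral_abs_dens_diff_le_dTV[OF k, of d V W] by simp
  moreover have "exp (- 30 * y) * (sqrt (real k) * \<sigma>) \<le> b / 2"
  proof -
    have "sqrt (real k) \<le> real k" using k by (intro real_le_lsqrt) (auto simp: power2_eq_square)
    also have "\<dots> = exp (ln (real k))" using k by simp
    also have "\<dots> \<le> exp y"
    proof -
      have "ln (real k) \<le> y / 32 - 1" using y(1) by (simp add: field_simps)
      then have "ln (real k) \<le> y" using y(2) by linarith
      then show ?thesis by simp
    qed
    finally have 1: "sqrt (real k) \<le> exp y" .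
    have 2: "y \<le> exp y" using exp_ge_add_one_self[of y] by linarith
    have 3: "1152 \<le> exp (6 * y)"
    proof -
      have "(1152::real) \<le> 1 + 6 * y + (6 * y)\<^sup>2 / 2"
      proof -
        have "32 * 32 \<le> y * y" using y by (intro mult_mono) auto
        then show ?thesis using y by (simp add: power2_eq_square)
      qed
      also have "\<dots> \<le> exp (6 * y)" using y by (intro exp_lower_Taylor_quadratic) simp
      finally show ?thesis .
    qed
    have "sqrt (real k) * (1152 * y) \<le> exp y * (exp (6 * y) * exp y)"
      using 1 2 3 y by (intro mult_mono) auto
    also have "\<dots> = exp (8 * y)" by (simp add: exp_add[symmetric])
    finally have "exp (- 30 * y) * (sqrt (real k) * (1152 * y)) \<le> exp (- 30 * y) * exp (8 * y)" by (intro mult_left_mono) auto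
    also have "\<dots> = exp (- 22 * y)" by (simp add: exp_add[symmetric])
    finally have "exp (- 30 * y) * (sqrt (real k) * (1152 * y)) * \<sigma> \<le> exp (- 22 * y) * \<sigma>" using \<sigma> by (intro mult_right_mono)
    then show ?thesis using y by (simp add: b_def field_simps)
  qed
  moreover have "exp (- 30 * y) * frob d k (mdiff V W) \<le> exp (- 30 * y) * (sqrt (real k) * \<sigma>)"
    using j(2) by (intro mult_left_mono) (auto simp: \<sigma>_def)
  ultimately show ?thesis unfolding y_def by linarith
qed

lemma information_preservation:
  assumes c: "0 < c" "c \<le> 1" and C: "1 \<le> C" and k: "2 \<le> k" and sep: "sep_bounded d k c C Wstar"
    and V: "frob d k (mdiff V Wstar) \<le> ln 2 / ln (real k)" and W: "frob d k (mdiff W Wstar) \<le> ln 2 / ln (real k)"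
  shows "(c / (exp 1 * real k)) powr (960 * C\<^sup>2 / c\<^sup>2) * frob d k (mdiff V W) \<le> dTV (auction_model d k V) (auction_model d k W)"
proof -
  have "ln 2 / ln (real k) \<le> 1" using k by (simp add: field_simps)
  then have V1: "frob d k (mdiff V Wstar) \<le> 1" and W1: "frob d k (mdiff W Wstar) \<le> 1" using V W by linarith+
  have col: "sqrt (colnorm2 d Wstar l) \<le> C" if "l < k" for l using sep that by (simp add: sep_bounded_def)
  have base: "exp (- 30 * (rad C k)\<^sup>2) * frob d k (mdiff V W) \<le> dTV (auction_model d k V) (auction_model d k W)"
    by (rule dTV_lower_bound[OF C k]) (auto intro: colnorm_triangle[OF V1 col C] colnorm_triangle[OF W1 col C])
  have "(c / (exp 1 * real k)) powr (960 * C\<^sup>2 / c\<^sup>2) \<le> exp (- 30 * (rad C k)\<^sup>2)"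
  proof -
    define u where "u = 1 + ln (real k)"
    have u: "0 \<le> u" using k by (simp add: u_def)
    have "ln (c / (exp 1 * real k)) = ln c - u" using c k by (simp add: u_def ln_div ln_mult)
    also have "\<dots> \<le> - u" using c by simp
    finally have l: "ln (c / (exp 1 * real k)) \<le> - u" .
    have "c\<^sup>2 \<le> 1" using c by (simp add: power_le_one)
    then have "960 * C\<^sup>2 * c\<^sup>2 \<le> 960 * C\<^sup>2 * 1" by (intro mult_left_mono) auto
    then have e: "960 * C\<^sup>2 \<le> 960 * C\<^sup>2 / c\<^sup>2" using c by (simp add: pos_le_divide_eq)
    have "960 * C\<^sup>2 / c\<^sup>2 * ln (c / (exp 1 * real k)) \<le> 960 * C\<^sup>2 / c\<^sup>2 * (- u)" using l by (intro mult_left_mono) auto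
    also have "\<dots> \<le> 960 * C\<^sup>2 * (- u)" using e u by (intro mult_right_mono_neg) auto
    also have "\<dots> = - 30 * (rad C k)\<^sup>2" unfolding rad_sq[OF C k] u_def by (simp add: algebra_simps)
    finally have "exp (960 * C\<^sup>2 / c\<^sup>2 * ln (c / (exp 1 * real k))) \<le> exp (- 30 * (rad C k)\<^sup>2)" by (subst exp_le_cancel_iff)
    then show ?thesis using c k by (simp add: powr_def)
  qed
  then have "(c / (exp 1 * real k)) powr (960 * C\<^sup>2 / c\<^sup>2) * frob d k (mdiff V W) \<le> exp (- 30 * (rad C k)\<^sup>2) * frob d k (mdiff V W)"
    by (intro mult_right_mono) (auto simp: frob_def sum_nonneg)
  then show ?thesis using base by linarith
qed

section \<open>Derivatives of the negative log-likelihood\<close>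

definition nll_grad :: "nat \<Rightarrow> nat \<Rightarrow> real \<Rightarrow> (nat \<Rightarrow> real) \<Rightarrow> nat \<Rightarrow> real" where
  "nll_grad k i s \<mu> m = (if m = i then - rhaz (\<mu> i - s)
     else rhaz (s - \<mu> m) - rhaz (s - \<mu> m) * rg (s - \<mu> m) / hsum k i s \<mu>)"

text \<open>Chosen so that the derivative of \<open>rhaz * rg\<close> is \<open>- rhaz * rk\<close>.\<close>
definition rk :: "real \<Rightarrow> real" where "rk z = (rg z)\<^sup>2 - 1 + rhaz z * rg z"

definition nll_hess :: "nat \<Rightarrow> nat \<Rightarrow> real \<Rightarrow> (nat \<Rightarrow> real) \<Rightarrow> nat \<Rightarrow> nat \<Rightarrow> real" where
  "nll_hess k i s \<mu> m n =
     (if n = m then (if m = i then rhaz (\<mu> i - s) * rg (\<mu> i - s)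
        else rhaz (s - \<mu> m) * rg (s - \<mu> m) - rhaz (s - \<mu> m) * rk (s - \<mu> m) / hsum k i s \<mu>) else 0)
   + (if m = i \<or> n = i then 0
      else (rhaz (s - \<mu> m) * rg (s - \<mu> m)) * (rhaz (s - \<mu> n) * rg (s - \<mu> n)) / (hsum k i s \<mu>)\<^sup>2)"

lemma nll_eq:
  assumes "2 \<le> k"
  shows "nll k i s \<mu> = - (\<Sum>l<k. ln (side i s \<mu> l)) - ln (hsum k i s \<mu>)"
proof -
  have "0 < (\<Prod>l<k. side i s \<mu> l)" by (rule prod_pos) simp
  then have "ln (obs_dens k i s \<mu>) = ln (\<Prod>l<k. side i s \<mu> l) + ln (hsum k i s \<mu>)"
    unfolding obs_dens_eq using hsum_pos[OF assms, of i s \<mu>] by (intro ln_mult_pos)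
  also have "ln (\<Prod>l<k. side i s \<mu> l) = (\<Sum>l<k. ln (side i s \<mu> l))"
    by (rule ln_prod) (auto simp: less_imp_neq[OF side_pos(1), symmetric])
  finally show ?thesis by (simp add: nll_def)
qed

lemma has_real_derivative_line_minus: "((\<lambda>t. (\<mu>::nat \<Rightarrow> real) l + t * \<nu> l - s) has_real_derivative \<nu> l) (at t)"
  by (auto intro!: derivative_eq_intros)

lemma has_real_derivative_minus_line: "((\<lambda>t. s - ((\<mu>::nat \<Rightarrow> real) l + t * \<nu> l)) has_real_derivative - \<nu> l) (at t)"
  by (auto intro!: derivative_eq_intros)

lemma has_real_derivative_hsum:
  "((\<lambda>t. hsum k i s (\<lambda>l. \<mu> l + t * \<nu> l)) has_real_derivative
     (\<Sum>j\<in>{..<k}-{i}. \<nu> j * (rhaz (s - (\<mu> j + t * \<nu> j)) * rg (s - (\<mu> j + t * \<nu> j))))) (at t)"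
proof -
  have "((\<lambda>t. \<Sum>j\<in>{..<k}-{i}. rhaz (s - (\<mu> j + t * \<nu> j))) has_real_derivative
     (\<Sum>j\<in>{..<k}-{i}. - rhaz (s - (\<mu> j + t * \<nu> j)) * rg (s - (\<mu> j + t * \<nu> j)) * - \<nu> j)) (at t)"
    by (intro DERIV_sum has_real_derivative_rhaz has_real_derivative_minus_line)
  then show ?thesis unfolding hsum_def by (simp add: mult_ac)
qed

lemma has_real_derivative_nll:
  assumes k: "2 \<le> k" and i: "i < k"
  shows "((\<lambda>t. nll k i s (\<lambda>l. \<mu> l + t * \<nu> l)) has_real_derivative
     (\<Sum>m<k. \<nu> m * nll_grad k i s (\<lambda>l. \<mu> l + t * \<nu> l) m)) (at t)"
proof -
  let ?m = "\<lambda>t l. \<mu> l + t * \<nu> l"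
  let ?H = "hsum k i s (?m t)"
  let ?d = "\<lambda>l. (if l = i then rhaz (?m t i - s) else - rhaz (s - ?m t l)) * \<nu> l"
  let ?h = "\<Sum>j\<in>{..<k}-{i}. \<nu> j * (rhaz (s - ?m t j) * rg (s - ?m t j))"
  have H: "0 < ?H" by (rule hsum_pos[OF k])
  have side: "((\<lambda>t. ln (side i s (?m t) l)) has_real_derivative ?d l) (at t)" for l
  proof (cases "l = i")
    case True
    then show ?thesis using has_real_derivative_ln_ncdf[OF has_real_derivative_line_minus[of \<mu> i \<nu> s t]] by (simp add: side_def)
  next
    case False
    then show ?thesis using has_real_derivative_ln_ncdf[OF has_real_derivative_minus_line[of s \<mu> l \<nu> t]] by (simp add: side_def)
  qed
  have lnH: "((\<lambda>t. ln (hsum k i s (?m t))) has_real_derivative ?h / ?H) (at t)"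
    using DERIV_chain2[OF DERIV_ln_divide[OF H] has_real_derivative_hsum] by simp
  have "((\<lambda>t. - (\<Sum>l<k. ln (side i s (?m t) l)) - ln (hsum k i s (?m t))) has_real_derivative - (\<Sum>l<k. ?d l) - ?h / ?H) (at t)"
    by (intro DERIV_diff DERIV_minus DERIV_sum side lnH)
  moreover have "- (\<Sum>l<k. ?d l) - ?h / ?H = (\<Sum>m<k. \<nu> m * nll_grad k i s (?m t) m)"
  proof -
    have 1: "(\<Sum>m<k. \<nu> m * nll_grad k i s (?m t) m) = \<nu> i * nll_grad k i s (?m t) i + (\<Sum>m\<in>{..<k}-{i}. \<nu> m * nll_grad k i s (?m t) m)"
      using i by (intro sum.remove) auto
    have 2: "(\<Sum>l<k. ?d l) = ?d i + (\<Sum>m\<in>{..<k}-{i}. ?d m)"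
      using i by (intro sum.remove) auto
    have "(\<Sum>m\<in>{..<k}-{i}. \<nu> m * nll_grad k i s (?m t) m)
      = (\<Sum>m\<in>{..<k}-{i}. - ?d m - \<nu> m * (rhaz (s - ?m t m) * rg (s - ?m t m)) / ?H)"
      by (rule sum.cong) (simp_all add: nll_grad_def right_diff_distrib mult.commute)
    also have "\<dots> = - (\<Sum>m\<in>{..<k}-{i}. ?d m) - ?h / ?H"
      unfolding sum_subtractf sum_negf sum_divide_distrib ..
    finally have 3: "(\<Sum>m\<in>{..<k}-{i}. \<nu> m * nll_grad k i s (?m t) m) = - (\<Sum>m\<in>{..<k}-{i}. ?d m) - ?h / ?H" .
    have 4: "\<nu> i * nll_grad k i s (?m t) i = - ?d i" by (simp add: nll_grad_def)
    show ?thesis unfolding 1 2 3 4 by simp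
  qed
  ultimately show ?thesis by (simp add: nll_eq[OF k])
qed

lemma has_real_derivative_nll_grad:
  assumes k: "2 \<le> k" and i: "i < k" and m: "m < k"
  shows "((\<lambda>t. nll_grad k i s (\<lambda>l. \<mu> l + t * \<nu> l) m) has_real_derivative
     (\<Sum>n<k. \<nu> n * nll_hess k i s (\<lambda>l. \<mu> l + t * \<nu> l) m n)) (at t)"
proof (cases "m = i")
  case True
  have "((\<lambda>t. - rhaz (\<mu> i + t * \<nu> i - s)) has_real_derivative
     - (- rhaz (\<mu> i + t * \<nu> i - s) * rg (\<mu> i + t * \<nu> i - s) * \<nu> i)) (at t)"
    by (intro DERIV_minus has_real_derivative_rhaz has_real_derivative_line_minus)
  then have "((\<lambda>t. - rhaz (\<mu> i + t * \<nu> i - s)) has_real_derivative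
     \<nu> i * (rhaz (\<mu> i + t * \<nu> i - s) * rg (\<mu> i + t * \<nu> i - s))) (at t)"
    by (rule DERIV_cong) simp
  moreover have "(\<Sum>n<k. \<nu> n * nll_hess k i s (\<lambda>l. \<mu> l + t * \<nu> l) m n) =
     (\<Sum>n<k. if n = i then \<nu> i * (rhaz (\<mu> i + t * \<nu> i - s) * rg (\<mu> i + t * \<nu> i - s)) else 0)"
    using True by (intro sum.cong) (auto simp: nll_hess_def)
  ultimately show ?thesis using True i by (simp add: nll_grad_def)
next
  case False
  let ?m = "\<lambda>t l. \<mu> l + t * \<nu> l"
  let ?H = "hsum k i s (?m t)"
  let ?u = "s - ?m t m"
  let ?h = "\<Sum>j\<in>{..<k}-{i}. \<nu> j * (rhaz (s - ?m t j) * rg (s - ?m t j))"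
  have H: "?H \<noteq> 0" using hsum_pos[OF k, of i s "?m t"] by simp
  have a: "((\<lambda>t. rhaz (s - ?m t m)) has_real_derivative - rhaz ?u * rg ?u * - \<nu> m) (at t)"
    by (intro has_real_derivative_rhaz has_real_derivative_minus_line)
  have b: "((\<lambda>t. rg (s - ?m t m)) has_real_derivative (1 - rhaz ?u * rg ?u) * - \<nu> m) (at t)"
    by (intro has_real_derivative_rg has_real_derivative_minus_line)
  have ab: "((\<lambda>t. rhaz (s - ?m t m) * rg (s - ?m t m)) has_real_derivative \<nu> m * (rhaz ?u * rk ?u)) (at t)"
  proof -
    have "h * ((1 - h * g) * - v) + (- h * g * - v) * g = v * (h * (g\<^sup>2 - 1 + h * g))" for h g v :: real
      by (simp add: algebra_simps power2_eq_square)
    then show ?thesis using DERIV_mult'[OF a b] unfolding rk_def by (simp only:)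
  qed
  have "((\<lambda>t. rhaz (s - ?m t m) - rhaz (s - ?m t m) * rg (s - ?m t m) / hsum k i s (?m t)) has_real_derivative
     - rhaz ?u * rg ?u * - \<nu> m - (\<nu> m * (rhaz ?u * rk ?u) * ?H - rhaz ?u * rg ?u * ?h) / (?H * ?H)) (at t)"
    by (intro DERIV_diff a DERIV_divide ab has_real_derivative_hsum H)
  moreover have "(\<Sum>n<k. \<nu> n * nll_hess k i s (?m t) m n)
     = - rhaz ?u * rg ?u * - \<nu> m - (\<nu> m * (rhaz ?u * rk ?u) * ?H - rhaz ?u * rg ?u * ?h) / (?H * ?H)"
  proof -
    let ?p = "\<lambda>n. if n = i then 0 else \<nu> n * (rhaz (s - ?m t n) * rg (s - ?m t n))"
    have "(\<Sum>n<k. \<nu> n * nll_hess k i s (?m t) m n)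
      = (\<Sum>n<k. (if n = m then \<nu> m * (rhaz ?u * rg ?u - rhaz ?u * rk ?u / ?H) else 0) + (rhaz ?u * rg ?u) / (?H)\<^sup>2 * ?p n)"
      by (intro sum.cong refl) (use False in \<open>simp add: nll_hess_def distrib_left\<close>)
    also have "\<dots> = \<nu> m * (rhaz ?u * rg ?u - rhaz ?u * rk ?u / ?H) + (rhaz ?u * rg ?u) / (?H)\<^sup>2 * (\<Sum>n<k. ?p n)"
      using m unfolding sum.distrib sum_distrib_left[symmetric] by (simp only: sum.delta finite_lessThan lessThan_iff if_True)
    also have "(\<Sum>n<k. ?p n) = ?h"
      using i by (subst sum.remove[of _ i]) auto
    finally have eq: "(\<Sum>n<k. \<nu> n * nll_hess k i s (?m t) m n)
      = \<nu> m * (rhaz ?u * rg ?u - rhaz ?u * rk ?u / ?H) + (rhaz ?u * rg ?u) / (?H)\<^sup>2 * ?h" .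
    have alg: "v * (a * b - a * c / H) + a * b / H\<^sup>2 * S = - a * b * - v - (v * (a * c) * H - a * b * S) / (H * H)"
      if "H \<noteq> 0" for v a b c H S :: real
      using that by (simp add: field_simps power2_eq_square)
    show ?thesis unfolding eq by (rule alg[OF H])
  qed
  ultimately show ?thesis using False by (simp add: nll_grad_def)
qed

definition nll_scale :: "nat \<Rightarrow> real \<Rightarrow> (nat \<Rightarrow> real) \<Rightarrow> real" where
  "nll_scale k s \<mu> = 2 + \<bar>s\<bar> + (\<Sum>l<k. \<bar>\<mu> l\<bar>)"

lemma nll_scale_ge: "2 \<le> nll_scale k s \<mu>" "l < k \<Longrightarrow> 2 + \<bar>s - \<mu> l\<bar> \<le> nll_scale k s \<mu>"
proof -
  show "2 \<le> nll_scale k s \<mu>" by (simp add: nll_scale_def sum_nonneg)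
  assume "l < k"
  then have "\<bar>\<mu> l\<bar> \<le> (\<Sum>l<k. \<bar>\<mu> l\<bar>)" by (intro member_le_sum) auto
  then show "2 + \<bar>s - \<mu> l\<bar> \<le> nll_scale k s \<mu>" unfolding nll_scale_def by linarith
qed

lemma rhaz_rg_scale:
  assumes "l < k"
  shows "rhaz (s - \<mu> l) \<le> nll_scale k s \<mu>" "rg (s - \<mu> l) \<le> nll_scale k s \<mu>"
    "rhaz (\<mu> l - s) \<le> nll_scale k s \<mu>" "rg (\<mu> l - s) \<le> nll_scale k s \<mu>"
  using nll_scale_ge(2)[OF assms, of s \<mu>] rhaz_bound[of "s - \<mu> l"] rg_bound[of "s - \<mu> l"] rhaz_bound[of "\<mu> l - s"] rg_bound[of "\<mu> l - s"]
    abs_minus_commute[of s "\<mu> l"] by linarith+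

lemma rhaz_le_hsum:
  assumes "m < k" "m \<noteq> i"
  shows "rhaz (s - \<mu> m) / hsum k i s \<mu> \<le> 1"
proof -
  have "rhaz (s - \<mu> m) \<le> hsum k i s \<mu>"
    unfolding hsum_def using assms by (intro member_le_sum[of m "{..<k}-{i}" "\<lambda>m. rhaz (s - \<mu> m)"]) auto
  moreover from this have "0 < hsum k i s \<mu>" using rhaz_pos(1)[of "s - \<mu> m"] by linarith
  ultimately show ?thesis by (simp add: pos_divide_le_eq)
qed

lemma abs_nll_grad_le:
  assumes "2 \<le> k" "i < k" "m < k"
  shows "\<bar>nll_grad k i s \<mu> m\<bar> \<le> 2 * nll_scale k s \<mu>"
proof (cases "m = i")
  case True
  then show ?thesis using rhaz_rg_scale(3)[OF assms(2), of \<mu> s] rhaz_pos(2)[of "\<mu> i - s"] nll_scale_ge(1)[of k s \<mu>]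
    unfolding nll_grad_def by simp
next
  case False
  let ?u = "s - \<mu> m" let ?H = "hsum k i s \<mu>"
  have "rhaz ?u / ?H * rg ?u \<le> 1 * rg ?u" using rhaz_le_hsum[OF assms(3) False] by (intro mult_right_mono) auto
  moreover have "0 \<le> rhaz ?u / ?H * rg ?u" using hsum_pos[OF assms(1), of i s \<mu>] by (intro mult_nonneg_nonneg divide_nonneg_nonneg) auto
  moreover have "nll_grad k i s \<mu> m = rhaz ?u - rhaz ?u / ?H * rg ?u" using False by (simp add: nll_grad_def)
  ultimately show ?thesis
    using rhaz_rg_scale(1,2)[OF assms(3), of s \<mu>] rhaz_pos(2)[of ?u] nll_scale_ge(1)[of k s \<mu>] by linarith
qed

lemma abs_nll_hess_le:
  assumes k: "2 \<le> k" and i: "i < k" and m: "m < k" and n: "n < k"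
  shows "\<bar>nll_hess k i s \<mu> m n\<bar> \<le> 5 * (nll_scale k s \<mu>)\<^sup>2"
proof -
  define B where "B = nll_scale k s \<mu>"
  let ?H = "hsum k i s \<mu>"
  have B: "2 \<le> B" unfolding B_def by (rule nll_scale_ge)
  have B2: "1 \<le> B\<^sup>2" using B by simp
  have H: "0 < ?H" by (rule hsum_pos[OF k])
  have hg: "0 \<le> rhaz z * rg z" "rhaz z * rg z \<le> B\<^sup>2" if "rhaz z \<le> B" "rg z \<le> B" for z
  proof -
    show "0 \<le> rhaz z * rg z" by simp
    show "rhaz z * rg z \<le> B\<^sup>2" unfolding power2_eq_square using that B by (intro mult_mono) simp_all
  qed
  have ratio: "0 \<le> rhaz (s - \<mu> l) / ?H * rg (s - \<mu> l)" "rhaz (s - \<mu> l) / ?H * rg (s - \<mu> l) \<le> B" if "l < k" "l \<noteq> i" for l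
  proof -
    show "0 \<le> rhaz (s - \<mu> l) / ?H * rg (s - \<mu> l)" using H by (intro mult_nonneg_nonneg divide_nonneg_nonneg) auto
    have "rhaz (s - \<mu> l) / ?H * rg (s - \<mu> l) \<le> 1 * B"
      by (rule mult_mono[OF rhaz_le_hsum[OF that]]) (simp_all add: B_def rhaz_rg_scale(2)[OF that(1)])
    then show "rhaz (s - \<mu> l) / ?H * rg (s - \<mu> l) \<le> B" by simp
  qed
  have diag: "\<bar>if n = m then (if m = i then rhaz (\<mu> i - s) * rg (\<mu> i - s)
        else rhaz (s - \<mu> m) * rg (s - \<mu> m) - rhaz (s - \<mu> m) * rk (s - \<mu> m) / ?H) else 0\<bar> \<le> 4 * B\<^sup>2"
  proof (cases "n = m")
    case nm: True
    show ?thesis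
    proof (cases "m = i")
      case True
      have u: "rhaz (\<mu> i - s) \<le> B" "rg (\<mu> i - s) \<le> B" unfolding B_def by (rule rhaz_rg_scale[OF i])+
      have "\<bar>rhaz (\<mu> i - s) * rg (\<mu> i - s)\<bar> \<le> 4 * B\<^sup>2" using hg[OF u] B2 by linarith
      then show ?thesis using nm True by (simp only: if_True simp_thms)
    next
      case False
      let ?u = "s - \<mu> m"
      have u: "rhaz ?u \<le> B" "rg ?u \<le> B" unfolding B_def by (rule rhaz_rg_scale[OF m])+
      have "(rg ?u)\<^sup>2 \<le> B\<^sup>2" using u by (intro power_mono) auto
      then have rk: "\<bar>rk ?u\<bar> \<le> 3 * B\<^sup>2" using hg[OF u] B2 zero_le_power2[of "rg ?u"] unfolding rk_def by linarith
      have r01: "0 \<le> rhaz ?u / ?H" "rhaz ?u / ?H \<le> 1" by (simp add: less_imp_le[OF H], rule rhaz_le_hsum[OF m False])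
      have "\<bar>rhaz ?u / ?H * rk ?u\<bar> \<le> 1 * (3 * B\<^sup>2)"
        unfolding abs_mult by (rule mult_mono) (use r01 rk in simp_all)
      then have "\<bar>rhaz ?u * rg ?u - rhaz ?u / ?H * rk ?u\<bar> \<le> 4 * B\<^sup>2" using hg[OF u] by linarith
      moreover have "rhaz ?u * rk ?u / ?H = rhaz ?u / ?H * rk ?u" by simp
      ultimately show ?thesis using nm False by (simp only: if_True if_False simp_thms)
    qed
  qed (use B2 in simp)
  have off: "\<bar>if m = i \<or> n = i then 0
      else (rhaz (s - \<mu> m) * rg (s - \<mu> m)) * (rhaz (s - \<mu> n) * rg (s - \<mu> n)) / ?H\<^sup>2\<bar> \<le> B\<^sup>2"
  proof (cases "m = i \<or> n = i")
    case False
    have "(rhaz (s - \<mu> m) * rg (s - \<mu> m)) * (rhaz (s - \<mu> n) * rg (s - \<mu> n)) / ?H\<^sup>2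
      = (rhaz (s - \<mu> m) / ?H * rg (s - \<mu> m)) * (rhaz (s - \<mu> n) / ?H * rg (s - \<mu> n))"
      by (simp add: power2_eq_square)
    moreover have "(rhaz (s - \<mu> m) / ?H * rg (s - \<mu> m)) * (rhaz (s - \<mu> n) / ?H * rg (s - \<mu> n)) \<le> B * B"
      using ratio[OF m] ratio[OF n] False B by (intro mult_mono) simp_all
    moreover have "0 \<le> (rhaz (s - \<mu> m) / ?H * rg (s - \<mu> m)) * (rhaz (s - \<mu> n) / ?H * rg (s - \<mu> n))"
      by (intro mult_nonneg_nonneg divide_nonneg_nonneg) (use H in simp_all)
    ultimately have "\<bar>(rhaz (s - \<mu> m) * rg (s - \<mu> m)) * (rhaz (s - \<mu> n) * rg (s - \<mu> n)) / ?H\<^sup>2\<bar> \<le> B\<^sup>2"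
      by (simp only: power2_eq_square abs_of_nonneg)
    then show ?thesis using False by (simp only: if_False)
  qed simp
  have "\<bar>nll_hess k i s \<mu> m n\<bar> \<le> 4 * B\<^sup>2 + B\<^sup>2"
    unfolding nll_hess_def by (rule order.trans[OF abs_triangle_ineq add_mono[OF diag off]])
  then show ?thesis by (simp add: B_def)
qed

lemma nll_lipschitz:
  assumes k: "2 \<le> k" and i: "i < k"
  shows "\<bar>nll k i s \<mu>' - nll k i s \<mu>\<bar> \<le> 2 * (nll_scale k s \<mu> + nll_scale k s \<mu>') * (\<Sum>l<k. \<bar>\<mu>' l - \<mu> l\<bar>)"
proof -
  define \<nu> where "\<nu> = (\<lambda>l. \<mu>' l - \<mu> l)"
  let ?m = "\<lambda>t l. \<mu> l + t * \<nu> l"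
  have "\<exists>z. 0 < z \<and> z < 1 \<and> nll k i s (?m 1) - nll k i s (?m 0) = (1 - 0) * (\<Sum>m<k. \<nu> m * nll_grad k i s (?m z) m)"
    by (rule MVT2[of 0 1 "\<lambda>t. nll k i s (?m t)" "\<lambda>t. \<Sum>m<k. \<nu> m * nll_grad k i s (?m t) m"])
       (simp, rule has_real_derivative_nll[OF k i])
  then obtain z where z: "0 < z" "z < 1"
    and eq: "nll k i s (?m 1) - nll k i s (?m 0) = (\<Sum>m<k. \<nu> m * nll_grad k i s (?m z) m)" by auto
  have sc: "nll_scale k s (?m z) \<le> nll_scale k s \<mu> + nll_scale k s \<mu>'"
  proof -
    have "\<bar>?m z l\<bar> \<le> \<bar>\<mu> l\<bar> + \<bar>\<mu>' l\<bar>" for l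
    proof -
      have "?m z l = (1 - z) * \<mu> l + z * \<mu>' l" by (simp add: \<nu>_def algebra_simps)
      then have "\<bar>?m z l\<bar> \<le> \<bar>(1 - z) * \<mu> l\<bar> + \<bar>z * \<mu>' l\<bar>" by (simp only: abs_triangle_ineq)
      also have "\<dots> = (1 - z) * \<bar>\<mu> l\<bar> + z * \<bar>\<mu>' l\<bar>" using z by (simp add: abs_mult)
      also have "\<dots> \<le> 1 * \<bar>\<mu> l\<bar> + 1 * \<bar>\<mu>' l\<bar>" using z by (intro add_mono mult_right_mono) auto
      finally show ?thesis by simp
    qed
    then have "(\<Sum>l<k. \<bar>?m z l\<bar>) \<le> (\<Sum>l<k. \<bar>\<mu> l\<bar>) + (\<Sum>l<k. \<bar>\<mu>' l\<bar>)"
      unfolding sum.distrib[symmetric] by (intro sum_mono)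
    then show ?thesis unfolding nll_scale_def by linarith
  qed
  have "\<bar>\<Sum>m<k. \<nu> m * nll_grad k i s (?m z) m\<bar> \<le> (\<Sum>m<k. \<bar>\<nu> m * nll_grad k i s (?m z) m\<bar>)" by (rule sum_abs)
  also have "\<dots> \<le> (\<Sum>m<k. 2 * (nll_scale k s \<mu> + nll_scale k s \<mu>') * \<bar>\<nu> m\<bar>)"
  proof (rule sum_mono)
    fix m assume "m \<in> {..<k}"
    then have "\<bar>nll_grad k i s (?m z) m\<bar> \<le> 2 * (nll_scale k s \<mu> + nll_scale k s \<mu>')"
      using abs_nll_grad_le[OF k i, of m s "?m z"] sc by simp
    then show "\<bar>\<nu> m * nll_grad k i s (?m z) m\<bar> \<le> 2 * (nll_scale k s \<mu> + nll_scale k s \<mu>') * \<bar>\<nu> m\<bar>"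
      unfolding abs_mult mult.commute[of "\<bar>\<nu> m\<bar>"] by (intro mult_right_mono) simp_all
  qed
  also have "\<dots> = 2 * (nll_scale k s \<mu> + nll_scale k s \<mu>') * (\<Sum>l<k. \<bar>\<nu> l\<bar>)" by (rule sum_distrib_left[symmetric])
  finally have "\<bar>nll k i s (?m 1) - nll k i s (?m 0)\<bar> \<le> 2 * (nll_scale k s \<mu> + nll_scale k s \<mu>') * (\<Sum>l<k. \<bar>\<nu> l\<bar>)"
    unfolding eq .
  moreover have "?m 1 = \<mu>'" "?m 0 = \<mu>" by (auto simp: \<nu>_def)
  ultimately show ?thesis by (simp add: \<nu>_def)
qed

text \<open>Together with the Lipschitz bound this controls the growth of the negative log-likelihood.\<close>

lemma nll_diag: "2 \<le> k \<Longrightarrow> i < k \<Longrightarrow> nll k i s (\<lambda>_. s) = nll k 0 0 (\<lambda>_. 0)"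
proof -
  assume k: "2 \<le> k" and i: "i < k"
  have h: "hsum k i' s' (\<lambda>_. s') = real (k - 1) * rhaz 0" if "i' < k" for i' s'
    using that by (simp add: hsum_def)
  have sd: "side i' s' (\<lambda>_. s') l = ncdf 0" for i' s' l by (simp add: side_def)
  have "0 < k" using k by simp
  then show ?thesis unfolding nll_eq[OF k] sd h[OF i] h[OF \<open>0 < k\<close>] by simp
qed

lemma has_real_derivative_integral:
  fixes f f' :: "real \<Rightarrow> 'a \<Rightarrow> real"
  assumes int: "\<And>t. \<bar>t\<bar> < 1 \<Longrightarrow> integrable M (f t)"
    and deriv: "\<And>t \<omega>. \<bar>t\<bar> < 1 \<Longrightarrow> \<omega> \<in> space M \<Longrightarrow> ((\<lambda>t. f t \<omega>) has_real_derivative f' t \<omega>) (at t)"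
    and bound: "\<And>t \<omega>. \<bar>t\<bar> < 1 \<Longrightarrow> \<omega> \<in> space M \<Longrightarrow> \<bar>f' t \<omega>\<bar> \<le> g \<omega>"
    and g: "integrable M g" and f'm: "f' 0 \<in> borel_measurable M"
  shows "((\<lambda>t. integral\<^sup>L M (f t)) has_real_derivative integral\<^sup>L M (f' 0)) (at 0)"
  unfolding DERIV_def tendsto_at_iff_sequentially
proof (intro allI impI)
  fix X :: "nat \<Rightarrow> real"
  assume X0: "\<forall>n. X n \<in> UNIV - {0}" and Xl: "X \<longlonglongrightarrow> 0"
  have ne: "X n \<noteq> 0" for n using X0 by auto
  have "eventually (\<lambda>n. dist (X n) 0 < 1) sequentially" by (rule tendstoD[OF Xl]) simp
  then obtain N where N: "\<And>n. N \<le> n \<Longrightarrow> \<bar>X n\<bar> < 1" by (auto simp: eventually_sequentially)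
  let ?Y = "\<lambda>n. X (n + N)"
  have Y: "\<bar>?Y n\<bar> < 1" for n by (rule N) simp
  have Yl: "?Y \<longlonglongrightarrow> 0" using Xl by (rule LIMSEQ_ignore_initial_segment)
  have i0: "integrable M (f 0)" by (rule int) simp
  have "(\<lambda>n. \<integral>\<omega>. (f (?Y n) \<omega> - f 0 \<omega>) / ?Y n \<partial>M) \<longlonglongrightarrow> integral\<^sup>L M (f' 0)"
  proof (rule integral_dominated_convergence[where w=g])
    show "f' 0 \<in> borel_measurable M" by (rule f'm)
    show "integrable M g" by (rule g)
    show "(\<lambda>\<omega>. (f (?Y n) \<omega> - f 0 \<omega>) / ?Y n) \<in> borel_measurable M" for n
      using borel_measurable_integrable[OF int[OF Y[of n]]] borel_measurable_integrable[OF i0]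
      by (intro borel_measurable_divide borel_measurable_diff) simp_all
    show "AE \<omega> in M. (\<lambda>n. (f (?Y n) \<omega> - f 0 \<omega>) / ?Y n) \<longlonglongrightarrow> f' 0 \<omega>"
    proof (rule AE_I2)
      fix \<omega> assume w: "\<omega> \<in> space M"
      have "((\<lambda>t. f t \<omega>) has_real_derivative f' 0 \<omega>) (at 0)" using w by (intro deriv) auto
      then have "((\<lambda>h. (f (0 + h) \<omega> - f 0 \<omega>) / h) \<longlongrightarrow> f' 0 \<omega>) (at 0)" unfolding DERIV_def .
      then have "((\<lambda>h. (f h \<omega> - f 0 \<omega>) / h) \<longlongrightarrow> f' 0 \<omega>) (at 0)" by simp
      then show "(\<lambda>n. (f (?Y n) \<omega> - f 0 \<omega>) / ?Y n) \<longlonglongrightarrow> f' 0 \<omega>"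
        using Yl ne unfolding tendsto_at_iff_sequentially by (auto simp: o_def)
    qed
    show "AE \<omega> in M. norm ((f (?Y n) \<omega> - f 0 \<omega>) / ?Y n) \<le> g \<omega>" for n
    proof (rule AE_I2)
      fix \<omega> assume w: "\<omega> \<in> space M"
      have "\<exists>z. \<bar>z\<bar> < 1 \<and> f (?Y n) \<omega> - f 0 \<omega> = ?Y n * f' z \<omega>"
      proof (cases "0 < ?Y n")
        case True
        have "\<exists>z. 0 < z \<and> z < ?Y n \<and> f (?Y n) \<omega> - f 0 \<omega> = (?Y n - 0) * f' z \<omega>"
          by (rule MVT2[OF True, of "\<lambda>t. f t \<omega>" "\<lambda>t. f' t \<omega>"], rule deriv) (use Y[of n] w in auto)
        then obtain z where "0 < z" "z < ?Y n" "f (?Y n) \<omega> - f 0 \<omega> = ?Y n * f' z \<omega>" by auto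
        then show ?thesis using Y[of n] by (intro exI[of _ z]) auto
      next
        case False
        then have neg: "?Y n < 0" using ne[of "n + N"] by simp
        have "\<exists>z. ?Y n < z \<and> z < 0 \<and> f 0 \<omega> - f (?Y n) \<omega> = (0 - ?Y n) * f' z \<omega>"
          by (rule MVT2[OF neg, of "\<lambda>t. f t \<omega>" "\<lambda>t. f' t \<omega>"], rule deriv) (use Y[of n] w in auto)
        then obtain z where "?Y n < z" "z < 0" "f 0 \<omega> - f (?Y n) \<omega> = - ?Y n * f' z \<omega>" by auto
        then show ?thesis using Y[of n] by (intro exI[of _ z]) auto
      qed
      then obtain z where z: "\<bar>z\<bar> < 1" "f (?Y n) \<omega> - f 0 \<omega> = ?Y n * f' z \<omega>" by blast
      then have "(f (?Y n) \<omega> - f 0 \<omega>) / ?Y n = f' z \<omega>" using ne[of "n + N"] by simp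
      then show "norm ((f (?Y n) \<omega> - f 0 \<omega>) / ?Y n) \<le> g \<omega>" using bound[OF z(1) w] by simp
    qed
  qed
  also have "(\<lambda>n. \<integral>\<omega>. (f (?Y n) \<omega> - f 0 \<omega>) / ?Y n \<partial>M) = (\<lambda>n. (integral\<^sup>L M (f (?Y n)) - integral\<^sup>L M (f 0)) / ?Y n)"
    using int[OF Y] i0 by simp
  finally have "(\<lambda>n. (integral\<^sup>L M (f (X (n + N))) - integral\<^sup>L M (f 0)) / X (n + N)) \<longlonglongrightarrow> integral\<^sup>L M (f' 0)" .
  then have "(\<lambda>n. (integral\<^sup>L M (f (X n)) - integral\<^sup>L M (f 0)) / X n) \<longlonglongrightarrow> integral\<^sup>L M (f' 0)"
    by (rule LIMSEQ_offset)
  then show "((\<lambda>h. (integral\<^sup>L M (f (0 + h)) - integral\<^sup>L M (f 0)) / h) \<circ> X) \<longlonglongrightarrow> integral\<^sup>L M (f' 0)"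
    by (simp add: o_def)
qed

lemma power6_sum_le:
  fixes a :: "'i \<Rightarrow> real"
  assumes "finite I"
  shows "(\<Sum>i\<in>I. \<bar>a i\<bar>) ^ 6 \<le> real (card I) ^ 6 * (\<Sum>i\<in>I. \<bar>a i\<bar> ^ 6)"
proof (cases "I = {}")
  case False
  have "Max ((\<lambda>i. \<bar>a i\<bar>) ` I) \<in> (\<lambda>i. \<bar>a i\<bar>) ` I" using assms False by (intro Max_in) auto
  then obtain j where j: "j \<in> I" "\<bar>a j\<bar> = Max ((\<lambda>i. \<bar>a i\<bar>) ` I)" by auto
  have "(\<Sum>i\<in>I. \<bar>a i\<bar>) \<le> real (card I) * \<bar>a j\<bar>"
    unfolding j(2) using assms by (intro sum_bounded_above Max_ge) auto
  then have "(\<Sum>i\<in>I. \<bar>a i\<bar>) ^ 6 \<le> (real (card I) * \<bar>a j\<bar>) ^ 6"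
    by (intro power_mono sum_nonneg) auto
  also have "\<dots> = real (card I) ^ 6 * \<bar>a j\<bar> ^ 6" by (rule power_mult_distrib)
  also have "\<dots> \<le> real (card I) ^ 6 * (\<Sum>i\<in>I. \<bar>a i\<bar> ^ 6)"
    using j(1) assms by (intro mult_left_mono member_le_sum) auto
  finally show ?thesis .
qed simp

lemma
  fixes f :: "(nat \<Rightarrow> real) \<Rightarrow> real"
  assumes f: "integrable (gauss d) f"
  shows integrable_noise_fst: "integrable (noise d k) (\<lambda>\<omega>. f (fst \<omega>))"
    and integral_noise_fst: "(\<integral>\<omega>. f (fst \<omega>) \<partial>noise d k) = integral\<^sup>L (gauss d) f"
proof -
  interpret K: prob_space "gauss k" by (rule prob_space_PiM_N01)
  have D: "distr (noise d k) (gauss d) fst = gauss d" by (rule K.distr_pair_fst)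
  show "integrable (noise d k) (\<lambda>\<omega>. f (fst \<omega>))"
    using integrable_distr[OF measurable_fst, of "gauss d" "gauss k" f] f unfolding D by simp
  show "(\<integral>\<omega>. f (fst \<omega>) \<partial>noise d k) = integral\<^sup>L (gauss d) f"
    using integral_distr[OF measurable_fst borel_measurable_integrable[OF f], of "gauss k"] unfolding D by simp
qed

lemma
  fixes f :: "(nat \<Rightarrow> real) \<Rightarrow> real"
  assumes f: "integrable (gauss k) f"
  shows integrable_noise_snd: "integrable (noise d k) (\<lambda>\<omega>. f (snd \<omega>))"
    and integral_noise_snd: "(\<integral>\<omega>. f (snd \<omega>) \<partial>noise d k) = integral\<^sup>L (gauss k) f"
proof -
  interpret D: prob_space "gauss d" by (rule prob_space_PiM_N01)
  interpret K: prob_space "gauss k" by (rule prob_space_PiM_N01)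
  interpret P: pair_sigma_finite "gauss k" "gauss d"
    by (intro pair_sigma_finite.intro D.sigma_finite_measure_axioms K.sigma_finite_measure_axioms)
  have 1: "integrable (gauss k \<Otimes>\<^sub>M gauss d) (\<lambda>\<omega>. f (fst \<omega>))"
    by (rule integrable_noise_fst[OF f])
  show "integrable (noise d k) (\<lambda>\<omega>. f (snd \<omega>))"
    using P.integrable_product_swap[OF 1] by (simp add: case_prod_beta')
  show "(\<integral>\<omega>. f (snd \<omega>) \<partial>noise d k) = integral\<^sup>L (gauss k) f"
    using P.integral_product_swap[OF borel_measurable_integrable[OF 1]] integral_noise_fst[OF f, of d] by (simp add: case_prod_beta')
qed

lemma moment6_WTx:
  shows "integrable (noise d k) (\<lambda>\<omega>. \<bar>WTx d U (fst \<omega>) m\<bar> ^ 6)"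
    and "(\<integral>\<omega>. \<bar>WTx d U (fst \<omega>) m\<bar> ^ 6 \<partial>noise d k) = 15 * sqrt (colnorm2 d U m) ^ 6"
proof -
  have i: "integrable (gauss d) (\<lambda>x. \<bar>WTx d U x m\<bar> ^ 6)"
    unfolding WTx_def by (rule gauss_lin_moment6)
  show "integrable (noise d k) (\<lambda>\<omega>. \<bar>WTx d U (fst \<omega>) m\<bar> ^ 6)" by (rule integrable_noise_fst[OF i])
  show "(\<integral>\<omega>. \<bar>WTx d U (fst \<omega>) m\<bar> ^ 6 \<partial>noise d k) = 15 * sqrt (colnorm2 d U m) ^ 6"
    unfolding integral_noise_fst[OF i] unfolding WTx_def colnorm2_def by (rule gauss_lin_moment6)
qed

lemma moment6_component:
  fixes a d :: nat
  assumes "a < d"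
  shows "integrable (gauss d) (\<lambda>x. \<bar>x a\<bar> ^ 6)" "(\<integral>x. \<bar>x a\<bar> ^ 6 \<partial>gauss d) = 15"
proof -
  let ?c = "\<lambda>l. if l = a then 1 else 0 :: real"
  have 1: "(\<Sum>l<d. ?c l * x l) = x a" for x :: "nat \<Rightarrow> real"
  proof -
    have "(\<Sum>l<d. ?c l * x l) = (\<Sum>l<d. if l = a then x a else 0)" by (rule sum.cong) auto
    then show ?thesis using assms by simp
  qed
  have 2: "(\<Sum>l<d. (?c l)\<^sup>2) = 1"
  proof -
    have "(\<Sum>l<d. (?c l)\<^sup>2) = (\<Sum>l<d. if l = a then 1 else 0)" by (rule sum.cong) auto
    then show ?thesis using assms by simp
  qed
  show "integrable (gauss d) (\<lambda>x. \<bar>x a\<bar> ^ 6)" "(\<integral>x. \<bar>x a\<bar> ^ 6 \<partial>gauss d) = 15"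
    using gauss_lin_moment6[of d ?c] unfolding 1 2 by simp_all
qed

definition growth :: "nat \<Rightarrow> (nat \<Rightarrow> real) \<times> nat \<times> real \<Rightarrow> real" where
  "growth d = (\<lambda>(x, i, s). 1 + (\<Sum>a<d. \<bar>x a\<bar>) + \<bar>s\<bar>)"

definition entry_sum :: "nat \<Rightarrow> nat \<Rightarrow> (nat \<Rightarrow> nat \<Rightarrow> real) \<Rightarrow> real" where
  "entry_sum d k W = (\<Sum>m<k. \<Sum>a<d. \<bar>W a m\<bar>)"

lemma entry_sum_nonneg: "0 \<le> entry_sum d k W"
  by (simp add: entry_sum_def sum_nonneg)

lemma sum_abs_WTx_le: "(\<Sum>m<k. \<bar>WTx d W x m\<bar>) \<le> entry_sum d k W * (\<Sum>a<d. \<bar>x a\<bar>)"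
proof -
  have "\<bar>WTx d W x m\<bar> \<le> (\<Sum>a<d. \<bar>W a m\<bar>) * (\<Sum>a<d. \<bar>x a\<bar>)" for m
  proof -
    have "\<bar>WTx d W x m\<bar> \<le> (\<Sum>a<d. \<bar>W a m * x a\<bar>)" unfolding WTx_def by (rule sum_abs)
    also have "\<dots> \<le> (\<Sum>a<d. \<bar>W a m\<bar> * (\<Sum>a<d. \<bar>x a\<bar>))"
      unfolding abs_mult by (intro sum_mono mult_left_mono member_le_sum) auto
    also have "\<dots> = (\<Sum>a<d. \<bar>W a m\<bar>) * (\<Sum>a<d. \<bar>x a\<bar>)" by (rule sum_distrib_right[symmetric])
    finally show ?thesis .
  qed
  then show ?thesis unfolding entry_sum_def sum_distrib_right by (intro sum_mono) (simp add: sum_distrib_right[symmetric])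
qed

lemma growth_ge_1: "1 \<le> growth d \<omega>"
  by (auto simp: growth_def sum_nonneg split: prod.split)

lemma measurable_growth [measurable]: "growth d \<in> borel_measurable (obs_space d k)"
proof (rule borel_measurable_obsI)
  fix i
  have c: "(\<lambda>\<omega>. fst \<omega> a) \<in> borel_measurable (PiM {..<d} (\<lambda>_. borel :: real measure) \<Otimes>\<^sub>M (borel :: real measure))" if "a < d" for a
    using that by (intro measurable_compose[OF measurable_fst measurable_component_singleton]) simp
  show "(\<lambda>(x, s). growth d (x, i, s)) \<in> borel_measurable (PiM {..<d} (\<lambda>_. borel) \<Otimes>\<^sub>M borel)"
    unfolding growth_def split_beta' fst_conv snd_conv
    by (intro borel_measurable_add borel_measurable_sum borel_measurable_abs borel_measurable_const c measurable_snd) simp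
qed

lemma integrable_growth:
  assumes k: "2 \<le> k"
  shows "integrable (auction_model d k W) (\<lambda>\<omega>. growth d \<omega> ^ 6)"
proof -
  define E where "E = entry_sum d k W"
  have E: "0 \<le> E" by (simp add: E_def entry_sum_nonneg)
  let ?G = "\<lambda>\<omega>. (2 + E) ^ 6 * (3 ^ 6 * (1 + (real d ^ 6 * (\<Sum>a<d. \<bar>fst \<omega> a\<bar> ^ 6)) + (real k ^ 6 * (\<Sum>l<k. \<bar>snd \<omega> l\<bar> ^ 6))))"
  have "integrable (noise d k) (\<lambda>\<omega>. growth d (model_map d k W \<omega>) ^ 6)"
  proof (rule Bochner_Integration.integrable_bound)
    interpret D: prob_space "gauss d" by (rule prob_space_PiM_N01)
    interpret K: prob_space "gauss k" by (rule prob_space_PiM_N01)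
    interpret P: pair_prob_space "gauss d" "gauss k" ..
    show "integrable (noise d k) ?G"
      by (intro integrable_mult_right Bochner_Integration.integrable_add Bochner_Integration.integrable_sum P.integrable_const
          integrable_noise_fst[of d "\<lambda>x. \<bar>x _\<bar> ^ 6"] integrable_noise_snd[of k "\<lambda>x. \<bar>x _\<bar> ^ 6"] moment6_component) simp_all
    show "(\<lambda>\<omega>. growth d (model_map d k W \<omega>) ^ 6) \<in> borel_measurable (noise d k)"
      by (rule borel_measurable_power, rule measurable_compose[OF measurable_model_map[OF k] measurable_growth])
    show "AE \<omega> in noise d k. norm (growth d (model_map d k W \<omega>) ^ 6) \<le> norm (?G \<omega>)"
    proof (rule AE_I2)
      fix \<omega> :: "(nat \<Rightarrow> real) \<times> (nat \<Rightarrow> real)"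
      obtain x \<xi> where w: "\<omega> = (x, \<xi>)" by (cases \<omega>)
      define a where "a = (\<Sum>a<d. \<bar>x a\<bar>)"
      define b where "b = (\<Sum>l<k. \<bar>\<xi> l\<bar>)"
      have ab: "0 \<le> a" "0 \<le> b" by (auto simp: a_def b_def sum_nonneg)
      let ?y = "\<lambda>i. WTx d W x i + \<xi> i"
      have "\<bar>ysmax k ?y\<bar> \<le> (\<Sum>l<k. \<bar>?y l\<bar>)" by (rule abs_ysmax_le[OF k])
      also have "\<dots> \<le> (\<Sum>l<k. \<bar>WTx d W x l\<bar> + \<bar>\<xi> l\<bar>)" by (intro sum_mono abs_triangle_ineq)
      also have "\<dots> \<le> E * a + b" using sum_abs_WTx_le[of d W x k] by (simp add: sum.distrib E_def a_def b_def)
      finally have ys: "\<bar>ysmax k ?y\<bar> \<le> E * a + b" .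
      have "growth d (model_map d k W \<omega>) = 1 + a + \<bar>ysmax k ?y\<bar>" by (simp add: growth_def model_map_def w a_def)
      also have "\<dots> \<le> 1 + a + (E * a + b)" using ys by simp
      also have "\<dots> \<le> (2 + E) * (\<bar>1\<bar> + \<bar>a\<bar> + \<bar>b\<bar>)"
      proof -
        have "0 \<le> E * b" using E ab by simp
        then show ?thesis using ab E by (simp add: algebra_simps)
      qed
      finally have "growth d (model_map d k W \<omega>) ^ 6 \<le> ((2 + E) * (\<bar>1\<bar> + \<bar>a\<bar> + \<bar>b\<bar>)) ^ 6"
        using growth_ge_1[of d "model_map d k W \<omega>"] by (intro power_mono) simp_all
      also have "\<dots> = (2 + E) ^ 6 * (\<bar>1\<bar> + \<bar>a\<bar> + \<bar>b\<bar>) ^ 6" by (rule power_mult_distrib)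
      also have "\<dots> \<le> (2 + E) ^ 6 * (3 ^ 6 * (1 + a ^ 6 + b ^ 6))"
      proof (rule mult_left_mono)
        have "(\<Sum>i\<in>{0,1,2::nat}. \<bar>[1, a, b] ! i\<bar>) ^ 6 \<le> real (card {0,1,2::nat}) ^ 6 * (\<Sum>i\<in>{0,1,2::nat}. \<bar>[1, a, b] ! i\<bar> ^ 6)"
          by (rule power6_sum_le) simp
        then show "(\<bar>1\<bar> + \<bar>a\<bar> + \<bar>b\<bar>) ^ 6 \<le> 3 ^ 6 * (1 + a ^ 6 + b ^ 6)" using ab by (simp add: numeral_2_eq_2 add.assoc)
      qed (use E in simp)
      also have "\<dots> \<le> ?G \<omega>"
      proof (intro mult_left_mono add_mono order_refl)
        show "a ^ 6 \<le> real d ^ 6 * (\<Sum>a<d. \<bar>fst \<omega> a\<bar> ^ 6)" using power6_sum_le[of "{..<d}" x] by (simp add: a_def w)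
        show "b ^ 6 \<le> real k ^ 6 * (\<Sum>l<k. \<bar>snd \<omega> l\<bar> ^ 6)" using power6_sum_le[of "{..<k}" \<xi>] by (simp add: b_def w)
      qed (use E in simp_all)
      finally show "norm (growth d (model_map d k W \<omega>) ^ 6) \<le> norm (?G \<omega>)"
        using growth_ge_1[of d "model_map d k W \<omega>"] by simp
    qed
  qed
  then show ?thesis unfolding auction_model_eq
    by (subst integrable_distr_eq[OF measurable_model_map[OF k]]) (simp_all add: borel_measurable_power measurable_growth)
qed

section \<open>Differentiation of the population likelihood\<close>

lemma nll_scale_nonneg [simp]: "0 \<le> nll_scale k s \<mu>"
  using nll_scale_ge(1)[of k s \<mu>] by linarith

definition madd :: "(nat \<Rightarrow> nat \<Rightarrow> real) \<Rightarrow> real \<Rightarrow> (nat \<Rightarrow> nat \<Rightarrow> real) \<Rightarrow> nat \<Rightarrow> nat \<Rightarrow> real" where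
  "madd W t U = (\<lambda>l i. W l i + t * U l i)"

lemma WTx_madd: "WTx d (madd W t U) x = (\<lambda>l. WTx d W x l + t * WTx d U x l)"
  by (auto simp: WTx_def madd_def fun_eq_iff distrib_right sum.distrib sum_distrib_left mult.assoc)

lemma madd_0 [simp]: "madd W 0 U = W"
  by (simp add: madd_def)

definition grad_obs :: "nat \<Rightarrow> nat \<Rightarrow> (nat \<Rightarrow> nat \<Rightarrow> real) \<Rightarrow> (nat \<Rightarrow> nat \<Rightarrow> real) \<Rightarrow> (nat \<Rightarrow> real) \<times> nat \<times> real \<Rightarrow> real" where
  "grad_obs d k W U = (\<lambda>(x, i, s). \<Sum>m<k. WTx d U x m * nll_grad k i s (WTx d W x) m)"

definition hess_obs :: "nat \<Rightarrow> nat \<Rightarrow> (nat \<Rightarrow> nat \<Rightarrow> real) \<Rightarrow> (nat \<Rightarrow> nat \<Rightarrow> real) \<Rightarrow> (nat \<Rightarrow> nat \<Rightarrow> real) \<Rightarrow> (nat \<Rightarrow> real) \<times> nat \<times> real \<Rightarrow> real" where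
  "hess_obs d k W U V = (\<lambda>(x, i, s). \<Sum>m<k. WTx d U x m * (\<Sum>n<k. WTx d V x n * nll_hess k i s (WTx d W x) m n))"

lemma measurable_WTx_fst:
  "(\<lambda>\<omega>. WTx d W (fst \<omega>) m) \<in> borel_measurable (PiM {..<d} (\<lambda>_. borel :: real measure) \<Otimes>\<^sub>M (borel :: real measure))"
  by (rule measurable_compose[OF measurable_fst measurable_WTx(1)])

lemma measurable_mean_gap:
  "(\<lambda>\<omega>. snd \<omega> - WTx d W (fst \<omega>) m) \<in> borel_measurable (PiM {..<d} (\<lambda>_. borel :: real measure) \<Otimes>\<^sub>M (borel :: real measure))"
  "(\<lambda>\<omega>. WTx d W (fst \<omega>) m - snd \<omega>) \<in> borel_measurable (PiM {..<d} (\<lambda>_. borel :: real measure) \<Otimes>\<^sub>M (borel :: real measure))"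
  by (intro borel_measurable_diff measurable_WTx_fst measurable_snd)+

lemmas measurable_mean_gap_fun =
  measurable_compose[OF measurable_mean_gap(1) borel_measurable_rhaz] measurable_compose[OF measurable_mean_gap(2) borel_measurable_rhaz]
  measurable_compose[OF measurable_mean_gap(1) borel_measurable_rg] measurable_compose[OF measurable_mean_gap(2) borel_measurable_rg]

lemma measurable_hsum_obs:
  "(\<lambda>\<omega>. hsum k i (snd \<omega>) (WTx d W (fst \<omega>))) \<in> borel_measurable (PiM {..<d} (\<lambda>_. borel :: real measure) \<Otimes>\<^sub>M (borel :: real measure))"
  unfolding hsum_def by (intro borel_measurable_sum measurable_mean_gap_fun)

lemma measurable_grad_obs: "grad_obs d k W U \<in> borel_measurable (obs_space d k)"
proof (rule borel_measurable_obsI)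
  fix i
  have "(\<lambda>\<omega>. nll_grad k i (snd \<omega>) (WTx d W (fst \<omega>)) m) \<in> borel_measurable (PiM {..<d} (\<lambda>_. borel :: real measure) \<Otimes>\<^sub>M (borel :: real measure))" for m
    unfolding nll_grad_def
    by (cases "m = i") (simp_all only: if_True if_False simp_thms, (intro borel_measurable_uminus borel_measurable_diff
        borel_measurable_divide borel_measurable_times measurable_mean_gap_fun measurable_hsum_obs)+)
  then show "(\<lambda>(x, s). grad_obs d k W U (x, i, s)) \<in> borel_measurable (PiM {..<d} (\<lambda>_. borel) \<Otimes>\<^sub>M borel)"
    unfolding grad_obs_def split_beta' fst_conv snd_conv
    by (intro borel_measurable_sum borel_measurable_times measurable_WTx_fst)
qed

lemma measurable_hess_obs: "hess_obs d k W U V \<in> borel_measurable (obs_space d k)"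
proof (rule borel_measurable_obsI)
  fix i
  let ?M = "PiM {..<d} (\<lambda>_. borel :: real measure) \<Otimes>\<^sub>M (borel :: real measure)"
  have rk: "(\<lambda>\<omega>. rk (snd \<omega> - WTx d W (fst \<omega>) m)) \<in> borel_measurable ?M" for m
    unfolding rk_def
    by (intro borel_measurable_add borel_measurable_diff borel_measurable_power borel_measurable_times borel_measurable_const measurable_mean_gap_fun)
  have "(\<lambda>\<omega>. nll_hess k i (snd \<omega>) (WTx d W (fst \<omega>)) m n) \<in> borel_measurable ?M" for m n
    unfolding nll_hess_def
  proof (rule borel_measurable_add)
    show "(\<lambda>\<omega>. if n = m then if m = i then rhaz (WTx d W (fst \<omega>) i - snd \<omega>) * rg (WTx d W (fst \<omega>) i - snd \<omega>)
        else rhaz (snd \<omega> - WTx d W (fst \<omega>) m) * rg (snd \<omega> - WTx d W (fst \<omega>) m) -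
             rhaz (snd \<omega> - WTx d W (fst \<omega>) m) * rk (snd \<omega> - WTx d W (fst \<omega>) m) / hsum k i (snd \<omega>) (WTx d W (fst \<omega>)) else 0) \<in> borel_measurable ?M"
      by (cases "n = m"; cases "m = i"; simp only: if_True if_False simp_thms;
          intro borel_measurable_const borel_measurable_diff borel_measurable_divide borel_measurable_times measurable_mean_gap_fun measurable_hsum_obs rk)
    show "(\<lambda>\<omega>. if m = i \<or> n = i then 0 else rhaz (snd \<omega> - WTx d W (fst \<omega>) m) * rg (snd \<omega> - WTx d W (fst \<omega>) m) *
         (rhaz (snd \<omega> - WTx d W (fst \<omega>) n) * rg (snd \<omega> - WTx d W (fst \<omega>) n)) / (hsum k i (snd \<omega>) (WTx d W (fst \<omega>)))\<^sup>2) \<in> borel_measurable ?M"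
      by (cases "m = i \<or> n = i"; simp only: if_True if_False;
          intro borel_measurable_const borel_measurable_divide borel_measurable_times borel_measurable_power measurable_mean_gap_fun measurable_hsum_obs)
  qed
  then show "(\<lambda>(x, s). hess_obs d k W U V (x, i, s)) \<in> borel_measurable (PiM {..<d} (\<lambda>_. borel) \<Otimes>\<^sub>M borel)"
    unfolding hess_obs_def split_beta' fst_conv snd_conv
    by (intro borel_measurable_sum borel_measurable_times measurable_WTx_fst)
qed

lemma sum_abs_WTx_growth: "(\<Sum>m<k. \<bar>WTx d W x m\<bar>) \<le> entry_sum d k W * growth d (x, i, s)"
proof -
  have "entry_sum d k W * (\<Sum>a<d. \<bar>x a\<bar>) \<le> entry_sum d k W * growth d (x, i, s)"
    by (intro mult_left_mono) (simp_all add: growth_def entry_sum_nonneg)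
  then show ?thesis using sum_abs_WTx_le[of d W x k] by linarith
qed

lemma nll_scale_growth:
  assumes t: "\<bar>t\<bar> \<le> 1"
  shows "nll_scale k s (WTx d (madd W t U) x) \<le> (2 + entry_sum d k W + entry_sum d k U) * growth d (x, i, s)"
proof -
  have "\<bar>WTx d (madd W t U) x l\<bar> \<le> \<bar>WTx d W x l\<bar> + \<bar>WTx d U x l\<bar>" for l
  proof -
    have "\<bar>t * WTx d U x l\<bar> \<le> 1 * \<bar>WTx d U x l\<bar>" unfolding abs_mult using t by (intro mult_right_mono) simp_all
    then show ?thesis unfolding WTx_madd by linarith
  qed
  then have "(\<Sum>l<k. \<bar>WTx d (madd W t U) x l\<bar>) \<le> (\<Sum>l<k. \<bar>WTx d W x l\<bar> + \<bar>WTx d U x l\<bar>)" by (intro sum_mono)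
  also have "\<dots> \<le> (entry_sum d k W + entry_sum d k U) * growth d (x, i, s)"
    unfolding sum.distrib distrib_right by (intro add_mono sum_abs_WTx_growth)
  finally have "(\<Sum>l<k. \<bar>WTx d (madd W t U) x l\<bar>) \<le> (entry_sum d k W + entry_sum d k U) * growth d (x, i, s)" .
  moreover have "2 + \<bar>s\<bar> \<le> 2 * growth d (x, i, s)" by (simp add: growth_def sum_nonneg)
  ultimately show ?thesis unfolding nll_scale_def by (simp add: distrib_right)
qed

lemma growth_power_le: "n \<le> 6 \<Longrightarrow> growth d \<omega> ^ n \<le> growth d \<omega> ^ 6"
  by (rule power_increasing[OF _ growth_ge_1])

lemma abs_grad_obs_le:
  assumes k: "2 \<le> k" and i: "i < k"
  shows "\<bar>grad_obs d k W U (x, i, s)\<bar> \<le> 2 * nll_scale k s (WTx d W x) * (\<Sum>m<k. \<bar>WTx d U x m\<bar>)"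
proof -
  have "\<bar>grad_obs d k W U (x, i, s)\<bar> \<le> (\<Sum>m<k. \<bar>WTx d U x m * nll_grad k i s (WTx d W x) m\<bar>)"
    unfolding grad_obs_def prod.case by (rule sum_abs)
  also have "\<dots> \<le> (\<Sum>m<k. 2 * nll_scale k s (WTx d W x) * \<bar>WTx d U x m\<bar>)"
  proof (rule sum_mono)
    fix m assume "m \<in> {..<k}"
    then have "\<bar>WTx d U x m\<bar> * \<bar>nll_grad k i s (WTx d W x) m\<bar> \<le> \<bar>WTx d U x m\<bar> * (2 * nll_scale k s (WTx d W x))"
      by (intro mult_left_mono abs_nll_grad_le[OF k i]) simp_all
    then show "\<bar>WTx d U x m * nll_grad k i s (WTx d W x) m\<bar> \<le> 2 * nll_scale k s (WTx d W x) * \<bar>WTx d U x m\<bar>"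
      by (simp add: abs_mult mult.commute)
  qed
  also have "\<dots> = 2 * nll_scale k s (WTx d W x) * (\<Sum>m<k. \<bar>WTx d U x m\<bar>)" by (rule sum_distrib_left[symmetric])
  finally show ?thesis .
qed

lemma abs_hess_obs_le:
  assumes k: "2 \<le> k" and i: "i < k"
  shows "\<bar>hess_obs d k W U V (x, i, s)\<bar> \<le> 5 * (nll_scale k s (WTx d W x))\<^sup>2 * ((\<Sum>m<k. \<bar>WTx d U x m\<bar>) * (\<Sum>m<k. \<bar>WTx d V x m\<bar>))"
proof -
  let ?B = "5 * (nll_scale k s (WTx d W x))\<^sup>2"
  have inner: "\<bar>\<Sum>n<k. WTx d V x n * nll_hess k i s (WTx d W x) m n\<bar> \<le> ?B * (\<Sum>n<k. \<bar>WTx d V x n\<bar>)" if "m < k" for m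
  proof -
    have "\<bar>\<Sum>n<k. WTx d V x n * nll_hess k i s (WTx d W x) m n\<bar> \<le> (\<Sum>n<k. \<bar>WTx d V x n * nll_hess k i s (WTx d W x) m n\<bar>)"
      by (rule sum_abs)
    also have "\<dots> \<le> (\<Sum>n<k. ?B * \<bar>WTx d V x n\<bar>)"
    proof (rule sum_mono)
      fix n assume "n \<in> {..<k}"
      then have "\<bar>WTx d V x n\<bar> * \<bar>nll_hess k i s (WTx d W x) m n\<bar> \<le> \<bar>WTx d V x n\<bar> * ?B"
        using that by (intro mult_left_mono abs_nll_hess_le[OF k i]) simp_all
      then show "\<bar>WTx d V x n * nll_hess k i s (WTx d W x) m n\<bar> \<le> ?B * \<bar>WTx d V x n\<bar>"
        by (simp only: abs_mult mult.commute[of _ "\<bar>WTx d V x n\<bar>"])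
    qed
    also have "\<dots> = ?B * (\<Sum>n<k. \<bar>WTx d V x n\<bar>)" by (rule sum_distrib_left[symmetric])
    finally show ?thesis .
  qed
  have "\<bar>hess_obs d k W U V (x, i, s)\<bar> \<le> (\<Sum>m<k. \<bar>WTx d U x m * (\<Sum>n<k. WTx d V x n * nll_hess k i s (WTx d W x) m n)\<bar>)"
    unfolding hess_obs_def prod.case by (rule sum_abs)
  also have "\<dots> \<le> (\<Sum>m<k. \<bar>WTx d U x m\<bar> * (?B * (\<Sum>n<k. \<bar>WTx d V x n\<bar>)))"
    unfolding abs_mult by (intro sum_mono mult_left_mono inner) simp_all
  also have "\<dots> = (\<Sum>m<k. \<bar>WTx d U x m\<bar>) * (?B * (\<Sum>n<k. \<bar>WTx d V x n\<bar>))" by (rule sum_distrib_right[symmetric])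
  also have "\<dots> = ?B * ((\<Sum>m<k. \<bar>WTx d U x m\<bar>) * (\<Sum>m<k. \<bar>WTx d V x m\<bar>))" by (simp only: mult_ac)
  finally show ?thesis .
qed

lemma grad_obs_growth:
  assumes k: "2 \<le> k"
  shows "\<exists>c. \<forall>t x i s. \<bar>t\<bar> \<le> 1 \<longrightarrow> i < k \<longrightarrow> \<bar>grad_obs d k (madd W t V) U (x, i, s)\<bar> \<le> c * growth d (x, i, s) ^ 6"
proof (intro exI allI impI)
  fix t x i s assume t: "\<bar>t::real\<bar> \<le> 1" and i: "i < k"
  let ?g = "growth d (x, i, s)"
  define B where "B = 2 + entry_sum d k W + entry_sum d k V"
  have B: "0 \<le> B" by (simp add: B_def entry_sum_nonneg)
  have g: "1 \<le> ?g" by (rule growth_ge_1)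
  have "\<bar>grad_obs d k (madd W t V) U (x, i, s)\<bar> \<le> 2 * nll_scale k s (WTx d (madd W t V) x) * (\<Sum>m<k. \<bar>WTx d U x m\<bar>)"
    by (rule abs_grad_obs_le[OF k i])
  also have "\<dots> \<le> 2 * (B * ?g) * (entry_sum d k U * ?g)"
    by (intro mult_mono sum_abs_WTx_growth nll_scale_growth[OF t, of k s d W V x i, folded B_def])
       (use B g in \<open>simp_all add: sum_nonneg\<close>)
  also have "\<dots> = (2 * B * entry_sum d k U) * ?g ^ 2" by (simp add: power2_eq_square)
  also have "\<dots> \<le> (2 * B * entry_sum d k U) * ?g ^ 6"
    using B by (intro mult_left_mono growth_power_le mult_nonneg_nonneg entry_sum_nonneg) simp_all
  finally show "\<bar>grad_obs d k (madd W t V) U (x, i, s)\<bar> \<le> (2 * (2 + entry_sum d k W + entry_sum d k V) * entry_sum d k U) * ?g ^ 6"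
    unfolding B_def .
qed

lemma hess_obs_growth:
  assumes k: "2 \<le> k"
  shows "\<exists>c. \<forall>t x i s. \<bar>t\<bar> \<le> 1 \<longrightarrow> i < k \<longrightarrow> \<bar>hess_obs d k (madd W t V) U V' (x, i, s)\<bar> \<le> c * growth d (x, i, s) ^ 6"
proof (intro exI allI impI)
  fix t x i s assume t: "\<bar>t::real\<bar> \<le> 1" and i: "i < k"
  let ?g = "growth d (x, i, s)"
  define B where "B = 2 + entry_sum d k W + entry_sum d k V"
  have B: "0 \<le> B" by (simp add: B_def entry_sum_nonneg)
  have g: "1 \<le> ?g" by (rule growth_ge_1)
  have "\<bar>hess_obs d k (madd W t V) U V' (x, i, s)\<bar>
    \<le> 5 * (nll_scale k s (WTx d (madd W t V) x))\<^sup>2 * ((\<Sum>m<k. \<bar>WTx d U x m\<bar>) * (\<Sum>m<k. \<bar>WTx d V' x m\<bar>))"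
    by (rule abs_hess_obs_le[OF k i])
  also have "\<dots> \<le> 5 * (B * ?g)\<^sup>2 * ((entry_sum d k U * ?g) * (entry_sum d k V' * ?g))"
    by (intro mult_mono power_mono sum_abs_WTx_growth nll_scale_growth[OF t, of k s d W V x i, folded B_def])
       (use B g in \<open>simp_all add: sum_nonneg entry_sum_nonneg\<close>)
  also have "\<dots> = (5 * B\<^sup>2 * entry_sum d k U * entry_sum d k V') * ?g ^ 4" by (simp add: power2_eq_square power4_eq_xxxx)
  also have "\<dots> \<le> (5 * B\<^sup>2 * entry_sum d k U * entry_sum d k V') * ?g ^ 6"
    by (intro mult_left_mono growth_power_le mult_nonneg_nonneg entry_sum_nonneg) simp_all
  finally show "\<bar>hess_obs d k (madd W t V) U V' (x, i, s)\<bar> \<le> (5 * (2 + entry_sum d k W + entry_sum d k V)\<^sup>2 * entry_sum d k U * entry_sum d k V') * ?g ^ 6"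
    unfolding B_def .
qed

lemma ln_dens_growth:
  assumes k: "2 \<le> k"
  shows "\<exists>c. \<forall>x i s. i < k \<longrightarrow> \<bar>ln (dens d k W (x, i, s))\<bar> \<le> c * growth d (x, i, s) ^ 6"
proof (intro exI allI impI)
  fix x i s assume i: "i < k"
  let ?g = "growth d (x, i, s)" and ?\<mu> = "WTx d W x"
  define B where "B = 2 + entry_sum d k W + entry_sum d k (\<lambda>_ _. 0)"
  define K where "K = \<bar>nll k 0 0 (\<lambda>_. 0)\<bar>"
  have B: "0 \<le> B" by (simp add: B_def entry_sum_nonneg)
  have g: "1 \<le> ?g" by (rule growth_ge_1)
  have sg: "\<bar>s\<bar> \<le> ?g" by (simp add: growth_def sum_nonneg)
  have sc: "nll_scale k s ?\<mu> \<le> B * ?g"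
    using nll_scale_growth[of 0 k s d W "\<lambda>_ _. 0" x i] by (simp add: B_def)
  have sc0: "nll_scale k s (\<lambda>_. s) \<le> (3 + real k) * ?g"
  proof -
    have "nll_scale k s (\<lambda>_. s) = 2 + (1 + real k) * \<bar>s\<bar>" by (simp add: nll_scale_def distrib_right)
    also have "\<dots> \<le> 2 * ?g + (1 + real k) * ?g" using g sg by (intro add_mono mult_left_mono) simp_all
    finally show ?thesis by (simp add: distrib_right)
  qed
  have df: "(\<Sum>l<k. \<bar>?\<mu> l - s\<bar>) \<le> (B + real k) * ?g"
  proof -
    have "(\<Sum>l<k. \<bar>?\<mu> l - s\<bar>) \<le> (\<Sum>l<k. \<bar>?\<mu> l\<bar> + \<bar>s\<bar>)" by (intro sum_mono abs_triangle_ineq4)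
    also have "\<dots> = (\<Sum>l<k. \<bar>?\<mu> l\<bar>) + real k * \<bar>s\<bar>" by (simp add: sum.distrib)
    also have "\<dots> \<le> B * ?g + real k * ?g"
      using sc sg unfolding nll_scale_def by (intro add_mono mult_left_mono) simp_all
    finally show ?thesis by (simp add: distrib_right)
  qed
  have "\<bar>nll k i s ?\<mu> - nll k i s (\<lambda>_. s)\<bar> \<le> 2 * (nll_scale k s (\<lambda>_. s) + nll_scale k s ?\<mu>) * (\<Sum>l<k. \<bar>?\<mu> l - s\<bar>)"
    by (rule nll_lipschitz[OF k i])
  also have "\<dots> \<le> 2 * ((3 + real k) * ?g + B * ?g) * ((B + real k) * ?g)"
    using B g by (intro mult_mono add_mono sc sc0 df) (simp_all add: sum_nonneg)
  also have "\<dots> = 2 * (3 + real k + B) * (B + real k) * ?g ^ 2" by (simp add: power2_eq_square algebra_simps)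
  also have "\<dots> \<le> 2 * (3 + real k + B) * (B + real k) * ?g ^ 6"
    using B by (intro mult_left_mono growth_power_le) simp_all
  finally have 1: "\<bar>nll k i s ?\<mu> - nll k i s (\<lambda>_. s)\<bar> \<le> 2 * (3 + real k + B) * (B + real k) * ?g ^ 6" .
  have "1 \<le> ?g ^ 6" using g by simp
  then have "K * 1 \<le> K * ?g ^ 6" by (intro mult_left_mono) (simp_all add: K_def)
  moreover have "\<bar>nll k i s (\<lambda>_. s)\<bar> = K" using nll_diag[OF k i, of s] by (simp add: K_def)
  moreover have "ln (dens d k W (x, i, s)) = - nll k i s ?\<mu>" by (simp add: dens_def nll_def)
  ultimately show "\<bar>ln (dens d k W (x, i, s))\<bar> \<le> (2 * (3 + real k + (2 + entry_sum d k W + entry_sum d k (\<lambda>_ _. 0))) * ((2 + entry_sum d k W + entry_sum d k (\<lambda>_ _. 0)) + real k) + \<bar>nll k 0 0 (\<lambda>_. 0)\<bar>) * ?g ^ 6"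
    using 1 unfolding B_def[symmetric] K_def[symmetric] distrib_right[of _ K] by linarith
qed

lemma integrable_growth_bound:
  fixes f :: "(nat \<Rightarrow> real) \<times> nat \<times> real \<Rightarrow> real"
  assumes k: "2 \<le> k" and m: "f \<in> borel_measurable (obs_space d k)"
    and b: "\<And>x i s. i < k \<Longrightarrow> \<bar>f (x, i, s)\<bar> \<le> c * growth d (x, i, s) ^ 6"
  shows "integrable (auction_model d k W) f"
proof (rule Bochner_Integration.integrable_bound)
  show "integrable (auction_model d k W) (\<lambda>\<omega>. c * growth d \<omega> ^ 6)"
    by (intro integrable_mult_right integrable_growth[OF k])
  show "f \<in> borel_measurable (auction_model d k W)"
    using m by (subst measurable_cong_sets[OF sets_auction_model refl])
  show "AE \<omega> in auction_model d k W. norm (f \<omega>) \<le> norm (c * growth d \<omega> ^ 6)"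
  proof (rule AE_I2)
    fix \<omega> assume "\<omega> \<in> space (auction_model d k W)"
    then have "\<omega> \<in> space (obs_space d k)" by (simp add: sets_eq_imp_space_eq[OF sets_auction_model])
    then obtain x i s where w: "\<omega> = (x, i, s)" "i < k" by (auto simp: space_obs_space)
    show "norm (f \<omega>) \<le> norm (c * growth d \<omega> ^ 6)" using b[OF w(2), of x s] unfolding w(1) by simp
  qed
qed

lemma integrable_grad_obs: "2 \<le> k \<Longrightarrow> integrable (auction_model d k Ws) (grad_obs d k W U)"
  using grad_obs_growth[of k d W U U] integrable_growth_bound[of k "grad_obs d k W U", OF _ measurable_grad_obs]
  by (metis abs_zero madd_0 zero_le_one)

lemma integrable_hess_obs: "2 \<le> k \<Longrightarrow> integrable (auction_model d k Ws) (hess_obs d k W U V)"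
  using hess_obs_growth[of k d W U U V] integrable_growth_bound[of k "hess_obs d k W U V", OF _ measurable_hess_obs]
  by (metis abs_zero madd_0 zero_le_one)

lemma measurable_ln_dens: "(\<lambda>\<omega>. ln (dens d k W \<omega>)) \<in> borel_measurable (obs_space d k)"
  by (intro borel_measurable_ln borel_measurable_dens)

lemma integrable_ln_dens: "2 \<le> k \<Longrightarrow> integrable (auction_model d k Ws) (\<lambda>\<omega>. ln (dens d k W \<omega>))"
  using ln_dens_growth[of k d W] integrable_growth_bound[of k "\<lambda>\<omega>. ln (dens d k W \<omega>)", OF _ measurable_ln_dens]
  by metis

lemma space_auction_model: "space (auction_model d k W) = space (obs_space d k)"
  by (rule sets_eq_imp_space_eq[OF sets_auction_model])

lemma popNLL_eq:
  assumes k: "2 \<le> k"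
  shows "popNLL d k Ws W = (\<integral>\<omega>. - ln (sqrt (2 * pi) ^ k) - ln (dens d k W \<omega>) \<partial>auction_model d k Ws)"
  unfolding popNLL_def
proof (rule Bochner_Integration.integral_cong[OF refl])
  fix \<omega> assume "\<omega> \<in> space (auction_model d k Ws)"
  then obtain x i s where w: "\<omega> = (x, i, s)" "i < k" by (auto simp: space_auction_model space_obs_space)
  have "0 < sqrt (2 * pi) ^ k" by simp
  then have "ln (sqrt (2 * pi) ^ k * obs_dens k i s (WTx d W x)) = ln (sqrt (2 * pi) ^ k) + ln (obs_dens k i s (WTx d W x))"
    by (rule ln_mult_pos[OF _ obs_dens_pos[OF k]])
  then show "(case \<omega> of (x, i, s) \<Rightarrow> - ln (surf_int k s i (\<lambda>z. exp (- (1/2) * (\<Sum>l<k. (z l - WTx d W x l)\<^sup>2)))))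
     = - ln (sqrt (2 * pi) ^ k) - ln (dens d k W \<omega>)"
    unfolding w(1) prod.case surf_int_eq[OF w(2)] dens_def by simp
qed

lemma has_real_derivative_popNLL:
  assumes k: "2 \<le> k"
  shows "((\<lambda>t. popNLL d k Ws (madd W t U)) has_real_derivative integral\<^sup>L (auction_model d k Ws) (grad_obs d k W U)) (at 0)"
proof -
  let ?M = "auction_model d k Ws"
  interpret prob_space ?M by (rule prob_space_auction_model[OF k])
  obtain c where c: "\<And>t x i s. \<bar>t\<bar> \<le> 1 \<Longrightarrow> i < k \<Longrightarrow> \<bar>grad_obs d k (madd W t U) U (x, i, s)\<bar> \<le> c * growth d (x, i, s) ^ 6"
    using grad_obs_growth[OF k, of d W U U] by blast
  have "((\<lambda>t. \<integral>\<omega>. - ln (sqrt (2 * pi) ^ k) - ln (dens d k (madd W t U) \<omega>) \<partial>?M) has_real_derivative integral\<^sup>L ?M (grad_obs d k (madd W 0 U) U)) (at 0)"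
  proof (rule has_real_derivative_integral[where g="\<lambda>\<omega>. c * growth d \<omega> ^ 6"])
    show "integrable ?M (\<lambda>\<omega>. - ln (sqrt (2 * pi) ^ k) - ln (dens d k (madd W t U) \<omega>))" for t
      by (intro Bochner_Integration.integrable_diff integrable_const integrable_ln_dens[OF k])
    show "integrable ?M (\<lambda>\<omega>. c * growth d \<omega> ^ 6)" by (intro integrable_mult_right integrable_growth[OF k])
    show "grad_obs d k (madd W 0 U) U \<in> borel_measurable ?M"
      using measurable_grad_obs by (subst measurable_cong_sets[OF sets_auction_model refl])
    fix t :: real and \<omega> assume t: "\<bar>t\<bar> < 1" and "\<omega> \<in> space ?M"
    then obtain x i s where w: "\<omega> = (x, i, s)" "i < k" by (auto simp: space_auction_model space_obs_space)
    show "\<bar>grad_obs d k (madd W t U) U \<omega>\<bar> \<le> c * growth d \<omega> ^ 6" unfolding w(1) using t w(2) by (intro c) simp_all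
    have "((\<lambda>t. - ln (sqrt (2 * pi) ^ k) + nll k i s (\<lambda>l. WTx d W x l + t * WTx d U x l)) has_real_derivative
       0 + (\<Sum>m<k. WTx d U x m * nll_grad k i s (\<lambda>l. WTx d W x l + t * WTx d U x l) m)) (at t)"
      by (intro DERIV_add DERIV_const has_real_derivative_nll[OF k w(2)])
    then show "((\<lambda>t. - ln (sqrt (2 * pi) ^ k) - ln (dens d k (madd W t U) \<omega>)) has_real_derivative grad_obs d k (madd W t U) U \<omega>) (at t)"
      unfolding w(1) dens_def grad_obs_def prod.case WTx_madd nll_def by simp
  qed
  then show ?thesis by (simp add: popNLL_eq[OF k])
qed

lemma has_real_derivative_integral_grad_obs:
  assumes k: "2 \<le> k"
  shows "((\<lambda>t. integral\<^sup>L (auction_model d k Ws) (grad_obs d k (madd W t V) U)) has_real_derivative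
    integral\<^sup>L (auction_model d k Ws) (hess_obs d k W U V)) (at 0)"
proof -
  let ?M = "auction_model d k Ws"
  obtain c where c: "\<And>t x i s. \<bar>t\<bar> \<le> 1 \<Longrightarrow> i < k \<Longrightarrow> \<bar>hess_obs d k (madd W t V) U V (x, i, s)\<bar> \<le> c * growth d (x, i, s) ^ 6"
    using hess_obs_growth[OF k, of d W V U V] by blast
  have "((\<lambda>t. integral\<^sup>L ?M (grad_obs d k (madd W t V) U)) has_real_derivative integral\<^sup>L ?M (hess_obs d k (madd W 0 V) U V)) (at 0)"
  proof (rule has_real_derivative_integral[where g="\<lambda>\<omega>. c * growth d \<omega> ^ 6"])
    show "integrable ?M (grad_obs d k (madd W t V) U)" for t by (rule integrable_grad_obs[OF k])
    show "integrable ?M (\<lambda>\<omega>. c * growth d \<omega> ^ 6)" by (intro integrable_mult_right integrable_growth[OF k])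
    show "hess_obs d k (madd W 0 V) U V \<in> borel_measurable ?M"
      using measurable_hess_obs by (subst measurable_cong_sets[OF sets_auction_model refl])
    fix t :: real and \<omega> assume t: "\<bar>t\<bar> < 1" and "\<omega> \<in> space ?M"
    then obtain x i s where w: "\<omega> = (x, i, s)" "i < k" by (auto simp: space_auction_model space_obs_space)
    show "\<bar>hess_obs d k (madd W t V) U V \<omega>\<bar> \<le> c * growth d \<omega> ^ 6" unfolding w(1) using t w(2) by (intro c) simp_all
    show "((\<lambda>t. grad_obs d k (madd W t V) U \<omega>) has_real_derivative hess_obs d k (madd W t V) U V \<omega>) (at t)"
      unfolding w(1) grad_obs_def hess_obs_def prod.case WTx_madd
      by (intro DERIV_sum DERIV_cmult has_real_derivative_nll_grad[OF k w(2)]) simp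
  qed
  then show ?thesis by simp
qed

definition munit :: "nat \<times> nat \<Rightarrow> nat \<Rightarrow> nat \<Rightarrow> real" where
  "munit p = (\<lambda>l i. if (l, i) = p then 1 else 0)"

lemma shift_eq_madd: "shift W p t = madd W t (munit p)"
  by (auto simp: shift_def madd_def munit_def fun_eq_iff)

lemma WTx_munit_sum:
  assumes "m < k"
  shows "(\<Sum>p\<in>{..<d} \<times> {..<k}. v p * WTx d (munit p) x m) = WTx d (\<lambda>l i. v (l, i)) x m"
proof -
  have "(\<Sum>p\<in>{..<d} \<times> {..<k}. v p * WTx d (munit p) x m) = (\<Sum>l<d. \<Sum>i<k. v (l, i) * WTx d (munit (l, i)) x m)"
    by (subst sum.cartesian_product) (simp add: case_prod_beta')
  also have "\<dots> = (\<Sum>l<d. v (l, m) * x l)"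
  proof (rule sum.cong[OF refl])
    fix l assume l: "l \<in> {..<d}"
    have "WTx d (munit (l, i)) x m = (if i = m then x l else 0)" for i
    proof -
      have "WTx d (munit (l, i)) x m = (\<Sum>a<d. if a = l then (if i = m then x l else 0) else 0)"
        unfolding WTx_def munit_def by (rule sum.cong) auto
      then show ?thesis using l by simp
    qed
    then have "(\<Sum>i<k. v (l, i) * WTx d (munit (l, i)) x m) = (\<Sum>i<k. if i = m then v (l, m) * x l else 0)"
      by (intro sum.cong refl) simp
    then show "(\<Sum>i<k. v (l, i) * WTx d (munit (l, i)) x m) = v (l, m) * x l" using assms by simp
  qed
  finally show ?thesis by (simp add: WTx_def)
qed

lemma hess_obs_quadratic:
  "(\<Sum>p\<in>{..<d} \<times> {..<k}. \<Sum>q\<in>{..<d} \<times> {..<k}. v p * hess_obs d k W (munit p) (munit q) \<omega> * v q)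
     = hess_obs d k W (\<lambda>l i. v (l, i)) (\<lambda>l i. v (l, i)) \<omega>"
proof -
  obtain x i s where w: "\<omega> = (x, i, s)" by (cases \<omega>)
  let ?P = "{..<d} \<times> {..<k}"
  let ?h = "nll_hess k i s (WTx d W x)"
  have inner: "(\<Sum>q\<in>?P. v q * (\<Sum>n<k. WTx d (munit q) x n * ?h m n)) = (\<Sum>n<k. WTx d (\<lambda>l i. v (l, i)) x n * ?h m n)" for m
  proof -
    have "(\<Sum>q\<in>?P. v q * (\<Sum>n<k. WTx d (munit q) x n * ?h m n)) = (\<Sum>q\<in>?P. \<Sum>n<k. (v q * WTx d (munit q) x n) * ?h m n)"
      by (simp add: sum_distrib_left mult.assoc)
    also have "\<dots> = (\<Sum>n<k. (\<Sum>q\<in>?P. v q * WTx d (munit q) x n) * ?h m n)"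
      by (subst sum.swap) (simp add: sum_distrib_right)
    also have "\<dots> = (\<Sum>n<k. WTx d (\<lambda>l i. v (l, i)) x n * ?h m n)"
      by (rule sum.cong[OF refl]) (simp only: WTx_munit_sum lessThan_iff)
    finally show ?thesis .
  qed
  have "(\<Sum>p\<in>?P. \<Sum>q\<in>?P. v p * hess_obs d k W (munit p) (munit q) \<omega> * v q)
    = (\<Sum>p\<in>?P. \<Sum>q\<in>?P. \<Sum>m<k. v p * WTx d (munit p) x m * (v q * (\<Sum>n<k. WTx d (munit q) x n * ?h m n)))"
    unfolding w hess_obs_def prod.case sum_distrib_left sum_distrib_right
    by (intro sum.cong refl) (simp only: mult_ac)
  also have "\<dots> = (\<Sum>p\<in>?P. \<Sum>m<k. v p * WTx d (munit p) x m * (\<Sum>q\<in>?P. v q * (\<Sum>n<k. WTx d (munit q) x n * ?h m n)))"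
    by (rule sum.cong[OF refl], subst sum.swap) (simp only: sum_distrib_left)
  also have "\<dots> = (\<Sum>m<k. (\<Sum>p\<in>?P. v p * WTx d (munit p) x m) * (\<Sum>n<k. WTx d (\<lambda>l i. v (l, i)) x n * ?h m n))"
    unfolding inner by (subst sum.swap) (simp only: sum_distrib_right)
  also have "\<dots> = hess_obs d k W (\<lambda>l i. v (l, i)) (\<lambda>l i. v (l, i)) \<omega>"
    unfolding w hess_obs_def prod.case by (rule sum.cong[OF refl]) (simp only: WTx_munit_sum lessThan_iff)
  finally show ?thesis .
qed

lemma hessian_psdI:
  assumes k: "2 \<le> k"
    and pos: "\<And>U. 0 \<le> integral\<^sup>L (auction_model d k Ws) (hess_obs d k W U U)"
  shows "hessian_psd d k (popNLL d k Ws) W"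
proof -
  let ?M = "auction_model d k Ws" and ?F = "popNLL d k Ws" and ?P = "{..<d} \<times> {..<k}"
  have D: "((\<lambda>t. ?F (shift U p t)) has_real_derivative integral\<^sup>L ?M (grad_obs d k U (munit p))) (at 0)" for U p
    unfolding shift_eq_madd by (rule has_real_derivative_popNLL[OF k])
  have pd: "partial_deriv ?F U p = integral\<^sup>L ?M (grad_obs d k U (munit p))" for U p
    unfolding partial_deriv_def by (rule DERIV_imp_deriv[OF D])
  define H where "H = (\<lambda>p q. integral\<^sup>L ?M (hess_obs d k W (munit p) (munit q)))"
  have 1: "\<exists>e>0. \<forall>U. frob d k (mdiff U W) < e \<longrightarrow> (\<forall>p\<in>?P. (\<lambda>t. ?F (shift U p t)) differentiable (at 0))"
    using D by (intro exI[of _ 1]) (auto simp: real_differentiable_def)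
  have 2: "((\<lambda>t. partial_deriv ?F (shift W q t) p) has_real_derivative H p q) (at 0)" for p q
    unfolding pd H_def unfolding shift_eq_madd by (rule has_real_derivative_integral_grad_obs[OF k])
  have 3: "0 \<le> (\<Sum>p\<in>?P. \<Sum>q\<in>?P. v p * H p q * v q)" for v
  proof -
    have "(\<Sum>p\<in>?P. \<Sum>q\<in>?P. v p * H p q * v q) = (\<integral>\<omega>. (\<Sum>p\<in>?P. \<Sum>q\<in>?P. v p * hess_obs d k W (munit p) (munit q) \<omega> * v q) \<partial>?M)"
      unfolding H_def using integrable_hess_obs[OF k, of d Ws W]
      by (simp add: Bochner_Integration.integral_sum)
    also have "\<dots> = integral\<^sup>L ?M (hess_obs d k W (\<lambda>l i. v (l, i)) (\<lambda>l i. v (l, i)))"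
      unfolding hess_obs_quadratic ..
    finally show ?thesis using pos by simp
  qed
  show ?thesis unfolding hessian_psd_def using 1 2 3 by blast
qed

section \<open>Local convexity\<close>

lemma exp_mult_minus_one_ge:
  fixes L :: real
  assumes "0 \<le> L"
  shows "L\<^sup>2 / 2 \<le> exp L * (L - 1) + 1"
proof -
  let ?f = "\<lambda>L::real. exp L * (L - 1) + 1 - L\<^sup>2 / 2"
  have "?f 0 \<le> ?f L"
  proof (rule DERIV_nonneg_imp_nondecreasing[OF assms])
    fix z :: real assume z: "0 \<le> z" "z \<le> L"
    have "(?f has_real_derivative z * (exp z - 1)) (at z)"
      by (auto intro!: derivative_eq_intros simp: algebra_simps)
    moreover have "0 \<le> z * (exp z - 1)" using z by simp
    ultimately show "\<exists>y. (?f has_real_derivative y) (at z) \<and> 0 \<le> y" by blast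
  qed
  then show ?thesis by simp
qed

lemma kl_integrand_ge:
  fixes p q :: real
  assumes p: "0 < p" and q: "0 < q"
  shows "min p q * \<bar>ln p - ln q\<bar> ^ 2 / 2 \<le> p * (ln p - ln q) - p + q"
proof (cases "q \<le> p")
  case True
  define L where "L = ln p - ln q"
  have L: "0 \<le> L" using True p q by (simp add: L_def)
  have pe: "p = q * exp L" using p q by (simp add: L_def exp_diff)
  have "q * (L\<^sup>2 / 2) \<le> q * (exp L * (L - 1) + 1)"
    using q exp_mult_minus_one_ge[OF L] by (intro mult_left_mono) simp_all
  also have "\<dots> = p * L - p + q" by (simp add: pe algebra_simps)
  finally have "q * (L\<^sup>2 / 2) \<le> p * L - p + q" .
  moreover have "min p q = q" using True by (rule min_absorb2)
  ultimately show ?thesis using L unfolding L_def[symmetric] by simp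
next
  case False
  define L where "L = ln q - ln p"
  have L: "0 \<le> L" using False p q by (simp add: L_def)
  have qe: "q = p * exp L" using p q by (simp add: L_def exp_diff)
  have "p * (1 + L + L\<^sup>2 / 2) \<le> p * exp L"
    using p exp_lower_Taylor_quadratic[OF L] by (intro mult_left_mono) simp_all
  then have "p * (L\<^sup>2 / 2) \<le> p * (- L) - p + q" by (simp add: qe algebra_simps)
  moreover have "\<bar>ln p - ln q\<bar> ^ 2 = L\<^sup>2" "ln p - ln q = - L" by (simp_all add: L_def power2_commute)
  ultimately show ?thesis using False by (simp add: min_def)
qed

lemma abs_diff_le_ln:
  fixes p q :: real
  assumes "0 < p" "0 < q"
  shows "\<bar>p - q\<bar> \<le> \<bar>ln p - ln q\<bar> * (p + q)"
proof -
  have *: "p - q \<le> p * (ln p - ln q)" if "0 < q" "0 < p" for p q :: real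
  proof -
    have "ln (q / p) \<le> q / p - 1" using that by (intro ln_le_minus_one) auto
    then have "p * ln (q / p) \<le> p * (q / p - 1)" using that by (intro mult_left_mono) auto
    then show ?thesis using that by (simp add: ln_div algebra_simps)
  qed
  have 1: "p * (ln p - ln q) \<le> \<bar>ln p - ln q\<bar> * p" using assms by (subst mult.commute) (intro mult_right_mono, simp_all)
  have 2: "q * (ln q - ln p) \<le> \<bar>ln p - ln q\<bar> * q" using assms by (subst mult.commute) (intro mult_right_mono, simp_all)
  have "0 \<le> \<bar>ln p - ln q\<bar> * p" "0 \<le> \<bar>ln p - ln q\<bar> * q" using assms by simp_all
  then show ?thesis using *[OF assms(2,1)] *[OF assms] 1 2 unfolding distrib_left by linarith
qed

lemma kl_lower_bound:
  assumes C: "1 \<le> C" and k: "2 \<le> k"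
    and V: "\<And>l. l < k \<Longrightarrow> sqrt (colnorm2 d V l) \<le> 2 * C" and W: "\<And>l. l < k \<Longrightarrow> sqrt (colnorm2 d W l) \<le> 2 * C"
  shows "exp (- 30 * (rad C k)\<^sup>2) * (frob d k (mdiff V W))\<^sup>2
    \<le> (\<integral>\<omega>. ln (dens d k V \<omega>) - ln (dens d k W \<omega>) \<partial>auction_model d k V)"
proof -
  obtain j where j: "j < k" "frob d k (mdiff V W) \<le> sqrt (real k) * sqrt (colnorm2 d (mdiff V W) j)"
    using frob_le_max_colnorm[of k d "mdiff V W"] k by auto
  define y where "y = (rad C k)\<^sup>2"
  define \<sigma> where "\<sigma> = sqrt (colnorm2 d (mdiff V W) j)"
  define b where "b = exp (- 22 * y) * (\<sigma> / (288 * y))\<^sup>2 / 2"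
  have y: "32 * (1 + ln (real k)) \<le> y" "32 \<le> y" using rad_sq_ge[OF C k] by (auto simp: y_def)
  let ?p = "dens d k V" and ?q = "dens d k W" and ?M = "auction_model d k V"
  have il: "integrable ?M (\<lambda>\<omega>. ln (?p \<omega>) - ln (?q \<omega>))"
    by (intro Bochner_Integration.integrable_diff integrable_ln_dens[OF k])
  have ml: "(\<lambda>\<omega>. ln (?p \<omega>) - ln (?q \<omega>)) \<in> borel_measurable (obs_space d k)"
    by (intro borel_measurable_diff measurable_ln_dens)
  have ib: "integrable (base d k) (\<lambda>\<omega>. ?p \<omega> * (ln (?p \<omega>) - ln (?q \<omega>)))"
    using il unfolding integrable_auction_model_iff[OF k ml] .
  define h where "h = (\<lambda>\<omega>. ?p \<omega> * (ln (?p \<omega>) - ln (?q \<omega>)) - ?p \<omega> + ?q \<omega>)"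
  have ih: "integrable (base d k) h"
    unfolding h_def by (intro Bochner_Integration.integrable_add Bochner_Integration.integrable_diff ib integrable_dens[OF k])
  have eh: "integral\<^sup>L (base d k) h = (\<integral>\<omega>. ln (?p \<omega>) - ln (?q \<omega>) \<partial>?M)"
    unfolding h_def integral_auction_model[OF k ml] using ib integrable_dens[OF k, of d V] integrable_dens[OF k, of d W] by simp
  have pt: "min (?p \<omega>) (?q \<omega>) * \<bar>ln (?p \<omega>) - ln (?q \<omega>)\<bar> ^ 2 \<le> 2 * h \<omega>" for \<omega>
    using kl_integrand_ge[OF dens_pos[OF k, of d V \<omega>] dens_pos[OF k, of d W \<omega>]] by (simp add: h_def)
  have h0: "0 \<le> 2 * h \<omega>" for \<omega>
    by (rule order.trans[OF _ pt]) simp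
  have "ennreal b \<le> (\<integral>\<^sup>+ \<omega>. ennreal (min (?p \<omega>) (?q \<omega>) * \<bar>ln (?p \<omega>) - ln (?q \<omega>)\<bar> ^ 2) \<partial>base d k)"
    using log_density_gap_integral[OF C k V W j(1), of 2] by (simp add: b_def y_def \<sigma>_def)
  also have "\<dots> \<le> (\<integral>\<^sup>+ \<omega>. ennreal (2 * h \<omega>) \<partial>base d k)"
    by (intro nn_integral_mono ennreal_leI pt)
  also have "\<dots> = ennreal (\<integral>\<omega>. 2 * h \<omega> \<partial>base d k)"
    by (rule nn_integral_eq_integral) (simp_all only: h0 always_eventually simp_thms, intro integrable_mult_right ih)
  finally have "b \<le> (\<integral>\<omega>. 2 * h \<omega> \<partial>base d k)"
    by (subst (asm) ennreal_le_iff) (rule Bochner_Integration.integral_nonneg[OF h0])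
  then have b: "b / 2 \<le> (\<integral>\<omega>. ln (?p \<omega>) - ln (?q \<omega>) \<partial>?M)" using eh by simp
  have "exp (- 30 * y) * (sqrt (real k) * \<sigma>)\<^sup>2 \<le> b / 2"
  proof -
    have 1: "real k \<le> exp y"
    proof -
      have "ln (real k) \<le> y / 32 - 1" using y(1) by (simp add: field_simps)
      then have "ln (real k) \<le> y" using y(2) by linarith
      then have "exp (ln (real k)) \<le> exp y" by simp
      then show ?thesis using k by simp
    qed
    have 2: "y \<le> exp y" using exp_ge_add_one_self[of y] by linarith
    then have 3: "y\<^sup>2 \<le> (exp y)\<^sup>2" using y by (intro power_mono) simp_all
    have 4: "331776 \<le> (exp y) ^ 5"
    proof -
      have "(331776::real) \<le> 32 ^ 5" by simp
      also have "\<dots> \<le> (exp y) ^ 5" using 2 y by (intro power_mono) simp_all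
      finally show ?thesis .
    qed
    have "331776 * (y\<^sup>2 * real k) \<le> (exp y) ^ 5 * ((exp y)\<^sup>2 * exp y)"
      using 1 3 4 by (intro mult_mono) simp_all
    also have "\<dots> = exp (8 * y)" by (simp add: exp_of_nat_mult[symmetric] exp_add[symmetric])
    finally have "exp (- 30 * y) * (331776 * (y\<^sup>2 * real k)) \<le> exp (- 30 * y) * exp (8 * y)" by (intro mult_left_mono) simp_all
    also have "\<dots> = exp (- 22 * y)" by (simp add: exp_add[symmetric])
    finally have "exp (- 30 * y) * (331776 * (y\<^sup>2 * real k)) * \<sigma>\<^sup>2 \<le> exp (- 22 * y) * \<sigma>\<^sup>2" by (intro mult_right_mono) simp_all
    then have "exp (- 30 * y) * (real k * \<sigma>\<^sup>2) * (331776 * y\<^sup>2) \<le> exp (- 22 * y) * \<sigma>\<^sup>2" by (simp only: mult_ac)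
    then have "exp (- 30 * y) * (real k * \<sigma>\<^sup>2) \<le> exp (- 22 * y) * \<sigma>\<^sup>2 / (331776 * y\<^sup>2)" using y by (subst pos_le_divide_eq) simp_all
    also have "\<dots> = b / 2" by (simp add: b_def power_divide power_mult_distrib)
    finally show ?thesis using k by (simp add: power_mult_distrib)
  qed
  moreover have "exp (- 30 * y) * (frob d k (mdiff V W))\<^sup>2 \<le> exp (- 30 * y) * (sqrt (real k) * \<sigma>)\<^sup>2"
    using j(2) by (intro mult_left_mono power_mono) (simp_all add: \<sigma>_def frob_def sum_nonneg)
  ultimately show ?thesis using b unfolding y_def by linarith
qed

lemma second_derivative_ge:
  fixes f G :: "real \<Rightarrow> real"
  assumes f: "\<And>t. (f has_real_derivative G t) (at t)" and G: "(G has_real_derivative B) (at 0)"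
    and r: "0 < r" and ge: "\<And>t. \<bar>t\<bar> < r \<Longrightarrow> f 0 + \<kappa> * t\<^sup>2 \<le> f t"
  shows "2 * \<kappa> \<le> B"
proof (rule ccontr)
  assume "\<not> 2 * \<kappa> \<le> B"
  then have neg: "B - 2 * \<kappa> < 0" by simp
  let ?\<psi> = "\<lambda>t. f t - \<kappa> * t\<^sup>2" and ?K = "\<lambda>t. G t - 2 * \<kappa> * t"
  have d\<psi>: "(?\<psi> has_real_derivative ?K t) (at t)" for t
    by (rule derivative_eq_intros f refl)+ simp
  have "?K 0 = 0"
    by (rule DERIV_local_min[OF d\<psi> r]) (use ge in \<open>auto simp: algebra_simps\<close>)
  have dK: "(?K has_real_derivative (B - 2 * \<kappa>)) (at 0)"
    by (rule derivative_eq_intros G refl)+ simp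
  obtain e where e: "0 < e" "\<And>h. 0 < h \<Longrightarrow> h < e \<Longrightarrow> ?K (0 + h) < ?K 0"
    using DERIV_neg_dec_right[OF dK neg] by blast
  define h where "h = min e r / 2"
  have h: "0 < h" "h < e" "h < r" using e r by (auto simp: h_def)
  have "\<exists>z. 0 < z \<and> z < h \<and> ?\<psi> h - ?\<psi> 0 = (h - 0) * ?K z"
    by (rule MVT2[OF h(1), of ?\<psi> ?K]) (rule d\<psi>)
  then obtain z where z: "0 < z" "z < h" "?\<psi> h - ?\<psi> 0 = (h - 0) * ?K z" by blast
  have "?K z < 0" using e(2)[of z] z h \<open>?K 0 = 0\<close> by simp
  then have "(h - 0) * ?K z < 0" using h by (simp add: mult_pos_neg)
  moreover have "0 \<le> ?\<psi> h - ?\<psi> 0" using ge[of h] h by simp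
  ultimately show False using z by linarith
qed

lemma frob_eq_L2: "frob d k D = L2_set (\<lambda>(l, i). D l i) ({..<d} \<times> {..<k})"
  unfolding frob_def L2_set_def by (subst sum.cartesian_product) (simp add: case_prod_beta')

lemma frob_nonneg [simp]: "0 \<le> frob d k D"
  by (simp add: frob_def sum_nonneg)

lemma frob_madd_le: "frob d k (mdiff (madd W t U) V) \<le> frob d k (mdiff W V) + \<bar>t\<bar> * frob d k U"
proof -
  have "frob d k (mdiff (madd W t U) V) = L2_set (\<lambda>p. (\<lambda>(l, i). mdiff W V l i) p + (\<lambda>(l, i). t * U l i) p) ({..<d} \<times> {..<k})"
    unfolding frob_eq_L2 by (rule L2_set_cong) (auto simp: mdiff_def madd_def)
  also have "\<dots> \<le> L2_set (\<lambda>(l, i). mdiff W V l i) ({..<d} \<times> {..<k}) + L2_set (\<lambda>(l, i). t * U l i) ({..<d} \<times> {..<k})"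
    by (rule L2_set_triangle_ineq)
  also have "L2_set (\<lambda>(l, i). t * U l i) ({..<d} \<times> {..<k}) = \<bar>t\<bar> * frob d k U"
    unfolding frob_def L2_set_def
    by (subst sum.cartesian_product) (simp add: case_prod_beta' power_mult_distrib sum_distrib_left[symmetric] real_sqrt_mult)
  finally show ?thesis unfolding frob_eq_L2 .
qed

lemma frob_mdiff_madd: "(frob d k (mdiff W (madd W t U)))\<^sup>2 = t\<^sup>2 * (frob d k U)\<^sup>2"
  by (simp add: frob_def mdiff_def madd_def sum_nonneg power_mult_distrib sum_distrib_left)

lemma fisher_information_lower:
  assumes C: "1 \<le> C" and k: "2 \<le> k" and r: "0 < r"
    and cols: "\<And>t l. \<bar>t\<bar> < r \<Longrightarrow> l < k \<Longrightarrow> sqrt (colnorm2 d (madd W t U) l) \<le> 2 * C"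
  shows "2 * (exp (- 30 * (rad C k)\<^sup>2) * (frob d k U)\<^sup>2) \<le> integral\<^sup>L (auction_model d k W) (hess_obs d k W U U)"
proof (rule second_derivative_ge[OF _ has_real_derivative_integral_grad_obs[OF k] r])
  let ?M = "auction_model d k W"
  interpret prob_space ?M by (rule prob_space_auction_model[OF k])
  fix t :: real
  have "((\<lambda>h. popNLL d k W (madd (madd W t U) h U)) has_real_derivative integral\<^sup>L ?M (grad_obs d k (madd W t U) U)) (at 0)"
    by (rule has_real_derivative_popNLL[OF k])
  moreover have "madd (madd W t U) h U = madd W (h + t) U" for h
    by (auto simp: madd_def fun_eq_iff algebra_simps)
  ultimately show "((\<lambda>t. popNLL d k W (madd W t U)) has_real_derivative integral\<^sup>L ?M (grad_obs d k (madd W t U) U)) (at t)"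
    using DERIV_shift[of "\<lambda>t. popNLL d k W (madd W t U)" _ 0 t] by simp
  assume t: "\<bar>t\<bar> < r"
  have W: "sqrt (colnorm2 d W l) \<le> 2 * C" if "l < k" for l using cols[of 0 l] r that by simp
  have "exp (- 30 * (rad C k)\<^sup>2) * (frob d k U)\<^sup>2 * t\<^sup>2 = exp (- 30 * (rad C k)\<^sup>2) * (frob d k (mdiff W (madd W t U)))\<^sup>2"
    by (simp add: frob_mdiff_madd)
  also have "\<dots> \<le> (\<integral>\<omega>. ln (dens d k W \<omega>) - ln (dens d k (madd W t U) \<omega>) \<partial>?M)"
    by (rule kl_lower_bound[OF C k W cols[OF t]])
  also have "\<dots> = popNLL d k W (madd W t U) - popNLL d k W W"
    unfolding popNLL_eq[OF k] using integrable_ln_dens[OF k, of d W W] integrable_ln_dens[OF k, of d W "madd W t U"] by simp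
  finally show "popNLL d k W (madd W 0 U) + exp (- 30 * (rad C k)\<^sup>2) * (frob d k U)\<^sup>2 * t\<^sup>2 \<le> popNLL d k W (madd W t U)" by simp
qed

definition obs_scale :: "nat \<Rightarrow> nat \<Rightarrow> (nat \<Rightarrow> nat \<Rightarrow> real) \<Rightarrow> (nat \<Rightarrow> nat \<Rightarrow> real) \<Rightarrow> (nat \<Rightarrow> real) \<times> nat \<times> real \<Rightarrow> real" where
  "obs_scale d k V W = (\<lambda>(x, i, s). nll_scale k s (WTx d V x) + nll_scale k s (WTx d W x))"

definition lin_scale :: "nat \<Rightarrow> nat \<Rightarrow> (nat \<Rightarrow> nat \<Rightarrow> real) \<Rightarrow> (nat \<Rightarrow> real) \<times> nat \<times> real \<Rightarrow> real" where
  "lin_scale d k U = (\<lambda>(x, i, s). \<Sum>m<k. \<bar>WTx d U x m\<bar>)"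

lemma measurable_lin_scale: "lin_scale d k U \<in> borel_measurable (obs_space d k)"
  by (rule borel_measurable_obsI)
     (unfold lin_scale_def split_beta' fst_conv snd_conv, intro borel_measurable_sum borel_measurable_abs measurable_WTx_fst)

lemma measurable_obs_scale: "obs_scale d k V W \<in> borel_measurable (obs_space d k)"
  by (rule borel_measurable_obsI)
     (unfold obs_scale_def nll_scale_def split_beta' fst_conv snd_conv,
      intro borel_measurable_add borel_measurable_sum borel_measurable_abs borel_measurable_const measurable_WTx_fst measurable_snd)

lemma sum_moment6_WTx:
  "(\<integral>\<omega>. (\<Sum>m<k. \<bar>WTx d U (fst \<omega>) m\<bar> ^ 6) \<partial>noise d k) = (\<Sum>m<k. 15 * sqrt (colnorm2 d U m) ^ 6)"
  by (subst Bochner_Integration.integral_sum) (rule moment6_WTx(1), simp only: moment6_WTx(2))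

lemma moment6_lin_scale:
  assumes k: "2 \<le> k" and u: "0 < u" "frob d k U \<le> u"
  shows "integrable (auction_model d k W) (\<lambda>\<omega>. (lin_scale d k U \<omega> / u) ^ 6)"
    and "(\<integral>\<omega>. (lin_scale d k U \<omega> / u) ^ 6 \<partial>auction_model d k W) \<le> 15 * real k ^ 7"
proof -
  let ?G = "\<lambda>\<omega>. real k ^ 6 * (\<Sum>m<k. \<bar>WTx d U (fst \<omega>) m\<bar> ^ 6) / u ^ 6"
  have iG: "integrable (noise d k) ?G"
    by (intro integrable_divide integrable_mult_right Bochner_Integration.integrable_sum moment6_WTx)
  have m: "(\<lambda>\<omega>. (lin_scale d k U \<omega> / u) ^ 6) \<in> borel_measurable (obs_space d k)"
    by (intro borel_measurable_power borel_measurable_divide measurable_lin_scale borel_measurable_const)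
  have le: "(lin_scale d k U (model_map d k W \<omega>) / u) ^ 6 \<le> ?G \<omega>" for \<omega>
  proof -
    have "lin_scale d k U (model_map d k W \<omega>) ^ 6 \<le> real k ^ 6 * (\<Sum>m<k. \<bar>WTx d U (fst \<omega>) m\<bar> ^ 6)"
      using power6_sum_le[of "{..<k}" "\<lambda>m. WTx d U (fst \<omega>) m"] by (simp add: lin_scale_def model_map_def case_prod_beta')
    then show ?thesis unfolding power_divide using u by (intro divide_right_mono) simp_all
  qed
  have pos: "0 \<le> (lin_scale d k U (model_map d k W \<omega>) / u) ^ 6" for \<omega>
    by simp
  have i: "integrable (noise d k) (\<lambda>\<omega>. (lin_scale d k U (model_map d k W \<omega>) / u) ^ 6)"
    by (rule Bochner_Integration.integrable_bound[OF iG measurable_compose[OF measurable_model_map[OF k] m]])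
       (rule AE_I2, use le pos in \<open>simp only: real_norm_def abs_of_nonneg order.trans[OF pos le]\<close>)
  show "integrable (auction_model d k W) (\<lambda>\<omega>. (lin_scale d k U \<omega> / u) ^ 6)"
    unfolding auction_model_eq using i by (subst integrable_distr_eq[OF measurable_model_map[OF k] m])
  have "(\<integral>\<omega>. (lin_scale d k U \<omega> / u) ^ 6 \<partial>auction_model d k W) = (\<integral>\<omega>. (lin_scale d k U (model_map d k W \<omega>) / u) ^ 6 \<partial>noise d k)"
    unfolding auction_model_eq by (rule integral_distr[OF measurable_model_map[OF k] m])
  also have "\<dots> \<le> integral\<^sup>L (noise d k) ?G" by (rule integral_mono[OF i iG le])
  also have "\<dots> = real k ^ 6 * (\<Sum>m<k. 15 * sqrt (colnorm2 d U m) ^ 6) / u ^ 6"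
    by (simp only: integral_divide_zero integral_mult_right_zero sum_moment6_WTx)
  also have "\<dots> \<le> real k ^ 6 * (\<Sum>m<k. 15 * u ^ 6) / u ^ 6"
  proof (intro divide_right_mono mult_left_mono sum_mono power_mono)
    show "sqrt (colnorm2 d U m) \<le> u" if "m \<in> {..<k}" for m
      using colnorm_le_frob[of m k d U] that u by simp
  qed (use u in \<open>simp_all add: colnorm2_def sum_nonneg\<close>)
  also have "\<dots> = 15 * real k ^ 7" using u by (simp add: power_numeral_reduce)
  finally show "(\<integral>\<omega>. (lin_scale d k U \<omega> / u) ^ 6 \<partial>auction_model d k W) \<le> 15 * real k ^ 7" .
qed

lemma moment6_obs_scale:
  assumes k: "2 \<le> k" and C: "1 \<le> C" and W1: "W1 = V \<or> W1 = W"
    and V: "\<And>l. l < k \<Longrightarrow> sqrt (colnorm2 d V l) \<le> 2 * C" and W: "\<And>l. l < k \<Longrightarrow> sqrt (colnorm2 d W l) \<le> 2 * C"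
  shows "integrable (auction_model d k W1) (\<lambda>\<omega>. obs_scale d k V W \<omega> ^ 6)"
    and "(\<integral>\<omega>. obs_scale d k V W \<omega> ^ 6 \<partial>auction_model d k W1) \<le> 4 ^ 12 * 1936 * (real k ^ 7 * C ^ 6)"
proof -
  let ?s = "\<lambda>U \<omega>. real k ^ 6 * (\<Sum>m<k. \<bar>WTx d U (fst \<omega>) m\<bar> ^ 6)"
  let ?n = "\<lambda>\<omega>. real k ^ 6 * (\<Sum>m<k. \<bar>snd \<omega> m\<bar> ^ 6)"
  let ?G = "\<lambda>\<omega>. 4 ^ 12 * (1 + ?s V \<omega> + ?s W \<omega> + ?n \<omega>)"
  interpret D: prob_space "gauss d" by (rule prob_space_PiM_N01)
  interpret K: prob_space "gauss k" by (rule prob_space_PiM_N01)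
  interpret P: pair_prob_space "gauss d" "gauss k" ..
  have isu: "integrable (noise d k) (?s U)" for U
    by (intro integrable_mult_right Bochner_Integration.integrable_sum moment6_WTx)
  have in1: "integrable (noise d k) (\<lambda>\<omega>. \<bar>snd \<omega> m\<bar> ^ 6)" "(\<integral>\<omega>. \<bar>snd \<omega> m\<bar> ^ 6 \<partial>noise d k) = 15" if "m < k" for m
    using integrable_noise_snd[OF moment6_component(1)[OF that], of d] integral_noise_snd[OF moment6_component(1)[OF that], of d]
      moment6_component(2)[OF that] by simp_all
  have inn: "integrable (noise d k) ?n"
    by (intro integrable_mult_right Bochner_Integration.integrable_sum in1) simp
  have iG: "integrable (noise d k) ?G"
    by (intro integrable_mult_right Bochner_Integration.integrable_add P.integrable_const inn isu)
  have m: "(\<lambda>\<omega>. obs_scale d k V W \<omega> ^ 6) \<in> borel_measurable (obs_space d k)"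
    by (intro borel_measurable_power measurable_obs_scale)
  have le: "obs_scale d k V W (model_map d k W1 \<omega>) ^ 6 \<le> ?G \<omega>" for \<omega>
  proof -
    obtain x \<xi> where w: "\<omega> = (x, \<xi>)" by (cases \<omega>)
    define a where "a = (\<Sum>l<k. \<bar>WTx d V x l\<bar>)"
    define b where "b = (\<Sum>l<k. \<bar>WTx d W x l\<bar>)"
    define e where "e = (\<Sum>l<k. \<bar>\<xi> l\<bar>)"
    have abe: "0 \<le> a" "0 \<le> b" "0 \<le> e" by (auto simp: a_def b_def e_def sum_nonneg)
    let ?y = "\<lambda>i. WTx d W1 x i + \<xi> i"
    have "\<bar>ysmax k ?y\<bar> \<le> (\<Sum>l<k. \<bar>?y l\<bar>)" by (rule abs_ysmax_le[OF k])
    also have "\<dots> \<le> (\<Sum>l<k. \<bar>WTx d W1 x l\<bar> + \<bar>\<xi> l\<bar>)" by (intro sum_mono abs_triangle_ineq)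
    also have "\<dots> = (\<Sum>l<k. \<bar>WTx d W1 x l\<bar>) + e" by (simp add: sum.distrib e_def)
    also have "\<dots> \<le> a + b + e" using W1 abe by (auto simp: a_def b_def)
    finally have ys: "\<bar>ysmax k ?y\<bar> \<le> a + b + e" .
    have "obs_scale d k V W (model_map d k W1 \<omega>) = 4 + 2 * \<bar>ysmax k ?y\<bar> + a + b"
      by (simp add: obs_scale_def nll_scale_def model_map_def w a_def b_def)
    also have "\<dots> \<le> 4 * (1 + a + b + e)" using ys abe by simp
    finally have "obs_scale d k V W (model_map d k W1 \<omega>) ^ 6 \<le> (4 * (1 + a + b + e)) ^ 6"
      by (intro power_mono) (auto simp: obs_scale_def split: prod.split)
    also have "\<dots> = 4 ^ 6 * (1 + a + b + e) ^ 6" by (rule power_mult_distrib)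
    also have "\<dots> \<le> 4 ^ 6 * (4 ^ 6 * (1 + a ^ 6 + b ^ 6 + e ^ 6))"
    proof (rule mult_left_mono)
      have "(\<Sum>i\<in>{0,1,2,3::nat}. \<bar>[1, a, b, e] ! i\<bar>) ^ 6 \<le> real (card {0,1,2,3::nat}) ^ 6 * (\<Sum>i\<in>{0,1,2,3::nat}. \<bar>[1, a, b, e] ! i\<bar> ^ 6)"
        by (rule power6_sum_le) simp
      then show "(1 + a + b + e) ^ 6 \<le> 4 ^ 6 * (1 + a ^ 6 + b ^ 6 + e ^ 6)"
        using abe by (simp add: numeral_2_eq_2 numeral_3_eq_3 add.assoc)
    qed simp
    also have "\<dots> = 4 ^ 12 * (1 + a ^ 6 + b ^ 6 + e ^ 6)" by simp
    also have "\<dots> \<le> ?G \<omega>"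
    proof (intro mult_left_mono add_mono order_refl)
      show "a ^ 6 \<le> ?s V \<omega>" using power6_sum_le[of "{..<k}" "WTx d V x"] by (simp add: a_def w)
      show "b ^ 6 \<le> ?s W \<omega>" using power6_sum_le[of "{..<k}" "WTx d W x"] by (simp add: b_def w)
      show "e ^ 6 \<le> ?n \<omega>" using power6_sum_le[of "{..<k}" \<xi>] by (simp add: e_def w)
    qed simp
    finally show ?thesis .
  qed
  have pos: "0 \<le> obs_scale d k V W (model_map d k W1 \<omega>) ^ 6" for \<omega>
    by simp
  have i: "integrable (noise d k) (\<lambda>\<omega>. obs_scale d k V W (model_map d k W1 \<omega>) ^ 6)"
    by (rule Bochner_Integration.integrable_bound[OF iG measurable_compose[OF measurable_model_map[OF k] m]])
       (rule AE_I2, use le pos in \<open>simp only: real_norm_def abs_of_nonneg order.trans[OF pos le]\<close>)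
  show "integrable (auction_model d k W1) (\<lambda>\<omega>. obs_scale d k V W \<omega> ^ 6)"
    unfolding auction_model_eq using i by (subst integrable_distr_eq[OF measurable_model_map[OF k] m])
  have s: "integral\<^sup>L (noise d k) (?s U) \<le> 15 * 64 * (real k ^ 7 * C ^ 6)"
    if U: "\<And>l. l < k \<Longrightarrow> sqrt (colnorm2 d U l) \<le> 2 * C" for U
  proof -
    have "integral\<^sup>L (noise d k) (?s U) = real k ^ 6 * (\<Sum>m<k. 15 * sqrt (colnorm2 d U m) ^ 6)"
      by (simp only: integral_mult_right_zero sum_moment6_WTx)
    also have "\<dots> \<le> real k ^ 6 * (\<Sum>m<k. 15 * (2 * C) ^ 6)"
    proof (intro mult_left_mono sum_mono power_mono)
      show "sqrt (colnorm2 d U m) \<le> 2 * C" if "m \<in> {..<k}" for m using U that by simp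
    qed (simp_all add: colnorm2_def sum_nonneg)
    also have "\<dots> = 15 * 64 * (real k ^ 7 * C ^ 6)" by (simp add: power_mult_distrib power_numeral_reduce)
    finally show ?thesis .
  qed
  have n: "integral\<^sup>L (noise d k) ?n = 15 * real k ^ 7"
  proof -
    have "integral\<^sup>L (noise d k) (\<lambda>\<omega>. \<Sum>m<k. \<bar>snd \<omega> m\<bar> ^ 6) = (\<Sum>m<k. \<integral>\<omega>. \<bar>snd \<omega> m\<bar> ^ 6 \<partial>noise d k)"
      by (rule Bochner_Integration.integral_sum) (rule in1(1), simp)
    also have "\<dots> = (\<Sum>m<k. 15)" by (rule sum.cong[OF refl]) (rule in1(2), simp)
    finally show ?thesis by (simp only: integral_mult_right_zero) (simp add: power_numeral_reduce)
  qed
  have kC: "1 \<le> real k ^ 7 * C ^ 6" "real k ^ 7 \<le> real k ^ 7 * C ^ 6"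
  proof -
    have "1 \<le> C ^ 6" using C by simp
    then have "real k ^ 7 * 1 \<le> real k ^ 7 * C ^ 6" by (intro mult_left_mono) simp_all
    then show 2: "real k ^ 7 \<le> real k ^ 7 * C ^ 6" by simp
    have "1 \<le> real k ^ 7" using k by simp
    then show "1 \<le> real k ^ 7 * C ^ 6" using 2 by linarith
  qed
  have "(\<integral>\<omega>. obs_scale d k V W \<omega> ^ 6 \<partial>auction_model d k W1) = (\<integral>\<omega>. obs_scale d k V W (model_map d k W1 \<omega>) ^ 6 \<partial>noise d k)"
    unfolding auction_model_eq by (rule integral_distr[OF measurable_model_map[OF k] m])
  also have "\<dots> \<le> integral\<^sup>L (noise d k) ?G" by (rule integral_mono[OF i iG le])
  also have "\<dots> = 4 ^ 12 * (1 + integral\<^sup>L (noise d k) (?s V) + integral\<^sup>L (noise d k) (?s W) + integral\<^sup>L (noise d k) ?n)"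
  proof -
    have "integral\<^sup>L (noise d k) ?G = 4 ^ 12 * integral\<^sup>L (noise d k) (\<lambda>\<omega>. 1 + ?s V \<omega> + ?s W \<omega> + ?n \<omega>)"
      by (rule integral_mult_right_zero)
    also have "integral\<^sup>L (noise d k) (\<lambda>\<omega>. 1 + ?s V \<omega> + ?s W \<omega> + ?n \<omega>)
      = integral\<^sup>L (noise d k) (\<lambda>\<omega>. 1) + integral\<^sup>L (noise d k) (?s V) + integral\<^sup>L (noise d k) (?s W) + integral\<^sup>L (noise d k) ?n"
      by (simp only: Bochner_Integration.integral_add Bochner_Integration.integrable_add P.integrable_const isu inn)
    also have "integral\<^sup>L (noise d k) (\<lambda>\<omega>. 1 :: real) = 1" using P.prob_space by simp
    finally show ?thesis .
  qed
  also have "\<dots> \<le> 4 ^ 12 * (1936 * (real k ^ 7 * C ^ 6))"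
    by (rule mult_left_mono) (use s[OF V] s[OF W] n kC in linarith, simp)
  finally show "(\<integral>\<omega>. obs_scale d k V W \<omega> ^ 6 \<partial>auction_model d k W1) \<le> 4 ^ 12 * 1936 * (real k ^ 7 * C ^ 6)" by simp
qed

lemma hess_obs_change_of_model:
  assumes k: "2 \<le> k" and C: "1 \<le> C"
    and V: "\<And>l. l < k \<Longrightarrow> sqrt (colnorm2 d V l) \<le> 2 * C" and W: "\<And>l. l < k \<Longrightarrow> sqrt (colnorm2 d W l) \<le> 2 * C"
    and \<tau>: "0 < \<tau>" "frob d k (mdiff W V) \<le> \<tau>" and U: "0 < frob d k U"
  shows "\<bar>integral\<^sup>L (auction_model d k V) (hess_obs d k W U U) - integral\<^sup>L (auction_model d k W) (hess_obs d k W U U)\<bar>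
    \<le> 20 * \<tau> * (frob d k U)\<^sup>2 * (4 * 10 ^ 10 * (real k ^ 7 * C ^ 6))"
proof -
  let ?p = "dens d k V" and ?q = "dens d k W" and ?H = "hess_obs d k W U U"
  define u where "u = frob d k U"
  define R where "R = obs_scale d k V W"
  define \<alpha> where "\<alpha> = (\<lambda>\<omega>. lin_scale d k U \<omega> / u)"
  define \<beta> where "\<beta> = (\<lambda>\<omega>. lin_scale d k (mdiff W V) \<omega> / \<tau>)"
  define c where "c = 10 * \<tau> * u\<^sup>2"
  define T where "T = (\<lambda>\<omega>. c * (R \<omega> ^ 6 + \<alpha> \<omega> ^ 6 + \<beta> \<omega> ^ 6))"
  have u: "0 < u" using U by (simp add: u_def)
  have c: "0 \<le> c" using \<tau> by (simp add: c_def)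
  have mT: "T \<in> borel_measurable (obs_space d k)"
    unfolding T_def R_def \<alpha>_def \<beta>_def
    by (intro borel_measurable_times borel_measurable_add borel_measurable_power borel_measurable_divide borel_measurable_const
        measurable_obs_scale measurable_lin_scale)
  have i\<alpha>: "integrable (auction_model d k W1) (\<lambda>\<omega>. \<alpha> \<omega> ^ 6)" "(\<integral>\<omega>. \<alpha> \<omega> ^ 6 \<partial>auction_model d k W1) \<le> 15 * real k ^ 7" for W1
    unfolding \<alpha>_def by (rule moment6_lin_scale[OF k u], simp add: u_def)+
  have i\<beta>: "integrable (auction_model d k W1) (\<lambda>\<omega>. \<beta> \<omega> ^ 6)" "(\<integral>\<omega>. \<beta> \<omega> ^ 6 \<partial>auction_model d k W1) \<le> 15 * real k ^ 7" for W1
    unfolding \<beta>_def by (rule moment6_lin_scale[OF k \<tau>])+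
  have iR: "integrable (auction_model d k W1) (\<lambda>\<omega>. R \<omega> ^ 6)"
    "(\<integral>\<omega>. R \<omega> ^ 6 \<partial>auction_model d k W1) \<le> 4 ^ 12 * 1936 * (real k ^ 7 * C ^ 6)" if "W1 = V \<or> W1 = W" for W1
    unfolding R_def by (rule moment6_obs_scale[OF k C that V W], assumption, assumption)+
  have iT: "integrable (auction_model d k W1) T" "integral\<^sup>L (auction_model d k W1) T \<le> c * (4 * 10 ^ 10 * (real k ^ 7 * C ^ 6))"
    if W1: "W1 = V \<or> W1 = W" for W1
  proof -
    show "integrable (auction_model d k W1) T"
      unfolding T_def by (intro integrable_mult_right Bochner_Integration.integrable_add iR[OF W1] i\<alpha> i\<beta>)
    have "integral\<^sup>L (auction_model d k W1) T = c * ((\<integral>\<omega>. R \<omega> ^ 6 \<partial>auction_model d k W1) + (\<integral>\<omega>. \<alpha> \<omega> ^ 6 \<partial>auction_model d k W1) + (\<integral>\<omega>. \<beta> \<omega> ^ 6 \<partial>auction_model d k W1))"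
      unfolding T_def
      by (simp only: integral_mult_right_zero Bochner_Integration.integral_add Bochner_Integration.integrable_add iR[OF W1] i\<alpha> i\<beta>)
    also have "\<dots> \<le> c * (4 * 10 ^ 10 * (real k ^ 7 * C ^ 6))"
    proof (rule mult_left_mono[OF _ c])
      have "1 \<le> C ^ 6" using C by simp
      then have kC: "real k ^ 7 * 1 \<le> real k ^ 7 * C ^ 6" by (intro mult_left_mono) simp_all
      show "(\<integral>\<omega>. R \<omega> ^ 6 \<partial>auction_model d k W1) + (\<integral>\<omega>. \<alpha> \<omega> ^ 6 \<partial>auction_model d k W1) + (\<integral>\<omega>. \<beta> \<omega> ^ 6 \<partial>auction_model d k W1)
        \<le> 4 * 10 ^ 10 * (real k ^ 7 * C ^ 6)"
      proof -
        have "0 \<le> real k ^ 7" by simp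
        moreover have "4 ^ 12 * 1936 * (real k ^ 7 * C ^ 6) = 32480690176 * (real k ^ 7 * C ^ 6)"
          "4 * 10 ^ 10 * (real k ^ 7 * C ^ 6) = 40000000000 * (real k ^ 7 * C ^ 6)" by simp_all
        ultimately show ?thesis using iR(2)[OF W1] i\<alpha>(2)[of W1] i\<beta>(2)[of W1] kC by linarith
      qed
    qed
    finally show "integral\<^sup>L (auction_model d k W1) T \<le> c * (4 * 10 ^ 10 * (real k ^ 7 * C ^ 6))" .
  qed
  have bound: "\<bar>ln (?p \<omega>) - ln (?q \<omega>)\<bar> * \<bar>?H \<omega>\<bar> \<le> T \<omega>" if sp: "\<omega> \<in> space (base d k)" for \<omega>
  proof -
    obtain x i s where w: "\<omega> = (x, i, s)" "i < k" using sp by (auto simp: space_base space_obs_space)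
    let ?A = "lin_scale d k U \<omega>" and ?D = "lin_scale d k (mdiff W V) \<omega>"
    have R: "nll_scale k s (WTx d W x) + nll_scale k s (WTx d V x) = R \<omega>" by (simp add: R_def obs_scale_def w)
    have D: "(\<Sum>l<k. \<bar>WTx d V x l - WTx d W x l\<bar>) = ?D" by (simp add: lin_scale_def w WTx_mdiff abs_minus_commute)
    have A: "(\<Sum>l<k. \<bar>WTx d U x l\<bar>) = ?A" by (simp add: lin_scale_def w)
    have R0: "0 \<le> R \<omega>" unfolding R[symmetric] by simp
    have A0: "0 \<le> ?A" "0 \<le> ?D" by (simp_all add: lin_scale_def w sum_nonneg)
    have "\<bar>ln (?p \<omega>) - ln (?q \<omega>)\<bar> = \<bar>nll k i s (WTx d V x) - nll k i s (WTx d W x)\<bar>" by (simp add: dens_def nll_def w abs_minus_commute)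
    also have "\<dots> \<le> 2 * R \<omega> * ?D" using nll_lipschitz[OF k w(2), of s "WTx d V x" "WTx d W x"] unfolding R D .
    finally have 1: "\<bar>ln (?p \<omega>) - ln (?q \<omega>)\<bar> \<le> 2 * R \<omega> * ?D" .
    have "\<bar>?H \<omega>\<bar> \<le> 5 * (nll_scale k s (WTx d W x))\<^sup>2 * (?A * ?A)"
      using abs_hess_obs_le[OF k w(2), of d W U U x s] unfolding A w(1)[symmetric] .
    also have "\<dots> \<le> 5 * (R \<omega>)\<^sup>2 * (?A * ?A)"
      by (intro mult_right_mono mult_left_mono power_mono) (simp_all add: R[symmetric])
    finally have 2: "\<bar>?H \<omega>\<bar> \<le> 5 * (R \<omega>)\<^sup>2 * (?A * ?A)" .
    have "\<bar>ln (?p \<omega>) - ln (?q \<omega>)\<bar> * \<bar>?H \<omega>\<bar> \<le> (2 * R \<omega> * ?D) * (5 * (R \<omega>)\<^sup>2 * (?A * ?A))"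
      using 1 2 R0 A0 by (intro mult_mono) simp_all
    also have "\<dots> = c * (R \<omega> ^ 3 * \<alpha> \<omega> ^ 2 * \<beta> \<omega>)"
      using u \<tau> by (simp add: c_def \<alpha>_def \<beta>_def power2_eq_square power3_eq_cube)
    also have "\<dots> \<le> c * (R \<omega> ^ 6 + \<alpha> \<omega> ^ 6 + \<beta> \<omega> ^ 6)"
    proof (rule mult_left_mono[OF _ c])
      define m where "m = max (R \<omega>) (max (\<alpha> \<omega>) (\<beta> \<omega>))"
      have nn: "0 \<le> \<alpha> \<omega>" "0 \<le> \<beta> \<omega>" using A0 u \<tau> by (simp_all add: \<alpha>_def \<beta>_def)
      have le: "R \<omega> \<le> m" "\<alpha> \<omega> \<le> m" "\<beta> \<omega> \<le> m" by (auto simp: m_def)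
      have "R \<omega> ^ 3 * \<alpha> \<omega> ^ 2 * \<beta> \<omega> \<le> m ^ 3 * m ^ 2 * m"
        using nn R0 le by (intro mult_mono power_mono mult_nonneg_nonneg zero_le_power) linarith+
      also have "\<dots> = m ^ 6" by (simp add: power_numeral_reduce)
      also have "\<dots> \<le> R \<omega> ^ 6 + \<alpha> \<omega> ^ 6 + \<beta> \<omega> ^ 6"
        unfolding m_def max_def by simp
      finally show "R \<omega> ^ 3 * \<alpha> \<omega> ^ 2 * \<beta> \<omega> \<le> R \<omega> ^ 6 + \<alpha> \<omega> ^ 6 + \<beta> \<omega> ^ 6" .
    qed
    finally show ?thesis by (simp add: T_def)
  qed
  have ip: "integrable (base d k) (\<lambda>\<omega>. dens d k W1 \<omega> * ?H \<omega>)" for W1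
    using integrable_hess_obs[OF k, of d W1 W U U] unfolding integrable_auction_model_iff[OF k measurable_hess_obs] .
  have iTb: "integrable (base d k) (\<lambda>\<omega>. dens d k W1 \<omega> * T \<omega>)" if "W1 = V \<or> W1 = W" for W1
    using iT(1)[OF that] unfolding integrable_auction_model_iff[OF k mT] .
  have "\<bar>integral\<^sup>L (auction_model d k V) ?H - integral\<^sup>L (auction_model d k W) ?H\<bar>
    = \<bar>\<integral>\<omega>. ?p \<omega> * ?H \<omega> - ?q \<omega> * ?H \<omega> \<partial>base d k\<bar>"
    unfolding integral_auction_model[OF k measurable_hess_obs] using ip by simp
  also have "\<dots> \<le> (\<integral>\<omega>. \<bar>?p \<omega> * ?H \<omega> - ?q \<omega> * ?H \<omega>\<bar> \<partial>base d k)"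
    by (rule integral_abs_bound)
  also have "\<dots> \<le> (\<integral>\<omega>. ?p \<omega> * T \<omega> + ?q \<omega> * T \<omega> \<partial>base d k)"
  proof (rule integral_mono)
    show "integrable (base d k) (\<lambda>\<omega>. \<bar>?p \<omega> * ?H \<omega> - ?q \<omega> * ?H \<omega>\<bar>)"
      by (intro integrable_abs Bochner_Integration.integrable_diff ip)
    show "integrable (base d k) (\<lambda>\<omega>. ?p \<omega> * T \<omega> + ?q \<omega> * T \<omega>)"
      by (intro Bochner_Integration.integrable_add iTb) simp_all
    fix \<omega> assume w: "\<omega> \<in> space (base d k)"
    have "\<bar>?p \<omega> * ?H \<omega> - ?q \<omega> * ?H \<omega>\<bar> = \<bar>?p \<omega> - ?q \<omega>\<bar> * \<bar>?H \<omega>\<bar>"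
      unfolding left_diff_distrib[symmetric] abs_mult ..
    also have "\<dots> \<le> (\<bar>ln (?p \<omega>) - ln (?q \<omega>)\<bar> * (?p \<omega> + ?q \<omega>)) * \<bar>?H \<omega>\<bar>"
      by (intro mult_right_mono abs_diff_le_ln dens_pos[OF k]) simp
    also have "\<dots> = (?p \<omega> + ?q \<omega>) * (\<bar>ln (?p \<omega>) - ln (?q \<omega>)\<bar> * \<bar>?H \<omega>\<bar>)" by (simp only: mult_ac)
    also have "\<dots> \<le> (?p \<omega> + ?q \<omega>) * T \<omega>" by (intro mult_left_mono bound[OF w]) simp
    finally show "\<bar>?p \<omega> * ?H \<omega> - ?q \<omega> * ?H \<omega>\<bar> \<le> ?p \<omega> * T \<omega> + ?q \<omega> * T \<omega>" by (simp only: distrib_right)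
  qed
  also have "\<dots> = integral\<^sup>L (auction_model d k V) T + integral\<^sup>L (auction_model d k W) T"
    unfolding integral_auction_model[OF k mT] using iTb by (intro Bochner_Integration.integral_add) simp_all
  also have "\<dots> \<le> 2 * (c * (4 * 10 ^ 10 * (real k ^ 7 * C ^ 6)))"
    using iT(2)[OF disjI1[OF refl]] iT(2)[OF disjI2[OF refl]] by linarith
  also have "\<dots> = 20 * \<tau> * (frob d k U)\<^sup>2 * (4 * 10 ^ 10 * (real k ^ 7 * C ^ 6))" by (simp add: c_def u_def)
  finally show ?thesis .
qed

lemma hess_obs_zero_direction:
  assumes "frob d k U = 0"
  shows "hess_obs d k W U U = (\<lambda>_. 0)"
proof -
  have "(\<Sum>l<d. \<Sum>i<k. (U l i)\<^sup>2) = 0" using assms by (simp add: frob_def)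
  then have "\<forall>l\<in>{..<d}. (\<Sum>i<k. (U l i)\<^sup>2) = 0" by (subst (asm) sum_nonneg_eq_0_iff) (auto simp: sum_nonneg)
  then have "\<forall>l\<in>{..<d}. \<forall>i\<in>{..<k}. U l i = 0" by (simp add: sum_nonneg_eq_0_iff)
  then have "WTx d U x m = 0" if "m < k" for x m using that by (simp add: WTx_def)
  then show ?thesis by (simp add: hess_obs_def fun_eq_iff)
qed

definition conv_exponent :: "real \<Rightarrow> real" where
  "conv_exponent C = 8 + 960 * C\<^sup>2 + ln (4 * 10 ^ 11 * C ^ 6 * exp (960 * C\<^sup>2)) / ln 2"

lemma conv_exponent_ge:
  assumes "1 \<le> C"
  shows "8 \<le> conv_exponent C"
proof -
  have "1 \<le> 4 * 10 ^ 11 * C ^ 6 * exp (960 * C\<^sup>2)"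
  proof -
    have "1 \<le> C ^ 6" using assms by simp
    then have "1 * 1 \<le> (4 * 10 ^ 11 * C ^ 6) * exp (960 * C\<^sup>2)" by (intro mult_mono) simp_all
    then show ?thesis by simp
  qed
  then have "0 \<le> ln (4 * 10 ^ 11 * C ^ 6 * exp (960 * C\<^sup>2)) / ln 2" by simp
  then show ?thesis unfolding conv_exponent_def by simp
qed

lemma conv_exponent_small:
  assumes C: "1 \<le> C" and k: "2 \<le> k"
  shows "real k powr (- conv_exponent C) * (4 * 10 ^ 11 * (real k ^ 7 * C ^ 6)) \<le> exp (- 30 * (rad C k)\<^sup>2)"
proof -
  define L where "L = ln (real k)"
  define A where "A = 4 * 10 ^ 11 * C ^ 6 * exp (960 * C\<^sup>2)"
  have Ls: "ln 2 \<le> L" using k by (simp add: L_def)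
  have l2: "0 < ln (2::real)" by simp
  have A1: "1 \<le> A"
  proof -
    have "1 \<le> C ^ 6" using C by simp
    then have "1 * 1 \<le> (4 * 10 ^ 11 * C ^ 6) * exp (960 * C\<^sup>2)" by (intro mult_mono) simp_all
    then show ?thesis by (simp add: A_def)
  qed
  then have lnA: "0 \<le> ln A" by simp
  have kL: "real k = exp L" using k by (simp add: L_def)
  have k7: "real k ^ 7 = exp (7 * L)" unfolding kL by (simp add: exp_of_nat_mult[symmetric])
  have C6: "4 * 10 ^ 11 * C ^ 6 = exp (ln A - 960 * C\<^sup>2)"
    using A1 by (simp add: exp_diff) (simp add: A_def)
  have pw: "real k powr (- conv_exponent C) = exp (- conv_exponent C * L)" using k by (simp add: powr_def L_def)
  have "ln A * ln 2 \<le> ln A * L" using lnA Ls by (intro mult_left_mono)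
  then have q: "ln A \<le> ln A / ln 2 * L" using l2 by (simp add: pos_le_divide_eq)
  have "real k powr (- conv_exponent C) * (4 * 10 ^ 11 * (real k ^ 7 * C ^ 6))
    = exp (- conv_exponent C * L) * ((4 * 10 ^ 11 * C ^ 6) * real k ^ 7)" unfolding pw by (simp only: mult_ac)
  also have "\<dots> = exp (- conv_exponent C * L + ((ln A - 960 * C\<^sup>2) + 7 * L))"
    unfolding C6 k7 exp_add[symmetric] ..
  also have "\<dots> \<le> exp (- 30 * (rad C k)\<^sup>2)"
  proof (subst exp_le_cancel_iff)
    have "- 30 * (rad C k)\<^sup>2 = - (960 * C\<^sup>2) - 960 * C\<^sup>2 * L" unfolding rad_sq[OF C k] L_def[symmetric] by (simp add: algebra_simps)
    moreover have "- conv_exponent C * L = - (8 * L) - 960 * C\<^sup>2 * L - ln A / ln 2 * L"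
      unfolding conv_exponent_def A_def[symmetric] by (simp add: algebra_simps)
    moreover have "0 \<le> L" using Ls l2 by linarith
    ultimately show "- conv_exponent C * L + ((ln A - 960 * C\<^sup>2) + 7 * L) \<le> - 30 * (rad C k)\<^sup>2" using q by linarith
  qed
  finally show ?thesis .
qed

lemma local_convexity:
  assumes C: "1 \<le> C" and k: "2 \<le> k" and sep: "sep_bounded d k c C Wstar"
    and W: "frob d k (mdiff W Wstar) \<le> real k powr (- conv_exponent C)"
  shows "hessian_psd d k (popNLL d k Wstar) W"
proof (rule hessian_psdI[OF k])
  fix U
  let ?I = "\<lambda>V. integral\<^sup>L (auction_model d k V) (hess_obs d k W U U)"
  define \<tau> where "\<tau> = real k powr (- conv_exponent C)"
  define u where "u = frob d k U"
  show "0 \<le> ?I Wstar"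
  proof (cases "u = 0")
    case True
    then show ?thesis by (simp add: u_def hess_obs_zero_direction)
  next
    case False
    then have u: "0 < u" using frob_nonneg[of d k U] unfolding u_def by linarith
    have \<tau>0: "0 < \<tau>" using k by (simp add: \<tau>_def)
    have \<tau>1: "\<tau> \<le> 1/2"
    proof -
      have "\<tau> \<le> real k powr (- 1)" unfolding \<tau>_def using k conv_exponent_ge[OF C] by (intro powr_mono) simp_all
      also have "\<dots> = 1 / real k" using k by (simp add: powr_minus_divide)
      also have "\<dots> \<le> 1 / 2" using k by (intro divide_left_mono) simp_all
      finally show ?thesis .
    qed
    have W\<tau>: "frob d k (mdiff W Wstar) \<le> \<tau>" using W by (simp add: \<tau>_def)
    have colS: "sqrt (colnorm2 d Wstar l) \<le> C" if "l < k" for l using sep that by (simp add: sep_bounded_def)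
    have cols: "sqrt (colnorm2 d (madd W t U) l) \<le> 2 * C" if t: "\<bar>t\<bar> < 1 / (2 * u)" and l: "l < k" for t l
    proof (rule colnorm_triangle[OF _ colS[OF l] C l])
      have "\<bar>t\<bar> * u \<le> 1 / (2 * u) * u" using t u by (intro mult_right_mono) simp_all
      also have "\<dots> = 1/2" using u by simp
      finally show "frob d k (mdiff (madd W t U) Wstar) \<le> 1"
        using frob_madd_le[of d k W t U Wstar] W\<tau> \<tau>1 unfolding u_def by linarith
    qed
    have "2 * (exp (- 30 * (rad C k)\<^sup>2) * u\<^sup>2) \<le> ?I W"
      unfolding u_def by (rule fisher_information_lower[OF C k, of "1 / (2 * u)"]) (use u cols in simp_all)
    moreover have "\<bar>?I Wstar - ?I W\<bar> \<le> 20 * \<tau> * u\<^sup>2 * (4 * 10 ^ 10 * (real k ^ 7 * C ^ 6))"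
      unfolding u_def
    proof (rule hess_obs_change_of_model[OF k C])
      show "sqrt (colnorm2 d Wstar l) \<le> 2 * C" if "l < k" for l using colS[OF that] C by linarith
      show "sqrt (colnorm2 d W l) \<le> 2 * C" if "l < k" for l using cols[of 0 l] that u by simp
    qed (use \<tau>0 W\<tau> u in \<open>simp_all add: u_def\<close>)
    moreover have "20 * \<tau> * u\<^sup>2 * (4 * 10 ^ 10 * (real k ^ 7 * C ^ 6)) \<le> 2 * (exp (- 30 * (rad C k)\<^sup>2) * u\<^sup>2)"
    proof -
      have "20 * \<tau> * u\<^sup>2 * (4 * 10 ^ 10 * (real k ^ 7 * C ^ 6)) = 2 * (\<tau> * (4 * 10 ^ 11 * (real k ^ 7 * C ^ 6)) * u\<^sup>2)" by simp
      also have "\<dots> \<le> 2 * (exp (- 30 * (rad C k)\<^sup>2) * u\<^sup>2)"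
        using conv_exponent_small[OF C k] unfolding \<tau>_def by (intro mult_left_mono mult_right_mono) simp_all
      finally show ?thesis .
    qed
    ultimately show ?thesis by linarith
  qed
qed

theorem theorem3p8:
  shows
  "(\<exists>K>0. \<forall>c C. 0 < c \<and> c \<le> 1 \<and> 1 \<le> C \<longrightarrow>
      (\<exists>a>0. \<forall>(d::nat) (k::nat) Wstar. 2 \<le> k \<and> sep_bounded d k c C Wstar \<longrightarrow>
         (\<forall>V W. frob d k (mdiff V Wstar) \<le> a / ln (real k) \<and>
                frob d k (mdiff W Wstar) \<le> a / ln (real k) \<longrightarrow>
            dTV (auction_model d k V) (auction_model d k W)
              \<ge> (c / (exp 1 * real k)) powr (K * C\<^sup>2 / c\<^sup>2) * frob d k (mdiff V W)))) \<and>
   (\<forall>c C. 0 < c \<and> c \<le> 1 \<and> 1 \<le> C \<longrightarrow>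
      (\<exists>\<beta>>0. \<forall>(d::nat) (k::nat) Wstar. 2 \<le> k \<and> sep_bounded d k c C Wstar \<longrightarrow>
         (\<forall>W. frob d k (mdiff W Wstar) \<le> real k powr (- \<beta>) \<longrightarrow>
            hessian_psd d k (popNLL d k Wstar) W)))"
proof (rule conjI)
  show "\<exists>K>0. \<forall>c C. 0 < c \<and> c \<le> 1 \<and> 1 \<le> C \<longrightarrow>
      (\<exists>a>0. \<forall>(d::nat) (k::nat) Wstar. 2 \<le> k \<and> sep_bounded d k c C Wstar \<longrightarrow>
         (\<forall>V W. frob d k (mdiff V Wstar) \<le> a / ln (real k) \<and>
                frob d k (mdiff W Wstar) \<le> a / ln (real k) \<longrightarrow>
            dTV (auction_model d k V) (auction_model d k W)
              \<ge> (c / (exp 1 * real k)) powr (K * C\<^sup>2 / c\<^sup>2) * frob d k (mdiff V W)))"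
  proof (rule exI[of _ 960], intro conjI allI impI)
    fix c C :: real
    assume "0 < c \<and> c \<le> 1 \<and> 1 \<le> C"
    then show "\<exists>a>0. \<forall>(d::nat) (k::nat) Wstar. 2 \<le> k \<and> sep_bounded d k c C Wstar \<longrightarrow>
         (\<forall>V W. frob d k (mdiff V Wstar) \<le> a / ln (real k) \<and>
                frob d k (mdiff W Wstar) \<le> a / ln (real k) \<longrightarrow>
            dTV (auction_model d k V) (auction_model d k W)
              \<ge> (c / (exp 1 * real k)) powr (960 * C\<^sup>2 / c\<^sup>2) * frob d k (mdiff V W))"
      by (intro exI[of _ "ln 2"]) (auto intro!: information_preservation)
  qed simp
  show "\<forall>c C. 0 < c \<and> c \<le> 1 \<and> 1 \<le> C \<longrightarrow>
      (\<exists>\<beta>>0. \<forall>(d::nat) (k::nat) Wstar. 2 \<le> k \<and> sep_bounded d k c C Wstar \<longrightarrow>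
         (\<forall>W. frob d k (mdiff W Wstar) \<le> real k powr (- \<beta>) \<longrightarrow>
            hessian_psd d k (popNLL d k Wstar) W))"
  proof (intro allI impI)
    fix c C :: real
    assume c: "0 < c \<and> c \<le> 1 \<and> 1 \<le> C"
    then have "0 < conv_exponent C" using conv_exponent_ge[of C] by simp
    then show "\<exists>\<beta>>0. \<forall>(d::nat) (k::nat) Wstar. 2 \<le> k \<and> sep_bounded d k c C Wstar \<longrightarrow>
         (\<forall>W. frob d k (mdiff W Wstar) \<le> real k powr (- \<beta>) \<longrightarrow>
            hessian_psd d k (popNLL d k Wstar) W)"
      using c by (intro exI[of _ "conv_exponent C"]) (auto intro: local_convexity)
  qed
qed

end
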